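(* Let $\gamma=(\gamma_1,\ldots,\gamma_N)\in\mathbb{C}^N$ with $\mathrm{Re}(\gamma_i)>0$ for all $i\in I=\{1,\ldots,N\}$. Let $\mathcal{A}$, the relation lattice $\mathbb{L}$ and its basis $\{l^\alpha\}_{\alpha\in J}$, the Lie algebra $\mathfrak{L}_N$, its representation $(\pi_\gamma,\mathcal{V}_\gamma)$, the vector $\phi_R$, the covector $\phi_L$ and the pairing $\langle\,,\,\rangle$ be as described in the context. Then the integral solution $$\Phi_{\gamma}(u)=\int_{\mathbb{R}_+^N}\prod_{i=1}^N\frac{dt_i}{t_i}\,t_i^{\gamma_i}e^{-t_i}\prod_{\alpha\in J}\delta\Big(\prod_{j\in I}u_j^{-l_j^\alpha}t_j^{l_j^\alpha}-1\Big),\qquad u\in\mathbb{R}_+^N,$$ of the GG-system associated with $\mathcal{A}$ is expressed as a matrix element of the $\mathcal{U}(\mathfrak{L}_N)$-representation $(\pi_\gamma,\mathcal{V}_\gamma)$: for all $y=(y_1,\ldots,y_N)\in\mathbb{R}^N$, $$\Phi_\gamma(e^{y_1},\ldots,e^{y_N})=\Big\langle \phi_L,\ \pi_\gamma\Big(e^{\sum_{j=1}^N y_j\mathcal{H}_j}\Big)\phi_R\Big\rangle .$$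
   Context: $\mathbb{R}_+=(0,\infty)$. GKZ datum. $\mathcal{A}=\{a_1,\ldots,a_N\}\subset\mathbb{Z}^m$ is an $N$-element subset generating $\mathbb{Z}^m$ as an abelian group, $a_i=(a_i^1,\ldots,a_i^m)$; $I=\{1,\ldots,N\}$, $J=\{1,\ldots,N-m\}$. The relation lattice is $\mathbb{L}=\{(l_1,\ldots,l_N)\in\mathbb{Z}^N:\ l_1a_1+\cdots+l_Na_N=0\}$, with a fixed $\mathbb{Z}$-basis $l^\alpha=(l^\alpha_1,\ldots,l^\alpha_N)$, $\alpha\in J$. Delta-factors. In logarithmic variables $T_i=\ln t_i$, $\int_{\mathbb{R}_+^N}\prod_i\frac{dt_i}{t_i}F(t)\prod_{\alpha\in J}\delta(\prod_j u_j^{-l^\alpha_j}t_j^{l^\alpha_j}-1)=\int_{\mathbb{R}^N}\prod_i dT_i\,F(e^{T})\prod_{\alpha\in J}\delta(\sum_j l^\alpha_j(T_j-\ln u_j))$, i.e. the value at the point $s=(\sum_j l_j^\alpha\ln u_j)_{\alpha\in J}$ of the continuous density (with respect to Lebesgue measure on $\mathbb{R}^{J}$) of the push-forward of $F(e^T)\,dT$ under $T\mapsto(\sum_j l_j^\alpha T_j)_{\alpha\in J}$. If $J=\emptyset$ there are no delta-factors. GG-system. The GG-system associated with $\mathcal{A}$ is the system for a function $\Phi=\Phi_\gamma(u)$: (1) $\prod_{l_i<0}(-\partial_{u_i}+\gamma_i/u_i)^{-l_i}\Phi=\prod_{l_i>0}(-\partial_{u_i}+\gamma_i/u_i)^{l_i}\Phi$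 for $l\in\mathbb{L}$; (2) $\sum_{i}l_i(\partial_{\gamma_i}-\ln u_i)\Phi=0$ for $l\in\mathbb{L}$; (3) $\sum_i a_i^s u_i\partial_{u_i}\Phi=0$, $1\le s\le m$; (4) $\sum_i a_i^s(e^{\partial_{\gamma_i}}-\gamma_i)\Phi=0$, $1\le s\le m$, where $e^{\partial_{\gamma_i}}$ shifts $\gamma_i$ to $\gamma_i+1$. Lie algebra. $\mathfrak{L}_N$ is generated by a central element $\mathcal{C}$ and $\mathcal{E}_i,\mathcal{F}_i,\mathcal{H}_i$ ($i\in I$) with relations $[\mathcal{E}_i,\mathcal{F}_j]=\mathcal{C}\delta_{ij}$, $[\mathcal{H}_i,\mathcal{E}_j]=-\delta_{ij}\mathcal{E}_j$, $[\mathcal{H}_i,\mathcal{F}_j]=\delta_{ij}\mathcal{F}_j$ (other brackets of generators vanish); $\mathcal{U}(\mathfrak{L}_N)$ is its universal enveloping algebra. Representation. $\mathcal{V}_\gamma$ is the space of smooth functions $f(t)$ on $\mathbb{R}_+^N$ decreasing rapidly with all derivatives at infinity (for all nonnegative integers $n_i,m_i$, $t_1^{n_1}\cdots t_N^{n_N}|\partial_{t_1}^{m_1}\cdots\partial_{t_N}^{m_N}f(t)|\to0$ as $t_i\to\infty$), with $\pi_\gamma(\mathcal{C})=1$, $\pi_\gamma(\mathcal{E}_i)=-\partial_{t_i}$, $\pi_\gamma(\mathcal{F}_i)=-t_i$, $\pi_\gamma(\mathcal{H}_i)=\gamma_i+t_i\partial_{t_i}$. The action of the $\mathcal{H}_i$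 integrates to the group action $\big(\pi_\gamma(e^{\sum_j y_j\mathcal{H}_j})f\big)(t)=e^{\sum_j\gamma_jy_j}f(e^{y_1}t_1,\ldots,e^{y_N}t_N)$. Dual and pairing. The dual $\mathcal{V}_\gamma^\vee$ is realized in generalized functions on $\mathbb{R}_+^N$, with pairing $\langle\phi,\varphi\rangle=\int_{\mathbb{R}_+^N}\prod_i dt_i\,\phi(t)\varphi(t)$ and $\langle\pi_\gamma^\vee(X)\phi,\varphi\rangle=-\langle\phi,\pi_\gamma(X)\varphi\rangle$, so $\pi^\vee_\gamma(\mathcal{F}_i)=t_i$, $\pi^\vee_\gamma(\mathcal{H}_i)=1-\gamma_i+t_i\partial_{t_i}$. Vectors. $\phi_R\in\mathcal{V}_\gamma$ is defined by $\pi_\gamma(\mathcal{E}_i)\phi_R=\phi_R$, $i\in I$; $\phi_L\in\mathcal{V}^\vee_\gamma$ is defined by $\prod_{l_i^\alpha<0}\pi^\vee_\gamma(\mathcal{F}_i)^{-l_i^\alpha}\phi_L=\prod_{l_i^\alpha>0}\pi^\vee_\gamma(\mathcal{F}_i)^{l_i^\alpha}\phi_L$ for $\alpha\in J$ and $\sum_{i=1}^N a_i^s\pi^\vee_\gamma(\mathcal{H}_i)\phi_L=0$ for $1\le s\le m$. They are normalized as $$\phi_R(t)=e^{-\sum_i t_i},\qquad \langle\phi_L,\varphi\rangle=\int_{\mathbb{R}_+^N}\prod_{i\in I}\frac{dt_i}{t_i}\,t_i^{\gamma_i}\prod_{\alpha\in J}\delta\Big(\prod_{j\in I}t_j^{l_j^\alpha}-1\Big)\varphi(t),$$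 the latter for those $\varphi\in\mathcal{V}_\gamma$ for which the integral converges absolutely (the delta-factors here meaning that, with $T_i=\ln t_i$, $\int_{\mathbb{R}_+^N}\prod_i\frac{dt_i}{t_i}F(t)\prod_{\alpha\in J}\delta(\prod_j t_j^{l^\alpha_j}-1)=\int_{\mathbb{R}^N}\prod_i dT_i\,F(e^{T})\prod_{\alpha\in J}\delta(\sum_j l^\alpha_jT_j)$, i.e. the value at the origin $0\in\mathbb{R}^J$ of the continuous density, with respect to Lebesgue measure on $\mathbb{R}^J$, of the push-forward of $F(e^T)\,dT$ under $T\mapsto(\sum_j l_j^\alpha T_j)_{\alpha\in J}$, with $F(t)=\varphi(t)\prod_{i\in I}t_i^{\gamma_i}$). *)

theory Defs
  imports "HOL-Analysis.Analysis"
begin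

section \<open>The GKZ datum\<close>

global_interpretation zvec: module "(*s) :: int \<Rightarrow> int ^ 'k \<Rightarrow> int ^ 'k"
  by unfold_locales (simp_all add: vec_eq_iff distrib_left distrib_right mult.assoc)

text \<open>The set \<open>\<A>\<close> is given by an injective enumeration \<open>a\<close>, with index set \<open>I\<close> the type \<open>'n\<close>
  and \<open>m = CARD('m)\<close>.  Abelian groups are \<open>\<int>\<close>-modules.\<close>

definition gkz_config :: "('n::finite \<Rightarrow> int ^ 'm::finite) \<Rightarrow> bool" where
  "gkz_config a \<longleftrightarrow> inj a \<and> zvec.span (range a) = UNIV"

definition relation_lattice :: "('n::finite \<Rightarrow> int ^ 'm::finite) \<Rightarrow> (int ^ 'n) set" where
  "relation_lattice a = {v. (\<Sum>i\<in>UNIV. v $ i *s a i) = 0}"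

definition lattice_basis :: "(int ^ 'n::finite) set \<Rightarrow> nat set \<Rightarrow> (nat \<Rightarrow> int ^ 'n) \<Rightarrow> bool" where
  "lattice_basis L J l \<longleftrightarrow>
     inj_on l J \<and> zvec.independent (l ` J) \<and> zvec.span (l ` J) = L"


section \<open>Functions on the positive orthant\<close>

text \<open>A function on \<open>\<real>\<^sub>+\<^sup>N\<close> is represented by a function on the whole space, of which only the
  values on the open set \<open>pos_orthant\<close> matter.\<close>

definition pos_orthant :: "(real ^ 'n::finite) set" where
  "pos_orthant = {t. \<forall>i. 0 < t $ i}"

definition vec_exp :: "real ^ 'n::finite \<Rightarrow> real ^ 'n" where
  "vec_exp T = (\<chi> i. exp (T $ i))"

definition vec_ln :: "real ^ 'n::finite \<Rightarrow> real ^ 'n" where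
  "vec_ln t = (\<chi> i. ln (t $ i))"

definition pd :: "'n::finite \<Rightarrow> (real ^ 'n \<Rightarrow> complex) \<Rightarrow> real ^ 'n \<Rightarrow> complex" where
  "pd i f t = vector_derivative (\<lambda>x. f (t + x *\<^sub>R axis i 1)) (at 0)"

text \<open>Iterated partial derivatives are indexed by lists of coordinates, so that no order of
  differentiation is preferred.  A function is smooth iff all of them are differentiable.\<close>

definition pds :: "'n::finite list \<Rightarrow> (real ^ 'n \<Rightarrow> complex) \<Rightarrow> real ^ 'n \<Rightarrow> complex" where
  "pds ks f = foldr pd ks f"

definition smooth :: "(real ^ 'n::finite \<Rightarrow> complex) \<Rightarrow> bool" where
  "smooth f \<longleftrightarrow> (\<forall>ks. pds ks f differentiable_on pos_orthant)"

text \<open>The limit is taken as \<open>t\<close> tends to infinity inside the orthant, that is, as some \<open>t\<^sub>i\<close>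
  tends to infinity, uniformly in the other coordinates.\<close>

definition rapid_space :: "(real ^ 'n::finite \<Rightarrow> complex) set" where
  "rapid_space = {f. smooth f \<and>
     (\<forall>(n :: 'n \<Rightarrow> nat) ks.
        ((\<lambda>t. (\<Prod>i\<in>UNIV. t $ i ^ n i) * norm (pds ks f t)) \<longlongrightarrow> 0)
          (inf at_infinity (principal pos_orthant)))}"


section \<open>Integrals with delta-factors\<close>

definition lattice_map :: "nat set \<Rightarrow> (nat \<Rightarrow> int ^ 'n::finite) \<Rightarrow> real ^ 'n \<Rightarrow> nat \<Rightarrow> real" where
  "lattice_map J l T = (\<lambda>\<alpha>\<in>J. \<Sum>j\<in>UNIV. real_of_int (l \<alpha> $ j) * T $ j)"

text \<open>\<open>\<real>\<^sup>J\<close> is realised as the extensional functions on \<open>J\<close> (with the product topology and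
  the product of Lebesgue measures); for \<open>J = {}\<close> it is a point of mass 1.  The
  push-forward of \<open>G dT\<close> is the complex measure \<open>B \<mapsto> \<integral>\<^bsub>{T. lattice_map J l T \<in> B}\<^esub> G dT\<close>.\<close>

definition is_continuous_density ::
    "nat set \<Rightarrow> (nat \<Rightarrow> int ^ 'n::finite) \<Rightarrow> (real ^ 'n \<Rightarrow> complex) \<Rightarrow> ((nat \<Rightarrow> real) \<Rightarrow> complex) \<Rightarrow> bool"
  where
  "is_continuous_density J l G p \<longleftrightarrow>
     continuous_on (PiE J (\<lambda>_. UNIV)) p \<and>
     integrable (PiM J (\<lambda>_. lborel)) p \<and>
     (\<forall>B\<in>sets (PiM J (\<lambda>_. lborel)).
        set_lebesgue_integral lborel {T. lattice_map J l T \<in> B} G =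
        set_lebesgue_integral (PiM J (\<lambda>_. lborel)) B p)"

text \<open>\<open>has_delta_integral J l F s v\<close>: the integral
  \<open>\<integral> \<Prod>\<^sub>i dT\<^sub>i F(e\<^sup>T) \<Prod>\<^sub>\<alpha> \<delta>(\<Sum>\<^sub>j l\<^sup>\<alpha>\<^sub>j T\<^sub>j - s\<^sub>\<alpha>)\<close> converges absolutely and has the value \<open>v\<close>.\<close>

definition has_delta_integral ::
    "nat set \<Rightarrow> (nat \<Rightarrow> int ^ 'n::finite) \<Rightarrow> (real ^ 'n \<Rightarrow> complex) \<Rightarrow> (nat \<Rightarrow> real) \<Rightarrow> complex \<Rightarrow> bool"
  where
  "has_delta_integral J l F s v \<longleftrightarrow>
     integrable lborel (\<lambda>T. F (vec_exp T)) \<and>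
     (\<exists>p. is_continuous_density J l (\<lambda>T. F (vec_exp T)) p \<and> v = p s)"

definition delta_integral ::
    "nat set \<Rightarrow> (nat \<Rightarrow> int ^ 'n::finite) \<Rightarrow> (real ^ 'n \<Rightarrow> complex) \<Rightarrow> (nat \<Rightarrow> real) \<Rightarrow> complex"
  where
  "delta_integral J l F s = (THE v. has_delta_integral J l F s v)"

definition monomial :: "complex ^ 'n::finite \<Rightarrow> real ^ 'n \<Rightarrow> complex" where
  "monomial \<gamma> t = (\<Prod>i\<in>UNIV. of_real (t $ i) powr (\<gamma> $ i))"

definition Phi_integrand :: "complex ^ 'n::finite \<Rightarrow> real ^ 'n \<Rightarrow> complex" where
  "Phi_integrand \<gamma> t = (\<Prod>i\<in>UNIV. of_real (t $ i) powr (\<gamma> $ i) * exp (- of_real (t $ i)))"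

definition Phi ::
    "nat set \<Rightarrow> (nat \<Rightarrow> int ^ 'n::finite) \<Rightarrow> complex ^ 'n \<Rightarrow> real ^ 'n \<Rightarrow> complex" where
  "Phi J l \<gamma> u = delta_integral J l (Phi_integrand \<gamma>) (lattice_map J l (vec_ln u))"


section \<open>The GG-system\<close>

definition gamma_domain :: "(complex ^ 'n::finite) set" where
  "gamma_domain = {\<gamma>. \<forall>i. 0 < Re (\<gamma> $ i)}"

definition gg_op ::
    "complex ^ 'n::finite \<Rightarrow> 'n \<Rightarrow> (real ^ 'n \<Rightarrow> complex) \<Rightarrow> real ^ 'n \<Rightarrow> complex" where
  "gg_op \<gamma> i f u = - pd i f u + \<gamma> $ i / of_real (u $ i) * f u"

text \<open>The operators \<open>gg_op \<gamma> i\<close> commute on smooth functions; a product of powers of them is written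
  as a composition along a list in which \<open>i\<close> occurs as often as its exponent says.\<close>

definition list_for :: "('n \<Rightarrow> nat) \<Rightarrow> 'n list \<Rightarrow> bool" where
  "list_for e ks \<longleftrightarrow> (\<forall>i. count_list ks i = e i)"

definition gg_solution ::
    "('n::finite \<Rightarrow> int ^ 'm::finite) \<Rightarrow> (complex ^ 'n \<Rightarrow> real ^ 'n \<Rightarrow> complex) \<Rightarrow> bool" where
  "gg_solution a \<Phi> \<longleftrightarrow> (\<forall>\<gamma>\<in>gamma_domain.
     smooth (\<Phi> \<gamma>) \<and>
     (\<forall>u\<in>pos_orthant.
       (\<forall>i. (\<lambda>z. \<Phi> (\<gamma> + axis i z) u) field_differentiable (at 0)) \<and>
       (\<forall>v\<in>relation_lattice a. \<forall>ks ks'.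
          list_for (\<lambda>i. nat (- v $ i)) ks \<longrightarrow> list_for (\<lambda>i. nat (v $ i)) ks' \<longrightarrow>
          foldr (gg_op \<gamma>) ks (\<Phi> \<gamma>) u = foldr (gg_op \<gamma>) ks' (\<Phi> \<gamma>) u) \<and>
       (\<forall>v\<in>relation_lattice a.
          (\<Sum>i\<in>UNIV. of_int (v $ i) *
             (deriv (\<lambda>z. \<Phi> (\<gamma> + axis i z) u) 0 - of_real (ln (u $ i)) * \<Phi> \<gamma> u)) = 0) \<and>
       (\<forall>s. (\<Sum>i\<in>UNIV. of_int (a i $ s) * of_real (u $ i) * pd i (\<Phi> \<gamma>) u) = 0) \<and>
       (\<forall>s. (\<Sum>i\<in>UNIV. of_int (a i $ s) * (\<Phi> (\<gamma> + axis i 1) u - \<gamma> $ i * \<Phi> \<gamma> u)) = 0)))"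


section \<open>The Lie algebra and its representation\<close>

datatype 'n LN_gen = Cgen | Egen 'n | Fgen 'n | Hgen 'n

text \<open>Each bracket of generators is a multiple \<open>c Z\<close> of a generator \<open>Z\<close>, given as the pair \<open>(c, Z)\<close>.\<close>

fun LN_bracket :: "'n LN_gen \<Rightarrow> 'n LN_gen \<Rightarrow> complex \<times> 'n LN_gen" where
  "LN_bracket (Egen i) (Fgen j) = (if i = j then 1 else 0, Cgen)"
| "LN_bracket (Fgen j) (Egen i) = (if i = j then - 1 else 0, Cgen)"
| "LN_bracket (Hgen i) (Egen j) = (if i = j then - 1 else 0, Egen j)"
| "LN_bracket (Egen j) (Hgen i) = (if i = j then 1 else 0, Egen j)"
| "LN_bracket (Hgen i) (Fgen j) = (if i = j then 1 else 0, Fgen j)"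
| "LN_bracket (Fgen j) (Hgen i) = (if i = j then - 1 else 0, Fgen j)"
| "LN_bracket _ _ = (0, Cgen)"

text \<open>\<open>\<U>(\<LL>\<^sub>N)\<close> is the associative algebra with these generators and relations, so a module over
  it is a space with linear operators, one for each generator, that satisfy the relations.
  Functions on the orthant are equal if they agree on \<open>pos_orthant\<close>.\<close>

definition LN_representation ::
    "(real ^ 'n::finite \<Rightarrow> complex) set \<Rightarrow>
     ('n LN_gen \<Rightarrow> (real ^ 'n \<Rightarrow> complex) \<Rightarrow> real ^ 'n \<Rightarrow> complex) \<Rightarrow> bool" where
  "LN_representation V \<rho> \<longleftrightarrow>
     (\<forall>f\<in>V. \<forall>g\<in>V. \<forall>c. (\<lambda>t. c * f t + g t) \<in> V) \<and>
     (\<forall>X. \<forall>f\<in>V. \<rho> X f \<in> V) \<and>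
     (\<forall>X. \<forall>f\<in>V. \<forall>g\<in>V. \<forall>c. \<forall>t\<in>pos_orthant.
        \<rho> X (\<lambda>t. c * f t + g t) t = c * \<rho> X f t + \<rho> X g t) \<and>
     (\<forall>X Y. \<forall>f\<in>V. \<forall>t\<in>pos_orthant.
        \<rho> X (\<rho> Y f) t - \<rho> Y (\<rho> X f) t =
        fst (LN_bracket X Y) * \<rho> (snd (LN_bracket X Y)) f t)"

fun rep ::
    "complex ^ 'n::finite \<Rightarrow> 'n LN_gen \<Rightarrow> (real ^ 'n \<Rightarrow> complex) \<Rightarrow> real ^ 'n \<Rightarrow> complex" where
  "rep \<gamma> Cgen f = f"
| "rep \<gamma> (Egen i) f = (\<lambda>t. - pd i f t)"
| "rep \<gamma> (Fgen i) f = (\<lambda>t. - of_real (t $ i) * f t)"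
| "rep \<gamma> (Hgen i) f = (\<lambda>t. \<gamma> $ i * f t + of_real (t $ i) * pd i f t)"

text \<open>\<open>rep_exp \<gamma> y\<close> is \<open>\<pi>\<^sub>\<gamma>(exp (\<Sum>\<^sub>j y\<^sub>j \<H>\<^sub>j))\<close>; the lemma \<open>rep_exp_integrates\<close> below relates it to
  the operators \<open>\<pi>\<^sub>\<gamma>(\<H>\<^sub>j)\<close>.\<close>

definition rep_exp ::
    "complex ^ 'n::finite \<Rightarrow> real ^ 'n \<Rightarrow> (real ^ 'n \<Rightarrow> complex) \<Rightarrow> real ^ 'n \<Rightarrow> complex" where
  "rep_exp \<gamma> y f t =
     exp (\<Sum>j\<in>UNIV. \<gamma> $ j * of_real (y $ j)) * f (\<chi> j. exp (y $ j) * t $ j)"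


section \<open>The left and right vectors\<close>

definition right_vector :: "complex ^ 'n::finite \<Rightarrow> (real ^ 'n \<Rightarrow> complex) \<Rightarrow> bool" where
  "right_vector \<gamma> \<phi> \<longleftrightarrow>
     \<phi> \<in> rapid_space \<and>
     (\<forall>i. \<forall>t\<in>pos_orthant. rep \<gamma> (Egen i) \<phi> t = \<phi> t) \<and>
     (\<forall>t\<in>pos_orthant. \<phi> t = exp (- (\<Sum>i\<in>UNIV. of_real (t $ i))))"

text \<open>A generalized function \<open>\<phi>\<close> is the functional \<open>f \<mapsto> \<langle>\<phi>, f\<rangle>\<close>.\<close>

type_synonym 'n covector = "(real ^ 'n \<Rightarrow> complex) \<Rightarrow> complex"

definition pairing :: "'n::finite covector \<Rightarrow> (real ^ 'n \<Rightarrow> complex) \<Rightarrow> complex" where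
  "pairing \<phi> f = \<phi> f"

definition dual_rep ::
    "complex ^ 'n::finite \<Rightarrow> 'n LN_gen \<Rightarrow> 'n covector \<Rightarrow> 'n covector" where
  "dual_rep \<gamma> X \<phi> = (\<lambda>f. - pairing \<phi> (rep \<gamma> X f))"

text \<open>\<open>\<phi>\<^sub>L\<close> pairs with those elements of \<open>\<V>\<^sub>\<gamma>\<close> for which the defining integral converges.
  This set is not stable under \<open>\<U>(\<LL>\<^sub>N)\<close>, so the defining equations of \<open>\<phi>\<^sub>L\<close>
  are tested on the largest submodule \<open>left_test \<gamma>\<close> inside it.\<close>

definition left_domain ::
    "nat set \<Rightarrow> (nat \<Rightarrow> int ^ 'n::finite) \<Rightarrow> complex ^ 'n \<Rightarrow> (real ^ 'n \<Rightarrow> complex) set" where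
  "left_domain J l \<gamma> = {f \<in> rapid_space.
     \<exists>v. has_delta_integral J l (\<lambda>t. monomial \<gamma> t * f t) (\<lambda>\<alpha>\<in>J. 0) v}"

definition left_test ::
    "nat set \<Rightarrow> (nat \<Rightarrow> int ^ 'n::finite) \<Rightarrow> complex ^ 'n \<Rightarrow> (real ^ 'n \<Rightarrow> complex) set" where
  "left_test J l \<gamma> = {f. \<forall>Xs. foldr (rep \<gamma>) Xs f \<in> left_domain J l \<gamma>}"

definition left_vector ::
    "('n::finite \<Rightarrow> int ^ 'm::finite) \<Rightarrow> nat set \<Rightarrow> (nat \<Rightarrow> int ^ 'n) \<Rightarrow> complex ^ 'n \<Rightarrow>
     'n covector \<Rightarrow> bool" where
  "left_vector a J l \<gamma> \<phi> \<longleftrightarrow>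
     (\<forall>f\<in>left_test J l \<gamma>.
        (\<forall>\<alpha>\<in>J. \<forall>ks ks'.
           list_for (\<lambda>i. nat (- l \<alpha> $ i)) ks \<longrightarrow> list_for (\<lambda>i. nat (l \<alpha> $ i)) ks' \<longrightarrow>
           pairing (foldr (\<lambda>i. dual_rep \<gamma> (Fgen i)) ks \<phi>) f =
           pairing (foldr (\<lambda>i. dual_rep \<gamma> (Fgen i)) ks' \<phi>) f) \<and>
        (\<forall>s. (\<Sum>i\<in>UNIV. of_int (a i $ s) * pairing (dual_rep \<gamma> (Hgen i) \<phi>) f) = 0)) \<and>
     (\<forall>f\<in>left_domain J l \<gamma>.
        pairing \<phi> f = delta_integral J l (\<lambda>t. monomial \<gamma> t * f t) (\<lambda>\<alpha>\<in>J. 0))"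


section \<open>The group action integrates the action of the \<open>\<H>\<^sub>j\<close>\<close>

lemma has_vector_derivative_pd:
  assumes "(f has_derivative D) (at t)"
  shows "pd i f t = D (axis i 1)"
proof -
  have 1: "((\<lambda>x::real. t + x *\<^sub>R axis i 1) has_derivative (\<lambda>x. x *\<^sub>R axis i 1)) (at 0)"
    by (auto intro!: derivative_eq_intros)
  have D: "(f has_derivative D) (at (t + 0 *\<^sub>R axis i 1))"
    using assms by simp
  have "((\<lambda>x. f (t + x *\<^sub>R axis i 1)) has_derivative (\<lambda>x. D (x *\<^sub>R axis i 1))) (at 0)"
    using has_derivative_compose[OF 1 D] by simp
  moreover have "D (x *\<^sub>R axis i 1) = x *\<^sub>R D (axis i 1)" for x
    using assms has_derivative_linear linear_scale by blast
  ultimately show ?thesis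
    unfolding pd_def has_vector_derivative_def[symmetric]
    by (simp add: vector_derivative_at has_vector_derivative_def)
qed

lemma open_pos_orthant: "open (pos_orthant :: (real ^ 'a::finite) set)"
proof -
  have "open (\<Inter>i::'a. {t :: real ^ 'a. 0 < t $ i})"
    by (intro open_INT ballI open_Collect_less continuous_intros) simp_all
  moreover have "(\<Inter>i::'a. {t :: real ^ 'a. 0 < t $ i}) = pos_orthant"
    by (auto simp: pos_orthant_def)
  ultimately show ?thesis by simp
qed

lemma rep_exp_integrates:
  assumes f: "f \<in> rapid_space" and t: "t \<in> pos_orthant"
  shows "((\<lambda>\<tau>. rep_exp \<gamma> (\<tau> *\<^sub>R y) f t) has_vector_derivative
           (\<Sum>j\<in>UNIV. of_real (y $ j) * rep \<gamma> (Hgen j) (rep_exp \<gamma> (\<tau> *\<^sub>R y) f) t)) (at \<tau>)"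
proof -
  define q where "q r = (\<chi> j. exp (r * y $ j) * t $ j)" for r
  define S where "S = (\<Sum>j\<in>UNIV. \<gamma> $ j * of_real (y $ j))"
  have "q \<tau> \<in> pos_orthant"
    using t by (auto simp: q_def pos_orthant_def)
  moreover have "f differentiable_on pos_orthant"
    using f by (auto simp: rapid_space_def smooth_def pds_def dest: spec[of _ "[]"])
  ultimately have "f differentiable (at (q \<tau>))"
    using open_pos_orthant by (metis at_within_open differentiable_on_def)
  then obtain D where D: "(f has_derivative D) (at (q \<tau>))"
    by (auto simp: differentiable_def)
  have linD: "linear D" using D has_derivative_linear by blast
  have q': "(q has_derivative (\<lambda>x. x *\<^sub>R (\<chi> j. y $ j * q \<tau> $ j))) (at \<tau>)"
    unfolding has_derivative_componentwise_within[of q]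
  proof
    fix b :: "real ^ 'a" assume "b \<in> Basis"
    then obtain k where b: "b = axis k 1" by (auto simp: Basis_vec_def)
    show "((\<lambda>x. q x \<bullet> b) has_derivative (\<lambda>x. (x *\<^sub>R (\<chi> j. y $ j * q \<tau> $ j)) \<bullet> b)) (at \<tau>)"
      unfolding b by (auto simp: inner_axis q_def intro!: derivative_eq_intros)
  qed
  have comp: "((\<lambda>r. f (q r)) has_vector_derivative D (\<chi> j. y $ j * q \<tau> $ j)) (at \<tau>)"
    using has_derivative_compose[OF q' D] linear_scale[OF linD]
    by (simp add: has_vector_derivative_def)
  have E: "((\<lambda>r. exp (of_real r * S)) has_vector_derivative S * exp (of_real \<tau> * S)) (at \<tau>)"
    by (auto intro!: derivative_eq_intros has_vector_derivative_real_field)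
  have lhs: "rep_exp \<gamma> (r *\<^sub>R y) f t = exp (of_real r * S) * f (q r)" for r
    by (simp add: rep_exp_def S_def q_def sum_distrib_left algebra_simps)
  have pdj: "pd j (rep_exp \<gamma> (\<tau> *\<^sub>R y) f) t =
      exp (of_real \<tau> * S) * (exp (\<tau> * y $ j) *\<^sub>R D (axis j 1))" for j
  proof -
    have A: "((\<lambda>x. \<chi> k. exp (\<tau> * y $ k) * x $ k) has_derivative
        (\<lambda>x. \<chi> k. exp (\<tau> * y $ k) * x $ k)) (at t)"
      by (intro linear_imp_has_derivative linearI) (auto simp: vec_eq_iff algebra_simps)
    have B: "((\<lambda>x. exp (of_real \<tau> * S) * f (\<chi> k. exp (\<tau> * y $ k) * x $ k)) has_derivative
        (\<lambda>x. exp (of_real \<tau> * S) * D (\<chi> k. exp (\<tau> * y $ k) * x $ k))) (at t)"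
      by (rule has_derivative_mult_right has_derivative_compose[OF A] | use D in \<open>simp add: q_def\<close>)+
    have C: "rep_exp \<gamma> (\<tau> *\<^sub>R y) f = (\<lambda>x. exp (of_real \<tau> * S) * f (\<chi> k. exp (\<tau> * y $ k) * x $ k))"
      by (auto simp: rep_exp_def S_def sum_distrib_left algebra_simps)
    have ax: "(\<chi> k. exp (\<tau> * y $ k) * axis j 1 $ k) = exp (\<tau> * y $ j) *\<^sub>R axis j (1::real)"
      by (auto simp: vec_eq_iff axis_def)
    show ?thesis
      unfolding C has_vector_derivative_pd[OF B] ax by (simp add: linear_scale[OF linD])
  qed
  have dec: "(\<chi> j. y $ j * q \<tau> $ j) = (\<Sum>j\<in>UNIV. (y $ j * q \<tau> $ j) *\<^sub>R axis j 1)"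
    by (simp add: vec_eq_iff axis_def if_distrib cong: if_cong)
  have Dsum: "D (\<chi> j. y $ j * q \<tau> $ j) = (\<Sum>j\<in>UNIV. (y $ j * q \<tau> $ j) *\<^sub>R D (axis j 1))"
    unfolding dec by (simp add: linear_sum[OF linD] linear_scale[OF linD])
  have "(\<Sum>j\<in>UNIV. of_real (y $ j) * rep \<gamma> (Hgen j) (rep_exp \<gamma> (\<tau> *\<^sub>R y) f) t)
      = exp (of_real \<tau> * S) * D (\<chi> j. y $ j * q \<tau> $ j) + S * exp (of_real \<tau> * S) * f (q \<tau>)"
    unfolding Dsum rep.simps pdj lhs S_def[symmetric]
    by (simp add: q_def S_def sum_distrib_left sum_distrib_right scaleR_conv_of_real
        sum.distrib[symmetric] algebra_simps)
  moreover have "((\<lambda>r. rep_exp \<gamma> (r *\<^sub>R y) f t) has_vector_derivative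
      exp (of_real \<tau> * S) * D (\<chi> j. y $ j * q \<tau> $ j) + S * exp (of_real \<tau> * S) * f (q \<tau>)) (at \<tau>)"
    unfolding lhs using has_vector_derivative_mult[OF E comp] by simp
  ultimately show ?thesis by simp
qed

end

theory Submission
  imports Defs
begin

text \<open>In logarithmic coordinates \<open>T\<close> the integrand of \<open>\<Phi>\<close> is \<open>G(T) = exp (\<Sum>\<^sub>i (\<gamma>\<^sub>i T\<^sub>i - e\<^bsup>T\<^sub>i\<^esup>))\<close>, and the
delta-factors pick out a fibre of the linear map \<open>\<lambda> = lattice_map J l\<close>.  Everything follows once
the value of the delta-integral is written as an integral over that fibre.

\<^bold>\<open>Fibre integrals.\<close>  The \<open>N - m\<close> relation vectors \<open>l\<^sup>\<alpha>\<close> together with integer lifts of the \<open>m\<close> unit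
vectors of \<open>\<int>\<^sup>m\<close> span \<open>\<real>\<^sup>N\<close>, so they form a basis.  In the dual coordinates Lebesgue measure becomes a
product \<open>ds \<otimes> \<nu>\<close> with \<open>\<nu>\<close> carried by the kernel of \<open>\<lambda>\<close> (\<open>lattice_fibre_exists\<close>).  By Fubini
\<open>s \<mapsto> \<integral> G(sec s + T) d\<nu>(T)\<close>, where \<open>sec\<close> is a linear section of \<open>\<lambda>\<close>, is a continuous density of the
push-forward of \<open>G dT\<close>.  Continuous densities are unique, and this also shows that
\<open>\<integral> G(x + T) d\<nu>(T)\<close> depends on \<open>x\<close> through \<open>\<lambda> x\<close> only (\<open>fibre_integral_invariant\<close>).  Hence
\<open>\<Phi>\<^sub>\<gamma>(u) = u\<^sup>\<gamma> I\<^sub>\<gamma>(u)\<close> with \<open>I\<^sub>\<gamma>(u) = \<integral> exp (\<Sum>\<^sub>i (\<gamma>\<^sub>i T\<^sub>i - u\<^sub>i e\<^bsup>T\<^sub>i\<^esup>)) d\<nu>(T)\<close> (\<open>Phi_eq\<close>).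

\<^bold>\<open>Matrix element.\<close>  Acting by the group element on \<open>\<phi>\<^sub>R\<close> and multiplying by the monomial \<open>t\<^sup>\<gamma>\<close> gives
the translate \<open>G(T + y)\<close>.  The density of its push-forward at the origin is
\<open>\<integral> G(y + T) d\<nu>(T) = \<Phi>\<^sub>\<gamma>(e\<^sup>y)\<close> (\<open>translated_delta_integral\<close>).

\<^bold>\<open>GG-system.\<close>  The integral \<open>I\<^sub>\<gamma>(u)\<close> may be differentiated under the integral sign jointly in
\<open>(\<gamma>, u)\<close> (\<open>exp_integral_has_derivative\<close>), with \<open>\<partial>I\<^sub>\<gamma>/\<partial>u\<^sub>i = - I\<^bsub>\<gamma>+e\<^sub>i\<^esub>\<close>.  Conjugated by \<open>u\<^sup>\<gamma>\<close>, the operator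
\<open>-\<partial>\<^bsub>u\<^sub>i\<^esub> + \<gamma>\<^sub>i/u\<^sub>i\<close> becomes \<open>-\<partial>\<^bsub>u\<^sub>i\<^esub>\<close>, that is, the shift of \<open>\<gamma>\<close> by \<open>e\<^sub>i\<close> in the integrand.  A relation \<open>v\<close>
satisfies \<open>v \<cdot> T = 0\<close> on the support of \<open>\<nu>\<close>, which yields the two families of equations indexed
by relations.  The homogeneity equations express that \<open>\<Phi>\<^sub>\<gamma>\<close> depends on \<open>\<lambda>(ln u)\<close> only, and the
difference equations in \<open>\<gamma>\<close> are the homogeneity equations rewritten with the ladder formula
\<open>u\<^sub>i \<partial>\<^bsub>u\<^sub>i\<^esub> \<Phi>\<^sub>\<gamma> = \<gamma>\<^sub>i \<Phi>\<^sub>\<gamma> - \<Phi>\<^bsub>\<gamma>+e\<^sub>i\<^esub>\<close> (\<open>pd_Phi\<close>).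

\<^bold>\<open>Representation.\<close>  The brackets of the operators are the Leibniz rule and the symmetry of mixed
partial derivatives (\<open>pd_commute\<close>); invariance of the space of rapidly decreasing functions is a
coinduction on closure under partial derivatives (\<open>rapid_coinduct\<close>).\<close>

section \<open>Partial derivatives on the positive orthant\<close>

lemma eventually_in_pos_orthant:
  fixes t v :: "real ^ 'n::finite"
  assumes "t \<in> pos_orthant"
  shows "eventually (\<lambda>x. t + x *\<^sub>R v \<in> pos_orthant) (nhds 0)"
proof -
  have "((\<lambda>x::real. t + x *\<^sub>R v) \<longlongrightarrow> t + 0 *\<^sub>R v) (nhds 0)"
    by (intro tendsto_intros filterlim_ident)
  then show ?thesis
    using assms open_pos_orthant by (auto dest: topological_tendstoD)
qed

text \<open>Functions are only meaningful on the orthant, but partial derivatives are taken on the whole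
space; because the orthant is open, values outside it never enter.\<close>

lemma pd_cong:
  assumes "t \<in> pos_orthant" "\<And>s. s \<in> pos_orthant \<Longrightarrow> f s = g s"
  shows "pd i f t = pd i g t"
  unfolding pd_def
  by (rule vector_derivative_cong_eq)
     (use eventually_in_pos_orthant[OF assms(1), of "axis i 1"] assms(2)
      in \<open>auto elim!: eventually_mono\<close>)

lemma differentiable_on_orthant_iff:
  "f differentiable_on pos_orthant \<longleftrightarrow> (\<forall>t\<in>pos_orthant. f differentiable (at t))"
  by (simp add: differentiable_on_def at_within_open[OF _ open_pos_orthant])

lemma differentiable_on_orthant_cong:
  assumes "\<And>t. t \<in> pos_orthant \<Longrightarrow> f t = g t" "g differentiable_on pos_orthant"
  shows "f differentiable_on pos_orthant"
  using assms unfolding differentiable_on_def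
  by (metis differentiable_transform_within zero_less_one)

lemma has_derivative_pd_sum:
  assumes "(f has_derivative D) (at t)"
  shows "D v = (\<Sum>i\<in>UNIV. v $ i *\<^sub>R pd i f t)"
proof -
  have lin: "linear D" using assms has_derivative_linear by blast
  have "v = (\<Sum>i\<in>UNIV. (v $ i) *\<^sub>R axis i 1)"
    by (simp add: vec_eq_iff axis_def if_distrib cong: if_cong)
  then have "D v = D (\<Sum>i\<in>UNIV. (v $ i) *\<^sub>R axis i 1)" by simp
  also have "\<dots> = (\<Sum>i\<in>UNIV. v $ i *\<^sub>R D (axis i 1))"
    by (simp add: linear_sum[OF lin] linear_scale[OF lin])
  finally show ?thesis by (simp add: has_vector_derivative_pd[OF assms])
qed

lemma pd_lincomb:
  assumes "f differentiable (at t)" "g differentiable (at t)"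
  shows "pd i (\<lambda>t. c * f t + g t) t = c * pd i f t + pd i g t"
proof -
  obtain D E where D: "(f has_derivative D) (at t)" and E: "(g has_derivative E) (at t)"
    using assms by (auto simp: differentiable_def)
  have "((\<lambda>t. c * f t + g t) has_derivative (\<lambda>v. c * D v + E v)) (at t)"
    by (intro has_derivative_add has_derivative_mult_right D E)
  from has_vector_derivative_pd[OF this] show ?thesis
    by (simp add: has_vector_derivative_pd[OF D] has_vector_derivative_pd[OF E])
qed

lemma pd_mult:
  assumes "f differentiable (at t)" "g differentiable (at t)"
  shows "pd i (\<lambda>t. f t * g t) t = f t * pd i g t + pd i f t * g t"
proof -
  obtain D E where D: "(f has_derivative D) (at t)" and E: "(g has_derivative E) (at t)"
    using assms by (auto simp: differentiable_def)
  have "((\<lambda>t. f t * g t) has_derivative (\<lambda>v. f t * E v + D v * g t)) (at t)"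
    by (intro has_derivative_mult D E)
  from has_vector_derivative_pd[OF this] show ?thesis
    by (simp add: has_vector_derivative_pd[OF D] has_vector_derivative_pd[OF E])
qed

lemma pd_coordinate:
  fixes t :: "real ^ 'n::finite"
  shows "((\<lambda>t. complex_of_real (t $ j)) has_derivative (\<lambda>v. complex_of_real (v $ j))) (at t)"
    and "pd i (\<lambda>t. complex_of_real (t $ j)) t = (if i = j then 1 else 0)"
proof -
  show d: "((\<lambda>t. complex_of_real (t $ j)) has_derivative (\<lambda>v. complex_of_real (v $ j))) (at t)"
    by (intro has_derivative_of_real bounded_linear_imp_has_derivative bounded_linear_vec_nth)
  show "pd i (\<lambda>t. complex_of_real (t $ j)) t = (if i = j then 1 else 0)"
    by (auto simp: has_vector_derivative_pd[OF d] axis_def)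
qed

lemma coordinate_differentiable:
  "(\<lambda>t::real ^ 'n::finite. complex_of_real (t $ j)) differentiable (at t)"
  using pd_coordinate(1) unfolding differentiable_def by blast

lemma pd_coordinate_mult:
  fixes f :: "real ^ 'n::finite \<Rightarrow> complex"
  assumes "f differentiable (at t)"
  shows "pd i (\<lambda>t. of_real (t $ j) * f t) t = of_real (t $ j) * pd i f t + (if i = j then f t else 0)"
  using pd_mult[OF coordinate_differentiable assms, of i j] by (simp add: pd_coordinate(2))

lemma pd_uminus:
  assumes "f differentiable (at t)"
  shows "pd i (\<lambda>t. - f t) t = - pd i f t"
proof -
  have "pd i (\<lambda>t. 0::complex) t = 0" by (simp add: pd_def)
  then show ?thesis using pd_lincomb[OF assms differentiable_const, of i "-1" 0] by simp
qed

section \<open>Symmetry of mixed partial derivatives\<close>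

definition second_difference :: "(real ^ 'n::finite \<Rightarrow> complex) \<Rightarrow> real ^ 'n \<Rightarrow> 'n \<Rightarrow> 'n \<Rightarrow> real \<Rightarrow> complex"
  where "second_difference f t i j h =
    f (t + h *\<^sub>R axis i 1 + h *\<^sub>R axis j 1) - f (t + h *\<^sub>R axis i 1) - f (t + h *\<^sub>R axis j 1) + f t"

lemma line_in_ball:
  assumes "0 \<le> x" "x \<le> h" "2 * h < r" "0 \<le> c" "c \<le> h"
  shows "norm (x *\<^sub>R axis i 1 + c *\<^sub>R axis j 1 :: real ^ 'n::finite) < r"
    "norm (x *\<^sub>R axis i 1 + c *\<^sub>R axis j 1 :: real ^ 'n::finite) \<le> 2 * h"
proof -
  have "norm (x *\<^sub>R axis i 1 + c *\<^sub>R axis j 1 :: real ^ 'n) \<le> x + c"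
    using norm_triangle_ineq[of "x *\<^sub>R axis i 1 :: real ^ 'n" "c *\<^sub>R axis j 1"] assms by simp
  then show "norm (x *\<^sub>R axis i 1 + c *\<^sub>R axis j 1 :: real ^ 'n) < r"
    "norm (x *\<^sub>R axis i 1 + c *\<^sub>R axis j 1 :: real ^ 'n) \<le> 2 * h"
    using assms by linarith+
qed

text \<open>The estimate behind Young's version of the symmetry theorem, in which the first partial
derivatives are assumed differentiable at the point.  Along the
edge in direction \<open>i\<close> the difference \<open>g(x) = f(t + x e\<^sub>i + h e\<^sub>j) - f(t + x e\<^sub>i)\<close> has a derivative
equal to \<open>h \<partial>\<^sub>j\<partial>\<^sub>i f(t) + o(h)\<close> uniformly for \<open>0 \<le> x \<le> h\<close>, and the mean value inequality integrates
this to \<open>g(h) - g(0) = h\<^sup>2 \<partial>\<^sub>j\<partial>\<^sub>i f(t) + o(h\<^sup>2)\<close>.\<close>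

lemma second_difference_tendsto:
  fixes f :: "real ^ 'n::finite \<Rightarrow> complex"
  assumes t: "t \<in> pos_orthant" and f: "f differentiable_on pos_orthant"
    and f': "pd i f differentiable (at t)"
  shows "((\<lambda>h. second_difference f t i j h / of_real (h\<^sup>2)) \<longlongrightarrow> pd j (pd i f) t) (at_right 0)"
proof (rule tendstoI)
  fix e :: real assume e: "0 < e"
  obtain D where D: "(pd i f has_derivative D) (at t)"
    using f' by (auto simp: differentiable_def)
  have lin: "linear D" using D has_derivative_linear by blast
  have Dj: "pd j (pd i f) t = D (axis j 1)" by (rule has_vector_derivative_pd[OF D])
  have "\<exists>r>0. \<forall>w. norm (w - t) < r \<longrightarrow> norm (pd i f w - pd i f t - D (w - t)) \<le> e / 8 * norm (w - t)"
    using D e unfolding has_derivative_at_alt by (meson divide_pos_pos zero_less_numeral)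
  then obtain r where r: "r > 0"
    "\<And>w. norm w < r \<Longrightarrow> norm (pd i f (t + w) - pd i f t - D w) \<le> e / 8 * norm w"
    by (metis add_diff_cancel_left')
  obtain r' where r': "r' > 0" "ball t r' \<subseteq> pos_orthant"
    using open_pos_orthant t by (meson open_contains_ball)
  have "dist (second_difference f t i j h / of_real (h\<^sup>2)) (pd j (pd i f) t) < e"
    if h: "0 < h" "h < min r r' / 2" for h
  proof -
    define g where "g x = f (t + x *\<^sub>R axis i 1 + h *\<^sub>R axis j 1) - f (t + x *\<^sub>R axis i 1)" for x
    have inS: "t + x *\<^sub>R axis i 1 + c *\<^sub>R axis j 1 \<in> pos_orthant"
      if "0 \<le> x" "x \<le> h" "0 \<le> c" "c \<le> h" for x c
    proof -
      have "norm (x *\<^sub>R axis i 1 + c *\<^sub>R axis j 1 :: real ^ 'n) < r'"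
        using line_in_ball(1)[of x h r' c] that h by simp
      then have "t + (x *\<^sub>R axis i 1 + c *\<^sub>R axis j 1) \<in> ball t r'"
        unfolding mem_ball dist_commute[of t] by (simp add: dist_norm)
      then show ?thesis using r'(2) by (auto simp: add.assoc)
    qed
    have fder: "((\<lambda>x. f (t + x *\<^sub>R axis i 1 + c *\<^sub>R axis j 1)) has_vector_derivative
        pd i f (t + x *\<^sub>R axis i 1 + c *\<^sub>R axis j 1)) (at x)"
      if xc: "0 \<le> x" "x \<le> h" "0 \<le> c" "c \<le> h" for x c
    proof -
      obtain E where E: "(f has_derivative E) (at (t + x *\<^sub>R axis i 1 + c *\<^sub>R axis j 1))"
        using f inS[OF xc] unfolding differentiable_on_orthant_iff differentiable_def by blast
      have 1: "((\<lambda>x. t + x *\<^sub>R axis i 1 + c *\<^sub>R axis j 1) has_derivative (\<lambda>x. x *\<^sub>R axis i 1)) (at x)"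
        by (auto intro!: derivative_eq_intros)
      have "((\<lambda>x. f (t + x *\<^sub>R axis i 1 + c *\<^sub>R axis j 1)) has_derivative (\<lambda>x. E (x *\<^sub>R axis i 1))) (at x)"
        using has_derivative_compose[OF 1 E] .
      then show ?thesis unfolding has_vector_derivative_def has_vector_derivative_pd[OF E]
        using linear_scale[OF has_derivative_linear[OF E]] by simp
    qed
    have gder: "(g has_vector_derivative
        pd i f (t + x *\<^sub>R axis i 1 + h *\<^sub>R axis j 1) - pd i f (t + x *\<^sub>R axis i 1)) (at x within {0..h})"
      if "x \<in> {0..h}" for x
    proof -
      have x: "0 \<le> x" "x \<le> h" using that by auto
      have "((\<lambda>x. f (t + x *\<^sub>R axis i 1)) has_vector_derivative pd i f (t + x *\<^sub>R axis i 1)) (at x)"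
        using fder[OF x, of 0] h by simp
      then show ?thesis unfolding g_def
        using fder[OF x, of h] h
        by (intro has_vector_derivative_at_within[OF has_vector_derivative_diff]) simp_all
    qed
    have bound: "norm (pd i f (t + x *\<^sub>R axis i 1 + h *\<^sub>R axis j 1) - pd i f (t + x *\<^sub>R axis i 1)
        - h *\<^sub>R D (axis j 1)) \<le> e * h / 2" if "x \<in> {0..h}" for x
    proof -
      let ?w = "x *\<^sub>R axis i 1 + h *\<^sub>R axis j 1 :: real ^ 'n" and ?v = "x *\<^sub>R axis i 1 :: real ^ 'n"
      have w: "norm ?w < r" "norm ?w \<le> 2 * h" "norm ?v < r" "norm ?v \<le> 2 * h"
        using line_in_ball[of x h r h i j] line_in_ball[of x h r 0 i j] that h by simp_all
      have "norm (pd i f (t + ?w) - pd i f t - D ?w) \<le> e / 8 * (2 * h)"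
        "norm (pd i f (t + ?v) - pd i f t - D ?v) \<le> e / 8 * (2 * h)"
        using order_trans[OF r(2)[OF w(1)] mult_left_mono[OF w(2)]]
          order_trans[OF r(2)[OF w(3)] mult_left_mono[OF w(4)]] e by simp_all
      moreover have "D ?w - D ?v = h *\<^sub>R D (axis j 1)"
        by (simp add: linear_add[OF lin] linear_scale[OF lin])
      then have eq: "pd i f (t + ?w) - pd i f (t + ?v) - h *\<^sub>R D (axis j 1) =
        (pd i f (t + ?w) - pd i f t - D ?w) - (pd i f (t + ?v) - pd i f t - D ?v)"
        by (simp add: algebra_simps)
      moreover have "norm ((pd i f (t + ?w) - pd i f t - D ?w) - (pd i f (t + ?v) - pd i f t - D ?v))
        \<le> norm (pd i f (t + ?w) - pd i f t - D ?w) + norm (pd i f (t + ?v) - pd i f t - D ?v)"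
        by (rule norm_triangle_ineq4)
      ultimately show ?thesis
        unfolding add.assoc eq by linarith
    qed
    have "norm ((g h - h *\<^sub>R (h *\<^sub>R D (axis j 1))) - (g 0 - 0 *\<^sub>R (h *\<^sub>R D (axis j 1))))
        \<le> e * h / 2 * norm (h - 0)"
    proof (rule differentiable_bound[of "{0..h}"])
      fix x assume x: "x \<in> {0..h}"
      have "((\<lambda>x. g x - x *\<^sub>R (h *\<^sub>R D (axis j 1))) has_vector_derivative
          pd i f (t + x *\<^sub>R axis i 1 + h *\<^sub>R axis j 1) - pd i f (t + x *\<^sub>R axis i 1)
          - h *\<^sub>R D (axis j 1)) (at x within {0..h})"
        by (rule derivative_eq_intros gder[OF x] refl | simp)+
      then show "((\<lambda>x. g x - x *\<^sub>R (h *\<^sub>R D (axis j 1))) has_derivative (\<lambda>k. k *\<^sub>R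
          (pd i f (t + x *\<^sub>R axis i 1 + h *\<^sub>R axis j 1) - pd i f (t + x *\<^sub>R axis i 1)
          - h *\<^sub>R D (axis j 1)))) (at x within {0..h})"
        by (simp add: has_vector_derivative_def)
      show "onorm (\<lambda>k. k *\<^sub>R (pd i f (t + x *\<^sub>R axis i 1 + h *\<^sub>R axis j 1) - pd i f (t + x *\<^sub>R axis i 1)
          - h *\<^sub>R D (axis j 1))) \<le> e * h / 2"
        using mult_left_mono[OF bound[OF x] abs_ge_zero] e h
        by (intro onorm_bound) (simp_all add: mult.commute)
    qed (use h in auto)
    moreover have "g h - g 0 = second_difference f t i j h"
      by (simp add: g_def second_difference_def)
    ultimately have "norm (second_difference f t i j h - of_real (h\<^sup>2) * D (axis j 1)) \<le> e / 2 * h\<^sup>2"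
      using h by (simp add: power2_eq_square scaleR_conv_of_real algebra_simps)
    moreover have "second_difference f t i j h / of_real (h\<^sup>2) - D (axis j 1) =
      (second_difference f t i j h - of_real (h\<^sup>2) * D (axis j 1)) / of_real (h\<^sup>2)"
      using h by (simp add: field_simps)
    ultimately have "norm (second_difference f t i j h / of_real (h\<^sup>2) - D (axis j 1)) \<le> e / 2"
      using h by (simp add: norm_divide divide_le_eq norm_power)
    then show ?thesis using e by (simp add: dist_norm Dj)
  qed
  then show "eventually (\<lambda>h. dist (second_difference f t i j h / of_real (h\<^sup>2)) (pd j (pd i f) t) < e) (at_right 0)"
    unfolding eventually_at_right_field using r(1) r'(1)
    by (intro exI[of _ "min r r' / 2"]) auto
qed

text \<open>The second difference is symmetric in the two directions, so both mixed derivatives are limits of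
the same quotient.\<close>

lemma pd_commute:
  fixes f :: "real ^ 'n::finite \<Rightarrow> complex"
  assumes "t \<in> pos_orthant" "f differentiable_on pos_orthant"
    "pd i f differentiable (at t)" "pd j f differentiable (at t)"
  shows "pd i (pd j f) t = pd j (pd i f) t"
proof -
  have "second_difference f t i j = second_difference f t j i"
    by (auto simp: second_difference_def algebra_simps)
  then show ?thesis
    using second_difference_tendsto[OF assms(1,2,3), of j] second_difference_tendsto[OF assms(1,2,4), of i]
      tendsto_unique trivial_limit_at_right_real by metis
qed

section \<open>Smooth and rapidly decreasing functions\<close>

lemma smooth_differentiable_on: "smooth f \<Longrightarrow> f differentiable_on pos_orthant"
  by (auto simp: smooth_def pds_def dest: spec[of _ "[]"])

lemma smooth_differentiable: "smooth f \<Longrightarrow> t \<in> pos_orthant \<Longrightarrow> f differentiable (at t)"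
  using smooth_differentiable_on differentiable_on_orthant_iff by blast

lemma smooth_pd: "smooth f \<Longrightarrow> smooth (pd i f)"
  unfolding smooth_def pds_def
proof
  fix ks assume "\<forall>ks. foldr pd ks f differentiable_on pos_orthant"
  from spec[OF this, of "ks @ [i]"] show "foldr pd ks (pd i f) differentiable_on pos_orthant" by simp
qed

text \<open>The coinductive invariant for smoothness: all iterated partial derivatives of a member of such a
class agree on the orthant with members of the class.\<close>

definition pd_stable :: "(real ^ 'n::finite \<Rightarrow> complex) set \<Rightarrow> bool" where
  "pd_stable C \<longleftrightarrow> (\<forall>f\<in>C. f differentiable_on pos_orthant \<and>
     (\<forall>i. \<exists>g\<in>C. \<forall>t\<in>pos_orthant. pd i f t = g t))"

lemma pd_stable_pds:
  assumes "pd_stable C" "f \<in> C"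
  shows "\<exists>g\<in>C. \<forall>t\<in>pos_orthant. pds ks f t = g t"
proof (induction ks)
  case Nil then show ?case using assms(2) by (auto simp: pds_def)
next
  case (Cons k ks)
  then obtain g where g: "g \<in> C" "\<forall>t\<in>pos_orthant. pds ks f t = g t" by blast
  obtain h where h: "h \<in> C" "\<forall>t\<in>pos_orthant. pd k g t = h t"
    using assms(1) g(1) unfolding pd_stable_def by blast
  have "pds (k # ks) f t = h t" if "t \<in> pos_orthant" for t
    using pd_cong[OF that, of "pds ks f" g k] g(2) h(2) that by (simp add: pds_def)
  then show ?case using h(1) by blast
qed

text \<open>Smoothness is a statement about infinitely many iterated derivatives; this reduces it to one
derivative of each member of a suitable class.\<close>

lemma smooth_coinduct:
  assumes "pd_stable C" "f \<in> C"
  shows "smooth f"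
  unfolding smooth_def
proof
  fix ks
  obtain g where "g \<in> C" "\<forall>t\<in>pos_orthant. pds ks f t = g t"
    using pd_stable_pds[OF assms] by blast
  then show "pds ks f differentiable_on pos_orthant"
    using assms(1) differentiable_on_orthant_cong[of "pds ks f" g] unfolding pd_stable_def by blast
qed

lemma smooth_cong:
  assumes "\<And>t. t \<in> pos_orthant \<Longrightarrow> f t = g t" "smooth g"
  shows "smooth f"
proof (rule smooth_coinduct[of "{f. \<exists>g. smooth g \<and> (\<forall>t\<in>pos_orthant. f t = g t)}"])
  show "pd_stable {f::real ^ 'a \<Rightarrow> complex. \<exists>g. smooth g \<and> (\<forall>t\<in>pos_orthant. f t = g t)}"
    unfolding pd_stable_def
  proof (safe)
    fix f g :: "real ^ 'a \<Rightarrow> complex" and i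
    assume g: "smooth g" "\<forall>t\<in>pos_orthant. f t = g t"
    show "f differentiable_on pos_orthant"
      using g smooth_differentiable_on differentiable_on_orthant_cong[of f g] by blast
    show "\<exists>h\<in>{f. \<exists>g. smooth g \<and> (\<forall>t\<in>pos_orthant. f t = g t)}. \<forall>t\<in>pos_orthant. pd i f t = h t"
      using g smooth_pd pd_cong[of _ f g i] by (intro bexI[of _ "pd i g"]) auto
  qed
qed (use assms in auto)

text \<open>Products of two smooth functions are not closed under the Leibniz rule, but finite sums of them
are; this is the class to which the coinduction applies.\<close>

inductive_set products_of_smooth :: "(real ^ 'n::finite \<Rightarrow> complex) set" where
  prod: "smooth f \<Longrightarrow> smooth g \<Longrightarrow> (\<lambda>t. f t * g t) \<in> products_of_smooth"
| add: "f \<in> products_of_smooth \<Longrightarrow> g \<in> products_of_smooth \<Longrightarrow> (\<lambda>t. f t + g t) \<in> products_of_smooth"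

lemma pd_stable_products: "pd_stable products_of_smooth"
  unfolding pd_stable_def
proof
  fix f :: "real ^ 'n::finite \<Rightarrow> complex" assume "f \<in> products_of_smooth"
  then show "f differentiable_on pos_orthant \<and> (\<forall>i. \<exists>g\<in>products_of_smooth. \<forall>t\<in>pos_orthant. pd i f t = g t)"
  proof induction
    case (prod f g)
    have "\<forall>t\<in>pos_orthant. pd i (\<lambda>t. f t * g t) t = f t * pd i g t + pd i f t * g t" for i
      using pd_mult smooth_differentiable prod by blast
    moreover have "(\<lambda>t. f t * pd i g t + pd i f t * g t) \<in> products_of_smooth" for i
      by (intro products_of_smooth.intros smooth_pd prod)
    moreover have "(\<lambda>t. f t * g t) differentiable_on pos_orthant"
      using prod smooth_differentiable unfolding differentiable_on_orthant_iff by (auto intro: differentiable_mult)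
    ultimately show ?case by (intro conjI allI bexI) auto
  next
    case (add f g)
    have d: "(\<lambda>t. f t + g t) differentiable_on pos_orthant"
      using add by (auto intro: differentiable_on_add)
    have "\<exists>h\<in>products_of_smooth. \<forall>t\<in>pos_orthant. pd i (\<lambda>t. f t + g t) t = h t" for i
    proof -
      obtain f' g' where *: "f' \<in> products_of_smooth" "g' \<in> products_of_smooth"
        "\<forall>t\<in>pos_orthant. pd i f t = f' t" "\<forall>t\<in>pos_orthant. pd i g t = g' t"
        using add.IH by metis
      have "\<forall>t\<in>pos_orthant. pd i (\<lambda>t. f t + g t) t = f' t + g' t"
        using pd_lincomb[of f _ g i 1] add.IH * by (simp add: differentiable_on_orthant_iff)
      then show ?thesis using products_of_smooth.add[OF *(1,2)] by (rule bexI)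
    qed
    then show ?case using d by blast
  qed
qed

lemma smooth_mult: "smooth f \<Longrightarrow> smooth g \<Longrightarrow> smooth (\<lambda>t. f t * g t)"
  using smooth_coinduct[OF pd_stable_products] products_of_smooth.prod by blast

definition decays :: "(real ^ 'n::finite \<Rightarrow> complex) \<Rightarrow> bool" where
  "decays f \<longleftrightarrow> (\<forall>n :: 'n \<Rightarrow> nat.
     ((\<lambda>t. (\<Prod>i\<in>UNIV. t $ i ^ n i) * norm (f t)) \<longlongrightarrow> 0) (inf at_infinity (principal pos_orthant)))"

lemma rapid_space_decays: "rapid_space = {f. smooth f \<and> (\<forall>ks. decays (pds ks f))}"
  unfolding rapid_space_def decays_def by auto

lemma eventually_orthant_at_infinity:
  "eventually (\<lambda>t. t \<in> pos_orthant) (inf at_infinity (principal pos_orthant))"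
  by (simp add: eventually_inf_principal)

lemma decays_cong:
  assumes "\<And>t. t \<in> pos_orthant \<Longrightarrow> f t = g t" "decays g"
  shows "decays f"
  unfolding decays_def
proof
  fix n
  show "((\<lambda>t. (\<Prod>i\<in>UNIV. t $ i ^ n i) * norm (f t)) \<longlongrightarrow> 0) (inf at_infinity (principal pos_orthant))"
    by (rule Lim_transform_eventually[OF spec[OF assms(2)[unfolded decays_def], of n]])
       (use assms(1) in \<open>auto intro!: eventually_mono[OF eventually_orthant_at_infinity]\<close>)
qed

lemma decays_lincomb:
  assumes "decays f" "decays g"
  shows "decays (\<lambda>t. c * f t + g t)"
  unfolding decays_def
proof
  fix n :: "'a \<Rightarrow> nat"
  let ?F = "inf at_infinity (principal pos_orthant) :: (real ^ 'a) filter"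
  let ?m = "\<lambda>t::real ^ 'a. \<Prod>i\<in>UNIV. t $ i ^ n i"
  have lim: "((\<lambda>t. norm c * (?m t * norm (f t)) + ?m t * norm (g t)) \<longlongrightarrow> norm c * 0 + 0) ?F"
    using assms unfolding decays_def by (intro tendsto_intros) auto
  show "((\<lambda>t. ?m t * norm (c * f t + g t)) \<longlongrightarrow> 0) ?F"
  proof (rule Lim_null_comparison)
    show "((\<lambda>t. norm c * (?m t * norm (f t)) + ?m t * norm (g t)) \<longlongrightarrow> 0) ?F" using lim by simp
    show "eventually (\<lambda>t. norm (?m t * norm (c * f t + g t)) \<le> norm c * (?m t * norm (f t)) + ?m t * norm (g t)) ?F"
    proof (rule eventually_mono[OF eventually_orthant_at_infinity])
      fix t :: "real ^ 'a" assume "t \<in> pos_orthant"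
      then have m: "0 \<le> ?m t" by (intro prod_nonneg) (auto simp: pos_orthant_def less_imp_le)
      have "norm (c * f t + g t) \<le> norm c * norm (f t) + norm (g t)"
        by (metis norm_mult norm_triangle_ineq)
      from mult_left_mono[OF this m] m
      show "norm (?m t * norm (c * f t + g t)) \<le> norm c * (?m t * norm (f t)) + ?m t * norm (g t)"
        by (simp add: algebra_simps)
    qed
  qed
qed

lemma decays_coordinate_mult:
  assumes "decays f"
  shows "decays (\<lambda>t. of_real (t $ j) * f t)"
  unfolding decays_def
proof
  fix n :: "'a \<Rightarrow> nat"
  have *: "(\<Prod>i\<in>UNIV. t $ i ^ (n(j := Suc (n j))) i) = (\<Prod>i\<in>UNIV. t $ i ^ n i) * t $ j" for t :: "real ^ 'a"
  proof -
    have "(\<Prod>i\<in>UNIV - {j}. t $ i ^ (n(j := Suc (n j))) i) = (\<Prod>i\<in>UNIV - {j}. t $ i ^ n i)"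
      by (intro prod.cong) auto
    then show ?thesis by (simp add: prod.remove[of UNIV j] del: fun_upd_apply) simp
  qed
  have "(\<Prod>i\<in>UNIV. t $ i ^ (n(j := Suc (n j))) i) * norm (f t) = (\<Prod>i\<in>UNIV. t $ i ^ n i) * norm (of_real (t $ j) * f t)"
    if "t \<in> pos_orthant" for t
  proof -
    have "\<bar>t $ j\<bar> = t $ j" using that by (simp add: pos_orthant_def less_imp_le)
    then show ?thesis unfolding * by (simp add: norm_mult mult.assoc)
  qed
  then show "((\<lambda>t. (\<Prod>i\<in>UNIV. t $ i ^ n i) * norm (of_real (t $ j) * f t)) \<longlongrightarrow> 0)
      (inf at_infinity (principal pos_orthant))"
    by (intro Lim_transform_eventually[OF spec[OF assms[unfolded decays_def], of "n(j := Suc (n j))"]])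
       (auto intro!: eventually_mono[OF eventually_orthant_at_infinity])
qed

text \<open>With decay added to the invariant, the coinduction for smoothness gives membership in the space
of rapidly decreasing functions.\<close>

lemma rapid_coinduct:
  assumes "pd_stable C" "\<And>f. f \<in> C \<Longrightarrow> decays f" "f \<in> C"
  shows "f \<in> rapid_space"
proof -
  have "decays (pds ks f)" for ks
    using pd_stable_pds[OF assms(1,3), of ks] assms(2) decays_cong by blast
  then show ?thesis
    using smooth_coinduct[OF assms(1,3)] by (simp add: rapid_space_decays)
qed

lemma rapid_smooth: "f \<in> rapid_space \<Longrightarrow> smooth f"
  by (simp add: rapid_space_decays)

lemma rapid_decays: "f \<in> rapid_space \<Longrightarrow> decays f"
  by (auto simp: rapid_space_decays pds_def dest: spec[of _ "[]"])

lemma rapid_pd: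
  assumes "f \<in> rapid_space" shows "pd i f \<in> rapid_space"
proof -
  have "pds ks (pd i f) = pds (ks @ [i]) f" for ks by (simp add: pds_def)
  then show ?thesis using assms smooth_pd by (auto simp: rapid_space_decays)
qed

lemma rapid_lincomb:
  assumes "f \<in> rapid_space" "g \<in> rapid_space"
  shows "(\<lambda>t. c * f t + g t) \<in> rapid_space"
proof (rule rapid_coinduct[of "{\<lambda>t. c * f t + g t | f g. f \<in> rapid_space \<and> g \<in> rapid_space}"])
  show "pd_stable {\<lambda>t. c * f t + g t | f g. f \<in> rapid_space \<and> g \<in> (rapid_space :: (real ^ 'a \<Rightarrow> complex) set)}"
    unfolding pd_stable_def
  proof (safe)
    fix f g :: "real ^ 'a \<Rightarrow> complex" and i
    assume fg: "f \<in> rapid_space" "g \<in> rapid_space"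
    note d = fg[THEN rapid_smooth, THEN smooth_differentiable]
    show "(\<lambda>t. c * f t + g t) differentiable_on pos_orthant"
      using d by (auto simp: differentiable_on_orthant_iff)
    show "\<exists>h\<in>{\<lambda>t. c * f t + g t | f g. f \<in> rapid_space \<and> g \<in> rapid_space}.
        \<forall>t\<in>pos_orthant. pd i (\<lambda>t. c * f t + g t) t = h t"
    proof (intro bexI[of _ "\<lambda>t. c * pd i f t + pd i g t"] ballI)
      show "pd i (\<lambda>t. c * f t + g t) t = c * pd i f t + pd i g t" if "t \<in> pos_orthant" for t
        using d that by (simp add: pd_lincomb)
      show "(\<lambda>t. c * pd i f t + pd i g t) \<in> {\<lambda>t. c * f t + g t | f g. f \<in> rapid_space \<and> g \<in> rapid_space}"
        using fg rapid_pd by blast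
    qed
  qed
qed (use assms in \<open>auto intro: decays_lincomb rapid_decays\<close>)

lemma rapid_zero: "(\<lambda>t. 0) \<in> rapid_space"
  by (rule rapid_coinduct[of "{\<lambda>t. 0}"]) (auto simp: pd_stable_def decays_def pd_def)

lemma rapid_uminus: "f \<in> rapid_space \<Longrightarrow> (\<lambda>t. - f t) \<in> rapid_space"
  using rapid_lincomb[OF _ rapid_zero, of f "-1"] by simp

text \<open>The second summand is what makes the class stable: differentiating \<open>t\<^sub>j f\<close> leaves \<open>f\<close> itself as a
remainder.\<close>

lemma rapid_coordinate_mult_add:
  assumes "f \<in> rapid_space" "g \<in> rapid_space"
  shows "(\<lambda>t. of_real (t $ j) * f t + g t) \<in> rapid_space"
proof (rule rapid_coinduct[of "{\<lambda>t. of_real (t $ j) * f t + g t | f g. f \<in> rapid_space \<and> g \<in> rapid_space}"])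
  show "pd_stable {\<lambda>t. of_real (t $ j) * f t + g t | f g. f \<in> rapid_space \<and> g \<in> (rapid_space :: (real ^ 'a \<Rightarrow> complex) set)}"
    unfolding pd_stable_def
  proof (safe)
    fix f g :: "real ^ 'a \<Rightarrow> complex" and i
    assume fg: "f \<in> rapid_space" "g \<in> rapid_space"
    note d = fg[THEN rapid_smooth, THEN smooth_differentiable]
    have dm: "(\<lambda>t. of_real (t $ j) * f t) differentiable (at t)" if "t \<in> pos_orthant" for t
      using d that by (intro differentiable_mult coordinate_differentiable) auto
    show "(\<lambda>t. of_real (t $ j) * f t + g t) differentiable_on pos_orthant"
      using d dm by (auto simp: differentiable_on_orthant_iff)
    let ?h = "\<lambda>t. of_real (t $ j) * pd i f t + ((if i = j then 1 else 0) * f t + pd i g t)"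
    have h: "\<forall>t\<in>pos_orthant. pd i (\<lambda>t. of_real (t $ j) * f t + g t) t = ?h t"
      using d dm pd_lincomb[of "\<lambda>t. of_real (t $ j) * f t" _ g i 1] by (simp add: pd_coordinate_mult)
    have k: "(\<lambda>t. (if i = j then 1 else 0) * f t + pd i g t) \<in> rapid_space"
      using fg by (intro rapid_lincomb rapid_pd)
    have "?h \<in> {\<lambda>t. of_real (t $ j) * f t + g t | f g. f \<in> rapid_space \<and> g \<in> rapid_space}"
      by (rule CollectI, rule exI[of _ "pd i f"],
          rule exI[of _ "\<lambda>t. (if i = j then 1 else 0) * f t + pd i g t"],
          rule conjI[OF refl conjI[OF rapid_pd[OF fg(1)] k]])
    then show "\<exists>h\<in>{\<lambda>t. of_real (t $ j) * f t + g t | f g. f \<in> rapid_space \<and> g \<in> rapid_space}.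
        \<forall>t\<in>pos_orthant. pd i (\<lambda>t. of_real (t $ j) * f t + g t) t = h t"
      using h by (intro bexI[where x = ?h])
  qed
  fix h assume "h \<in> {\<lambda>t. of_real (t $ j) * f t + g t | f g. f \<in> rapid_space \<and> g \<in> (rapid_space :: (real ^ 'a \<Rightarrow> complex) set)}"
  then show "decays h"
    using decays_lincomb[OF decays_coordinate_mult, of _ _ 1] rapid_decays by fastforce
qed (use assms in auto)

lemma rapid_coordinate_mult: "f \<in> rapid_space \<Longrightarrow> (\<lambda>t. of_real (t $ j) * f t) \<in> rapid_space"
  using rapid_coordinate_mult_add[OF _ rapid_zero] by simp

lemma rapid_scale: "f \<in> rapid_space \<Longrightarrow> (\<lambda>t. c * f t) \<in> rapid_space"
  using rapid_lincomb[OF _ rapid_zero, of f c] by simp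

section \<open>The representation of the Lie algebra\<close>

lemma rep_rapid:
  assumes "f \<in> rapid_space" shows "rep \<gamma> X f \<in> rapid_space"
proof (cases X)
  case (Hgen i)
  show ?thesis using rapid_coordinate_mult_add[OF rapid_pd rapid_scale, OF assms assms, of i i "\<gamma> $ i"]
    by (simp add: Hgen add.commute)
qed (use assms rapid_uminus[OF rapid_pd] rapid_uminus[OF rapid_coordinate_mult] in auto)

lemma pd_rep_H:
  assumes "f \<in> rapid_space" "t \<in> pos_orthant"
  shows "pd j (\<lambda>t. c * f t + of_real (t $ i) * pd i f t) t =
    c * pd j f t + of_real (t $ i) * pd j (pd i f) t + (if i = j then pd i f t else 0)"
proof -
  have d: "f differentiable (at t)" "pd i f differentiable (at t)"
    using assms rapid_smooth rapid_pd smooth_differentiable by blast+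
  show ?thesis
    using pd_lincomb[OF d(1) differentiable_mult[OF coordinate_differentiable d(2)], of j c i]
    by (simp add: pd_coordinate_mult[OF d(2)] eq_commute)
qed

text \<open>The sixteen brackets reduce to the Leibniz rule for multiplication by a coordinate and to the
symmetry of second derivatives.\<close>

lemma LN_representation_rapid_space: "LN_representation rapid_space (rep \<gamma>)"
  unfolding LN_representation_def
proof (intro conjI allI ballI)
  fix f g :: "real ^ 'a \<Rightarrow> complex" and c X and t :: "real ^ 'a"
  assume f: "f \<in> rapid_space" and g: "g \<in> rapid_space"
  show "(\<lambda>t. c * f t + g t) \<in> rapid_space" using f g by (rule rapid_lincomb)
  assume t: "t \<in> pos_orthant"
  have d: "f differentiable (at t)" "g differentiable (at t)"
    using f g t rapid_smooth smooth_differentiable by blast+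
  show "rep \<gamma> X (\<lambda>t. c * f t + g t) t = c * rep \<gamma> X f t + rep \<gamma> X g t"
    by (cases X) (simp_all add: pd_lincomb[OF d], simp_all add: algebra_simps)
next
  fix f :: "real ^ 'a \<Rightarrow> complex" and X Y :: "'a LN_gen" and t :: "real ^ 'a"
  assume f: "f \<in> rapid_space"
  then show "rep \<gamma> X f \<in> rapid_space" by (rule rep_rapid)
  assume t: "t \<in> pos_orthant"
  have d: "f differentiable (at t)" "pd i f differentiable (at t)" for i
    using f t rapid_smooth rapid_pd smooth_differentiable by blast+
  have comm: "pd i (pd j f) t = pd j (pd i f) t" for i j
    using pd_commute[OF t smooth_differentiable_on[OF rapid_smooth[OF f]]] d by blast
  have F: "pd i (\<lambda>t. - (of_real (t $ j) * f t)) t = - (of_real (t $ j) * pd i f t + (if i = j then f t else 0))" for i j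
    using pd_uminus[OF differentiable_mult[OF coordinate_differentiable d(1)], of i j]
    by (simp add: pd_coordinate_mult[OF d(1)])
  note [simp] = pd_uminus[OF d(1)] pd_uminus[OF d(2)] F pd_rep_H[OF f t]
  show "rep \<gamma> X (rep \<gamma> Y f) t - rep \<gamma> Y (rep \<gamma> X f) t =
      fst (LN_bracket X Y) * rep \<gamma> (snd (LN_bracket X Y)) f t"
    by (cases X; cases Y) (simp_all, auto simp: algebra_simps comm)
qed

section \<open>Exponential integrals\<close>

text \<open>The exponent of the integrand, as a function of the parameter \<open>\<gamma>\<close>, the argument \<open>u\<close> and the
logarithmic integration variable \<open>T\<close>.  It is linear in the pair \<open>(\<gamma>, u)\<close>, which is why
derivatives in \<open>\<gamma>\<close> and in \<open>u\<close> can be treated together.\<close>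

definition phase :: "complex ^ 'n::finite \<Rightarrow> real ^ 'n \<Rightarrow> real ^ 'n \<Rightarrow> complex" where
  "phase \<gamma> u T = (\<Sum>i\<in>UNIV. \<gamma> $ i * of_real (T $ i) - of_real (u $ i * exp (T $ i)))"

text \<open>The growth of \<open>phase \<delta> v T\<close> in \<open>T\<close> for bounded \<open>(\<delta>, v)\<close>.\<close>

definition weight :: "real ^ 'n::finite \<Rightarrow> real" where
  "weight T = (\<Sum>i\<in>UNIV. \<bar>T $ i\<bar> + exp (T $ i))"

definition exp_integral :: "(real ^ 'n::finite) measure \<Rightarrow> complex ^ 'n \<Rightarrow> real ^ 'n \<Rightarrow> complex" where
  "exp_integral \<nu> \<gamma> u = (\<integral>T. exp (phase \<gamma> u T) \<partial>\<nu>)"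

text \<open>A class of measures for which the exponential integral converges.  It contains both Lebesgue measure
and the measures on the fibres of the lattice map.\<close>

definition tempered :: "(real ^ 'n::finite) measure \<Rightarrow> bool" where
  "tempered \<nu> \<longleftrightarrow> sets \<nu> = sets borel \<and>
     (\<forall>e>0. integrable \<nu> (\<lambda>T. exp (- e * (\<Sum>i\<in>UNIV. \<bar>T $ i\<bar>))))"

lemma continuous_phase: "continuous_on UNIV (phase \<gamma> u)"
  unfolding phase_def by (intro continuous_intros)

lemma measurable_phase [measurable]: "phase \<gamma> u \<in> borel_measurable borel"
  by (rule borel_measurable_continuous_onI[OF continuous_phase])

lemma measurable_weight [measurable]: "weight \<in> borel_measurable borel"
  unfolding weight_def by (intro borel_measurable_continuous_onI continuous_intros)

lemma phase_add: "phase (\<gamma> + \<delta>) (u + v) T = phase \<gamma> u T + phase \<delta> v T"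
  by (simp add: phase_def sum.distrib[symmetric] algebra_simps)

lemma phase_scale: "phase (r *\<^sub>R \<delta>) (r *\<^sub>R v) T = of_real r * phase \<delta> v T"
  by (simp add: phase_def sum_distrib_left scaleR_conv_of_real[of r "\<delta> $ _"] algebra_simps)

lemma Re_phase: "Re (phase \<gamma> u T) = (\<Sum>i\<in>UNIV. Re (\<gamma> $ i) * T $ i - u $ i * exp (T $ i))"
  by (simp add: phase_def)

lemma weight_nonneg: "0 \<le> weight T"
  unfolding weight_def by (intro sum_nonneg add_nonneg_nonneg) auto

lemma norm_phase_le: "norm (phase \<delta> v T) \<le> norm (\<delta>, v) * weight T"
proof -
  have 1: "norm (\<delta> $ i) \<le> norm (\<delta>, v)" and 2: "norm (v $ i) \<le> norm (\<delta>, v)" for i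
    by (rule order_trans[OF Finite_Cartesian_Product.norm_nth_le norm_fst_le]
        order_trans[OF Finite_Cartesian_Product.norm_nth_le norm_snd_le])+
  have "norm (\<delta> $ i * of_real (T $ i) - of_real (v $ i * exp (T $ i)))
      \<le> norm (\<delta>, v) * \<bar>T $ i\<bar> + norm (\<delta>, v) * exp (T $ i)" for i
  proof -
    have "norm (\<delta> $ i * of_real (T $ i) - of_real (v $ i * exp (T $ i)))
        \<le> norm (\<delta> $ i) * \<bar>T $ i\<bar> + \<bar>v $ i\<bar> * exp (T $ i)"
      using norm_triangle_ineq4[of "\<delta> $ i * of_real (T $ i)" "of_real (v $ i * exp (T $ i))"]
      by (simp add: norm_mult abs_mult del: of_real_mult)
    also have "\<dots> \<le> norm (\<delta>, v) * \<bar>T $ i\<bar> + norm (\<delta>, v) * exp (T $ i)"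
      using 1[of i] 2[of i] by (intro add_mono mult_right_mono) auto
    finally show ?thesis .
  qed
  then have "norm (phase \<delta> v T) \<le> (\<Sum>i\<in>UNIV. norm (\<delta>, v) * \<bar>T $ i\<bar> + norm (\<delta>, v) * exp (T $ i))"
    unfolding phase_def by (intro sum_norm_le) auto
  then show ?thesis by (simp add: weight_def sum_distrib_left distrib_left)
qed

text \<open>For negative \<open>x\<close> the linear term \<open>g x\<close> provides the decay; for positive \<open>x\<close> the term \<open>- u e\<^sup>x\<close> does,
through \<open>e\<^sup>x \<ge> x\<^sup>2/2\<close>, and the constant comes from completing the square.  A margin \<open>4\<rho>\<close> in \<open>g\<close> and \<open>u\<close>
leaves room for the factor \<open>exp (2\<rho> weight)\<close> which the Taylor remainder produces.\<close>

lemma scalar_phase_bound: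
  fixes \<rho> g u x :: real
  assumes "0 < \<rho>" "4 * \<rho> \<le> g" "4 * \<rho> \<le> u"
  shows "g * x - u * exp x + 2 * \<rho> * (\<bar>x\<bar> + exp x) \<le> (g + 4 * \<rho>)\<^sup>2 / (4 * \<rho>) - 2 * \<rho> * \<bar>x\<bar>"
proof -
  \<comment> \<open>Naming the product keeps the inequalities linear for the simplifier.\<close>
  define P where "P = u * exp x"
  have P: "4 * (\<rho> * exp x) \<le> P"
    using mult_right_mono[OF assms(3), of "exp x"] by (simp add: P_def)
  have "g * x - P + 2 * \<rho> * (\<bar>x\<bar> + exp x) \<le> (g + 4 * \<rho>)\<^sup>2 / (4 * \<rho>) - 2 * \<rho> * \<bar>x\<bar>"
  proof (cases "x \<ge> 0")
    case True
    have "exp x \<ge> x\<^sup>2 / 2" using exp_lower_Taylor_quadratic[OF True] True by simp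
    then have e: "2 * (\<rho> * exp x) \<ge> \<rho> * x\<^sup>2"
      using mult_left_mono[of "x\<^sup>2 / 2" "exp x" "2 * \<rho>"] assms(1) by simp
    have "0 \<le> (2 * \<rho> * x - (g + 4 * \<rho>))\<^sup>2" by simp
    then have "4 * \<rho> * ((g + 4 * \<rho>) * x - \<rho> * x\<^sup>2) \<le> (g + 4 * \<rho>)\<^sup>2"
      by (simp add: power2_eq_square algebra_simps)
    then have "(g + 4 * \<rho>) * x - \<rho> * x\<^sup>2 \<le> (g + 4 * \<rho>)\<^sup>2 / (4 * \<rho>)"
      using assms(1) by (simp add: pos_le_divide_eq mult.commute)
    then show ?thesis using P e True by (simp add: algebra_simps)
  next
    case False
    have "g * x \<le> 4 * (\<rho> * x)" using mult_right_mono_neg[OF assms(2), of x] False by simp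
    moreover have "0 \<le> (g + 4 * \<rho>)\<^sup>2 / (4 * \<rho>)" using assms(1) by simp
    moreover have "0 \<le> \<rho> * exp x" using assms(1) by simp
    moreover have "2 * \<rho> * (\<bar>x\<bar> + exp x) = 2 * (\<rho> * exp x) - 2 * (\<rho> * x)" "2 * \<rho> * \<bar>x\<bar> = - 2 * (\<rho> * x)"
      using False by (simp_all add: algebra_simps)
    ultimately show ?thesis using P by linarith
  qed
  then show ?thesis by (simp add: P_def)
qed

lemma phase_bound:
  fixes \<gamma> :: "complex ^ 'n::finite"
  assumes "0 < \<rho>" "\<And>i. 4 * \<rho> \<le> Re (\<gamma> $ i)" "\<And>i. 4 * \<rho> \<le> u $ i"
  obtains C where "0 < C"
    "\<And>T. norm (exp (phase \<gamma> u T)) * exp (2 * \<rho> * weight T) \<le> C * exp (- (2 * \<rho>) * (\<Sum>i\<in>UNIV. \<bar>T $ i\<bar>))"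
proof
  let ?C = "\<Sum>i\<in>UNIV. (Re (\<gamma> $ i) + 4 * \<rho>)\<^sup>2 / (4 * \<rho>)"
  show "0 < exp ?C" by simp
  fix T
  have "Re (phase \<gamma> u T) + 2 * \<rho> * weight T =
      (\<Sum>i\<in>UNIV. Re (\<gamma> $ i) * T $ i - u $ i * exp (T $ i) + 2 * \<rho> * (\<bar>T $ i\<bar> + exp (T $ i)))"
    by (simp add: Re_phase weight_def sum_distrib_left sum.distrib[symmetric])
  also have "\<dots> \<le> (\<Sum>i\<in>UNIV. (Re (\<gamma> $ i) + 4 * \<rho>)\<^sup>2 / (4 * \<rho>) - 2 * \<rho> * \<bar>T $ i\<bar>)"
    by (intro sum_mono scalar_phase_bound assms)
  also have "\<dots> = ?C + (- (2 * \<rho>) * (\<Sum>i\<in>UNIV. \<bar>T $ i\<bar>))"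
    by (simp add: sum_subtractf sum_distrib_left sum_negf)
  finally show "norm (exp (phase \<gamma> u T)) * exp (2 * \<rho> * weight T)
      \<le> exp ?C * exp (- (2 * \<rho>) * (\<Sum>i\<in>UNIV. \<bar>T $ i\<bar>))"
    by (simp add: exp_add[symmetric])
qed

lemma integrable_dominated_by_phase:
  fixes f :: "real ^ 'n::finite \<Rightarrow> complex"
  assumes "tempered \<nu>" "0 < \<rho>" "\<And>i. 4 * \<rho> \<le> Re (\<gamma> $ i)" "\<And>i. 4 * \<rho> \<le> u $ i"
    and f [measurable]: "f \<in> borel_measurable borel"
    and le: "\<And>T. norm (f T) \<le> K * (norm (exp (phase \<gamma> u T)) * exp (2 * \<rho> * weight T))"
  shows "integrable \<nu> f"
proof -
  obtain C where C: "0 < C"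
    "\<And>T. norm (exp (phase \<gamma> u T)) * exp (2 * \<rho> * weight T) \<le> C * exp (- (2 * \<rho>) * (\<Sum>i\<in>UNIV. \<bar>T $ i\<bar>))"
    using phase_bound[OF assms(2-4)] by metis
  have "integrable \<nu> (\<lambda>T. (\<bar>K\<bar> * C) * exp (- (2 * \<rho>) * (\<Sum>i\<in>UNIV. \<bar>T $ i\<bar>)))"
    using assms(1,2) unfolding tempered_def by (intro integrable_mult_right) auto
  then show ?thesis
  proof (rule Bochner_Integration.integrable_bound)
    show "f \<in> borel_measurable \<nu>"
      using f assms(1) by (simp add: tempered_def cong: measurable_cong_sets)
    show "AE T in \<nu>. norm (f T) \<le> norm ((\<bar>K\<bar> * C) * exp (- (2 * \<rho>) * (\<Sum>i\<in>UNIV. \<bar>T $ i\<bar>)))"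
    proof (rule AE_I2)
      fix T
      have "norm (f T) \<le> \<bar>K\<bar> * (norm (exp (phase \<gamma> u T)) * exp (2 * \<rho> * weight T))"
        using le[of T] mult_right_mono[OF abs_ge_self[of K], of "norm (exp (phase \<gamma> u T)) * exp (2 * \<rho> * weight T)"]
        by (meson mult_nonneg_nonneg norm_ge_zero exp_ge_zero order_trans)
      also have "\<dots> \<le> \<bar>K\<bar> * (C * exp (- (2 * \<rho>) * (\<Sum>i\<in>UNIV. \<bar>T $ i\<bar>)))"
        by (intro mult_left_mono C) auto
      finally show "norm (f T) \<le> norm ((\<bar>K\<bar> * C) * exp (- (2 * \<rho>) * (\<Sum>i\<in>UNIV. \<bar>T $ i\<bar>)))"
        using C(1) by (simp add: abs_mult mult.assoc)
    qed
  qed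
qed

lemma uniform_margin:
  fixes \<gamma> :: "complex ^ 'n::finite"
  assumes "\<gamma> \<in> gamma_domain" "u \<in> pos_orthant"
  obtains \<rho> where "0 < \<rho>" "\<And>i. 4 * \<rho> \<le> Re (\<gamma> $ i)" "\<And>i. 4 * \<rho> \<le> u $ i"
proof
  let ?S = "range (\<lambda>i. Re (\<gamma> $ i)) \<union> range (\<lambda>i. u $ i)"
  have fin: "finite ?S" "?S \<noteq> {}" by auto
  have "\<forall>x\<in>?S. 0 < x" using assms by (auto simp: gamma_domain_def pos_orthant_def)
  then show "0 < Min ?S / 4" using fin by simp
  show "4 * (Min ?S / 4) \<le> Re (\<gamma> $ i)" for i using Min_le[OF fin(1), of "Re (\<gamma> $ i)"] by simp
  show "4 * (Min ?S / 4) \<le> u $ i" for i using Min_le[OF fin(1), of "u $ i"] by simp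
qed

lemma weight_le_exp: "0 < \<rho> \<Longrightarrow> weight T \<le> 1 / (2 * \<rho>) * exp (2 * \<rho> * weight T)"
proof -
  assume "0 < \<rho>"
  moreover have "2 * \<rho> * weight T \<le> exp (2 * \<rho> * weight T)"
    using exp_ge_add_one_self[of "2 * \<rho> * weight T"] by linarith
  ultimately show ?thesis by (simp add: field_simps)
qed

lemma integrable_phase:
  assumes "tempered \<nu>" "\<gamma> \<in> gamma_domain" "u \<in> pos_orthant"
  shows "integrable \<nu> (\<lambda>T. exp (phase \<gamma> u T))"
    and "integrable \<nu> (\<lambda>T. phase \<delta> v T * exp (phase \<gamma> u T))"
proof -
  obtain \<rho> where \<rho>: "0 < \<rho>" "\<And>i. 4 * \<rho> \<le> Re (\<gamma> $ i)" "\<And>i. 4 * \<rho> \<le> u $ i"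
    using uniform_margin[OF assms(2,3)] by metis
  have "norm (exp (phase \<gamma> u T)) \<le> 1 * (norm (exp (phase \<gamma> u T)) * exp (2 * \<rho> * weight T))" for T
    using \<rho>(1) weight_nonneg[of T] by (simp add: mult_le_cancel_left1)
  then show "integrable \<nu> (\<lambda>T. exp (phase \<gamma> u T))"
    by (rule integrable_dominated_by_phase[OF assms(1) \<rho>, rotated]) simp
  have "norm (phase \<delta> v T * exp (phase \<gamma> u T))
      \<le> (norm (\<delta>, v) * (1 / (2 * \<rho>))) * (norm (exp (phase \<gamma> u T)) * exp (2 * \<rho> * weight T))" for T
  proof -
    have "norm (phase \<delta> v T) \<le> norm (\<delta>, v) * (1 / (2 * \<rho>) * exp (2 * \<rho> * weight T))"
      using norm_phase_le[of \<delta> v T] mult_left_mono[OF weight_le_exp[OF \<rho>(1), of T] norm_ge_zero[of "(\<delta>, v)"]]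
      by (rule order_trans)
    from mult_right_mono[OF this norm_ge_zero[of "exp (phase \<gamma> u T)"]] show ?thesis
      by (simp add: norm_mult mult_ac)
  qed
  then show "integrable \<nu> (\<lambda>T. phase \<delta> v T * exp (phase \<gamma> u T))"
    by (rule integrable_dominated_by_phase[OF assms(1) \<rho>, rotated]) simp
qed

text \<open>A quadratic remainder estimate survives integration against a measure, which makes it a convenient
criterion for differentiation under the integral sign.\<close>

lemma has_derivative_quadratic:
  fixes f :: "'a::real_normed_vector \<Rightarrow> 'b::real_normed_vector"
  assumes "bounded_linear D" "0 < r"
    and "\<And>h. norm h \<le> r \<Longrightarrow> norm (f (x + h) - f x - D h) \<le> K * (norm h)\<^sup>2"
  shows "(f has_derivative D) (at x)"
  unfolding has_derivative_at_alt
proof (intro conjI allI impI assms(1))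
  fix e :: real assume e: "0 < e"
  show "\<exists>d>0. \<forall>y. norm (y - x) < d \<longrightarrow> norm (f y - f x - D (y - x)) \<le> e * norm (y - x)"
  proof (intro exI[of _ "min r (e / (\<bar>K\<bar> + 1))"] conjI allI impI)
    show "0 < min r (e / (\<bar>K\<bar> + 1))" using e assms(2) by auto
    fix y assume y: "norm (y - x) < min r (e / (\<bar>K\<bar> + 1))"
    have "norm (f y - f x - D (y - x)) \<le> K * (norm (y - x))\<^sup>2"
      using assms(3)[of "y - x"] y by simp
    also have "\<dots> \<le> (\<bar>K\<bar> + 1) * norm (y - x) * norm (y - x)"
      by (simp add: power2_eq_square mult.assoc mult_right_mono)
    also have "(\<bar>K\<bar> + 1) * norm (y - x) \<le> e"
      using y by (simp add: pos_less_divide_eq mult.commute less_imp_le)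
    then have "(\<bar>K\<bar> + 1) * norm (y - x) * norm (y - x) \<le> e * norm (y - x)"
      by (rule mult_right_mono) simp
    finally show "norm (f y - f x - D (y - x)) \<le> e * norm (y - x)" .
  qed
qed

lemma exp_remainder_bound:
  fixes w :: complex
  shows "norm (exp w - 1 - w) \<le> exp (norm w) * (norm w)\<^sup>2"
  using Taylor_exp_field[of w 1] by (simp add: numeral_2_eq_2 algebra_simps)

text \<open>Differentiation under the integral sign.  If the pair \<open>(\<gamma>, u)\<close> is moved by \<open>h = (\<delta>, v)\<close>, then the
integrand is multiplied by \<open>e\<^sup>w\<close> with \<open>w = phase \<delta> v T\<close> and \<open>\<bar>w\<bar> \<le> \<parallel>h\<parallel> weight T\<close>.  Thus its first order
Taylor remainder is at most \<open>\<parallel>h\<parallel>\<^sup>2\<close> times an integrable function of \<open>T\<close>, as long as \<open>\<parallel>h\<parallel> \<le> \<rho>\<close>.\<close>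

lemma exp_integral_has_derivative:
  fixes \<nu> :: "(real ^ 'n::finite) measure"
  assumes \<nu>: "tempered \<nu>" and \<gamma>: "\<gamma> \<in> gamma_domain" and u: "u \<in> pos_orthant"
  shows "((\<lambda>(\<gamma>, u). exp_integral \<nu> \<gamma> u) has_derivative
    (\<lambda>(\<delta>, v). \<integral>T. phase \<delta> v T * exp (phase \<gamma> u T) \<partial>\<nu>)) (at (\<gamma>, u))"
proof -
  obtain \<rho> where \<rho>: "0 < \<rho>" "\<And>i. 4 * \<rho> \<le> Re (\<gamma> $ i)" "\<And>i. 4 * \<rho> \<le> u $ i"
    using uniform_margin[OF \<gamma> u] by metis
  let ?B = "\<lambda>T. norm (exp (phase \<gamma> u T)) * exp (2 * \<rho> * weight T)"
  have intB: "integrable \<nu> ?B"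
  proof -
    have "integrable \<nu> (\<lambda>T. complex_of_real (?B T))"
      by (rule integrable_dominated_by_phase[OF \<nu> \<rho>, where K = 1]) (simp_all add: norm_mult)
    then show ?thesis by (simp only: complex_of_real_integrable_eq)
  qed
  define D where "D = (\<lambda>(\<delta>::complex ^ 'n, v). \<integral>T. phase \<delta> v T * exp (phase \<gamma> u T) \<partial>\<nu>)"
  have linD: "linear D"
  proof (rule linearI)
    fix p q :: "(complex ^ 'n) \<times> (real ^ 'n)" and r :: real
    show "D (p + q) = D p + D q"
      by (cases p; cases q)
         (simp add: D_def phase_add distrib_right Bochner_Integration.integral_add integrable_phase[OF \<nu> \<gamma> u])
    show "D (r *\<^sub>R p) = r *\<^sub>R D p"
      by (cases p) (simp add: D_def phase_scale mult.assoc, simp add: scaleR_conv_of_real)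
  qed
  have "(( \<lambda>(\<gamma>, u). exp_integral \<nu> \<gamma> u) has_derivative D) (at (\<gamma>, u))"
  proof (rule has_derivative_quadratic[where r = \<rho>])
    show "bounded_linear D" using linD by (simp add: linear_conv_bounded_linear)
    show "0 < \<rho>" by fact
    fix h :: "(complex ^ 'n) \<times> (real ^ 'n)" assume h: "norm h \<le> \<rho>"
    obtain \<delta> v where hd: "h = (\<delta>, v)" by (cases h)
    have dom: "\<gamma> + \<delta> \<in> gamma_domain" "u + v \<in> pos_orthant"
    proof -
      have "norm (\<delta> $ i) \<le> norm h" "norm (v $ i) \<le> norm h" for i
        unfolding hd by (rule order_trans[OF Finite_Cartesian_Product.norm_nth_le norm_fst_le]
          order_trans[OF Finite_Cartesian_Product.norm_nth_le norm_snd_le])+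
      then have "\<bar>Re (\<delta> $ i)\<bar> \<le> \<rho>" "\<bar>v $ i\<bar> \<le> \<rho>" for i
        using h order_trans[OF abs_Re_le_cmod] order_trans by (metis, metis real_norm_def)
      then have "0 < Re (\<gamma> $ i) + Re (\<delta> $ i)" "0 < u $ i + v $ i" for i
        using \<rho>(1) \<rho>(2,3)[of i] by (smt (verit))+
      then show "\<gamma> + \<delta> \<in> gamma_domain" "u + v \<in> pos_orthant"
        by (auto simp: gamma_domain_def pos_orthant_def)
    qed
    let ?R = "\<lambda>T. exp (phase (\<gamma> + \<delta>) (u + v) T) - exp (phase \<gamma> u T) - phase \<delta> v T * exp (phase \<gamma> u T)"
    have R: "norm (?R T) \<le> 2 / \<rho>\<^sup>2 * (norm h)\<^sup>2 * ?B T" for T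
    proof -
      let ?w = "phase \<delta> v T"
      have w: "norm ?w \<le> norm h * weight T" using norm_phase_le hd by blast
      have w': "norm ?w \<le> \<rho> * weight T"
        using w mult_right_mono[OF h weight_nonneg[of T]] by linarith
      have q: "(weight T)\<^sup>2 \<le> 2 / \<rho>\<^sup>2 * exp (\<rho> * weight T)"
      proof -
        have "(\<rho> * weight T)\<^sup>2 / 2 \<le> exp (\<rho> * weight T)"
          using exp_lower_Taylor_quadratic[of "\<rho> * weight T"] \<rho>(1) weight_nonneg[of T] by (smt (verit) mult_nonneg_nonneg)
        then show ?thesis using \<rho>(1) by (simp add: field_simps power_mult_distrib)
      qed
      have "?R T = exp (phase \<gamma> u T) * (exp ?w - 1 - ?w)"
        unfolding phase_add exp_add by (simp add: algebra_simps)
      then have "norm (?R T) \<le> norm (exp (phase \<gamma> u T)) * (exp (norm ?w) * (norm ?w)\<^sup>2)"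
        using exp_remainder_bound[of ?w] by (simp add: norm_mult mult_left_mono)
      also have "\<dots> \<le> norm (exp (phase \<gamma> u T)) * (exp (\<rho> * weight T) * (norm h * weight T)\<^sup>2)"
        using w w' by (intro mult_left_mono mult_mono power_mono) auto
      also have "\<dots> = norm (exp (phase \<gamma> u T)) * exp (\<rho> * weight T) * (norm h)\<^sup>2 * (weight T)\<^sup>2"
        by (simp add: power_mult_distrib mult_ac)
      also have "\<dots> \<le> norm (exp (phase \<gamma> u T)) * exp (\<rho> * weight T) * (norm h)\<^sup>2 * (2 / \<rho>\<^sup>2 * exp (\<rho> * weight T))"
        by (intro mult_left_mono q) auto
      also have "\<dots> = 2 / \<rho>\<^sup>2 * (norm h)\<^sup>2 * ?B T"
        by (simp add: mult_exp_exp mult_ac)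
      finally show ?thesis .
    qed
    have "(case (\<gamma>, u) + h of (\<gamma>, u) \<Rightarrow> exp_integral \<nu> \<gamma> u) - (case (\<gamma>, u) of (\<gamma>, u) \<Rightarrow> exp_integral \<nu> \<gamma> u) - D h
        = (\<integral>T. ?R T \<partial>\<nu>)"
      using integrable_phase[OF \<nu> dom] integrable_phase[OF \<nu> \<gamma> u]
      by (simp add: hd D_def exp_integral_def)
    also have "norm \<dots> \<le> (\<integral>T. 2 / \<rho>\<^sup>2 * (norm h)\<^sup>2 * ?B T \<partial>\<nu>)"
      using integrable_phase[OF \<nu> dom] integrable_phase[OF \<nu> \<gamma> u] intB R
      by (intro Bochner_Integration.integral_norm_bound_integral Bochner_Integration.integrable_diff integrable_mult_right) auto
    also have "\<dots> = 2 / \<rho>\<^sup>2 * (norm h)\<^sup>2 * (\<integral>T. ?B T \<partial>\<nu>)" by simp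
    finally show "norm ((case (\<gamma>, u) + h of (\<gamma>, u) \<Rightarrow> exp_integral \<nu> \<gamma> u)
        - (case (\<gamma>, u) of (\<gamma>, u) \<Rightarrow> exp_integral \<nu> \<gamma> u) - D h) \<le> 2 / \<rho>\<^sup>2 * (\<integral>T. ?B T \<partial>\<nu>) * (norm h)\<^sup>2"
      by (simp add: mult_ac)
  qed
  then show ?thesis by (simp add: D_def)
qed

lemma exp_integral_has_derivative_u:
  assumes "tempered \<nu>" "\<gamma> \<in> gamma_domain" "u \<in> pos_orthant"
  shows "(exp_integral \<nu> \<gamma> has_derivative (\<lambda>v. \<integral>T. phase 0 v T * exp (phase \<gamma> u T) \<partial>\<nu>)) (at u)"
proof -
  have "((\<lambda>u. (\<gamma>, u)) has_derivative (\<lambda>v. (0, v))) (at u)"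
    by (auto intro!: derivative_eq_intros)
  from has_derivative_compose[OF this exp_integral_has_derivative[OF assms]]
  show ?thesis by simp
qed

lemma phase_axis_shift: "exp (phase (\<gamma> + axis i 1) u T) = of_real (exp (T $ i)) * exp (phase \<gamma> u T)"
proof -
  have "phase (axis i 1) 0 T = of_real (T $ i)"
    by (simp add: phase_def axis_def if_distrib[of "\<lambda>x. x * _"] cong: if_cong)
  then have "phase (\<gamma> + axis i 1) u T = phase \<gamma> u T + of_real (T $ i)"
    using phase_add[of \<gamma> "axis i 1" u 0 T] by simp
  then show ?thesis by (simp add: exp_add exp_of_real mult.commute)
qed

text \<open>Differentiating \<open>exp (- u\<^sub>i e\<^bsup>T\<^sub>i\<^esup>)\<close> brings down \<open>- e\<^bsup>T\<^sub>i\<^esup>\<close>, which is absorbed as a shift of \<open>\<gamma>\<^sub>i\<close> by one.\<close>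

lemma pd_exp_integral:
  assumes "tempered \<nu>" "\<gamma> \<in> gamma_domain" "u \<in> pos_orthant"
  shows "pd i (exp_integral \<nu> \<gamma>) u = - exp_integral \<nu> (\<gamma> + axis i 1) u"
proof -
  have "phase 0 (axis i 1) T * exp (phase \<gamma> u T) = - exp (phase (\<gamma> + axis i 1) u T)" for T
  proof -
    have "phase 0 (axis i 1) T = (\<Sum>j\<in>UNIV. if i = j then - of_real (exp (T $ j)) else 0)"
      unfolding phase_def by (intro sum.cong) (auto simp: axis_def)
    then have "phase 0 (axis i 1) T = - of_real (exp (T $ i))" by simp
    then show ?thesis by (simp add: phase_axis_shift)
  qed
  then show ?thesis
    unfolding has_vector_derivative_pd[OF exp_integral_has_derivative_u[OF assms]]
    by (simp add: exp_integral_def)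
qed

lemma exp_integral_has_field_derivative:
  assumes "tempered \<nu>" "\<gamma> \<in> gamma_domain" "u \<in> pos_orthant"
  shows "((\<lambda>z. exp_integral \<nu> (\<gamma> + axis i z) u) has_field_derivative
    (\<integral>T. of_real (T $ i) * exp (phase \<gamma> u T) \<partial>\<nu>)) (at 0)"
proof -
  have bl: "bounded_linear (\<lambda>z::complex. axis i z :: complex ^ 'a)"
    by (intro linear_conv_bounded_linear[THEN iffD1] linearI) (auto simp: vec_eq_iff axis_def)
  have 1: "((\<lambda>z. (\<gamma> + axis i z, u)) has_derivative (\<lambda>z. (axis i z, 0))) (at (0::complex))"
    using bounded_linear_imp_has_derivative[OF bl]
    by (auto intro!: derivative_eq_intros)
  have shift0: "\<gamma> + axis i 0 = \<gamma>" by (simp add: vec_eq_iff axis_def)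
  have 2: "((\<lambda>(\<gamma>, u). exp_integral \<nu> \<gamma> u) has_derivative
      (\<lambda>(\<delta>, v). \<integral>T. phase \<delta> v T * exp (phase \<gamma> u T) \<partial>\<nu>)) (at (\<gamma> + axis i 0, u))"
    using exp_integral_has_derivative[OF assms] by (simp only: shift0)
  have ax: "phase (axis i z) 0 T = of_real (T $ i) * z" for z T
  proof -
    have "phase (axis i z) 0 T = (\<Sum>j\<in>UNIV. if i = j then of_real (T $ j) * z else 0)"
      unfolding phase_def by (intro sum.cong) (auto simp: axis_def)
    then show ?thesis by simp
  qed
  have "((\<lambda>z. exp_integral \<nu> (\<gamma> + axis i z) u) has_derivative
      (\<lambda>z. \<integral>T. phase (axis i z) 0 T * exp (phase \<gamma> u T) \<partial>\<nu>)) (at 0)"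
    using has_derivative_compose[OF 1 2] by simp
  moreover have "(\<integral>T. phase (axis i z) 0 T * exp (phase \<gamma> u T) \<partial>\<nu>) =
      (\<integral>T. of_real (T $ i) * exp (phase \<gamma> u T) \<partial>\<nu>) * z" for z
  proof -
    have "(\<integral>T. phase (axis i z) 0 T * exp (phase \<gamma> u T) \<partial>\<nu>) =
        (\<integral>T. (of_real (T $ i) * exp (phase \<gamma> u T)) * z \<partial>\<nu>)"
      by (simp add: ax mult_ac)
    also have "\<dots> = (\<integral>T. of_real (T $ i) * exp (phase \<gamma> u T) \<partial>\<nu>) * z" by simp
    finally show ?thesis .
  qed
  ultimately show ?thesis by (simp add: has_field_derivative_def)
qed

lemma integrable_coordinate_phase:
  assumes "tempered \<nu>" "\<gamma> \<in> gamma_domain" "u \<in> pos_orthant"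
  shows "integrable \<nu> (\<lambda>T. of_real (T $ i) * exp (phase \<gamma> u T))"
proof -
  have "phase (axis i 1) 0 T = of_real (T $ i)" for T
    by (simp add: phase_def axis_def if_distrib[of "\<lambda>x. x * _"] cong: if_cong)
  then show ?thesis using integrable_phase(2)[OF assms, of "axis i 1" 0] by simp
qed

lemma tempered_lborel: "tempered (lborel :: (real ^ 'n::finite) measure)"
  unfolding tempered_def
proof (intro conjI allI impI)
  fix e :: real assume e: "0 < e"
  have half: "(\<integral>\<^sup>+x. ennreal (exp (- e * x)) * indicator {0..} x \<partial>lborel) = ennreal (1 / e)"
  proof -
    have "(\<integral>\<^sup>+x. ennreal (exp (- e * x)) * indicator {0..} x \<partial>lborel) = ennreal (0 - (- exp (- e * 0) / e))"
    proof (rule nn_integral_FTC_atLeast)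
      show "((\<lambda>x. - exp (- e * x) / e) has_real_derivative exp (- e * x)) (at x)" for x
        using e by (auto intro!: derivative_eq_intros)
      have "filterlim (\<lambda>x. e * x) at_top at_top"
        using e by (intro filterlim_tendsto_pos_mult_at_top[OF tendsto_const]) (auto simp: filterlim_ident)
      then have "((\<lambda>x. exp (- (e * x))) \<longlongrightarrow> 0) at_top"
        by (intro filterlim_compose[OF exp_at_bot]) (simp add: filterlim_uminus_at_bot)
      from tendsto_divide[OF tendsto_minus[OF this] tendsto_const[of e]] e
      show "((\<lambda>x. - exp (- e * x) / e) \<longlongrightarrow> 0) at_top" by simp
    qed auto
    then show ?thesis by simp
  qed
  have "(\<integral>\<^sup>+x. ennreal (exp (- e * \<bar>x\<bar>)) \<partial>lborel) \<le>
      (\<integral>\<^sup>+x. ennreal (exp (- e * x)) * indicator {0..} x + ennreal (exp (- e * (0 + (-1) * x))) * indicator {0..} (0 + (-1) * x) \<partial>lborel)"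
    by (intro nn_integral_mono) (auto split: split_indicator)
  also have "\<dots> = ennreal (1 / e) + (\<integral>\<^sup>+x. ennreal (exp (- e * (0 + (-1) * x))) * indicator {0..} (0 + (-1) * x) \<partial>lborel)"
    by (subst nn_integral_add) (simp_all add: half[simplified])
  also have "(\<integral>\<^sup>+x. ennreal (exp (- e * (0 + (-1) * x))) * indicator {0..} (0 + (-1) * x) \<partial>lborel) = ennreal (1 / e)"
    using nn_integral_real_affine[of "\<lambda>x. ennreal (exp (- e * x)) * indicator {0..} x" "-1" 0] half by simp
  finally have one: "(\<integral>\<^sup>+x. ennreal (exp (- e * \<bar>x\<bar>)) \<partial>lborel) < \<infinity>"
    by (simp add: le_less_trans)
  have "(\<integral>\<^sup>+T. ennreal (exp (- e * (\<Sum>i\<in>UNIV. \<bar>T $ i\<bar>))) \<partial>(lborel :: (real ^ 'n) measure)) =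
      (\<integral>\<^sup>+T. (\<Prod>b\<in>Basis. ennreal (exp (- e * \<bar>T \<bullet> b\<bar>))) \<partial>(lborel :: (real ^ 'n) measure))"
  proof (rule nn_integral_cong)
    fix T :: "real ^ 'n"
    have B: "(Basis :: (real ^ 'n) set) = (\<lambda>i. axis i 1) ` UNIV"
      by (auto simp: Basis_vec_def)
    have inj: "inj (\<lambda>i::'n. axis i (1::real))" by (auto intro!: injI simp: axis_eq_axis)
    have "(\<Prod>b\<in>Basis. ennreal (exp (- e * \<bar>T \<bullet> b\<bar>))) = (\<Prod>i\<in>UNIV. ennreal (exp (- e * \<bar>T $ i\<bar>)))"
      unfolding B by (subst prod.reindex[OF inj]) (simp add: inner_axis)
    also have "\<dots> = ennreal (exp (\<Sum>i\<in>UNIV. - e * \<bar>T $ i\<bar>))"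
      by (simp add: prod_ennreal exp_sum)
    finally show "ennreal (exp (- e * (\<Sum>i\<in>UNIV. \<bar>T $ i\<bar>))) = (\<Prod>b\<in>Basis. ennreal (exp (- e * \<bar>T \<bullet> b\<bar>)))"
      by (simp add: sum_distrib_left)
  qed
  also have "\<dots> = (\<Prod>b\<in>(Basis :: (real ^ 'n) set). \<integral>\<^sup>+x. ennreal (exp (- e * \<bar>x\<bar>)) \<partial>lborel)"
    by (rule nn_integral_lborel_prod) auto
  also have "\<dots> < \<infinity>" using one by (simp add: power_less_top_ennreal)
  finally show "integrable (lborel :: (real ^ 'n) measure) (\<lambda>T. exp (- e * (\<Sum>i\<in>UNIV. \<bar>T $ i\<bar>)))"
    by (simp add: integrable_iff_bounded)
qed simp

section \<open>Lebesgue measure in linear coordinates\<close>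

text \<open>Uniqueness of Haar measure for \<open>\<real>\<^sup>N\<close>, by the classical Fubini argument: with \<open>f\<close> and \<open>g\<close> the indicators of
\<open>A\<close> and \<open>B\<close>, shift the inner variable of \<open>\<integral>\<integral> f(x) g(y) dy dM(x)\<close> by \<open>x\<close>, exchange the integrals, shift
the other variable by \<open>- y\<close>, and exchange back.  The reflection invariance of Lebesgue measure then
decouples the two factors.\<close>

lemma emeasure_translation_invariant:
  fixes M :: "'a::euclidean_space measure"
  assumes sets [measurable_cong]: "sets M = sets borel" and sf: "sigma_finite_measure M"
    and inv: "\<And>c. distr M borel ((+) c) = M"
    and A [measurable]: "A \<in> sets borel" and B [measurable]: "B \<in> sets borel"
  shows "emeasure M A * emeasure lborel B = emeasure M B * emeasure lborel A"
proof -
  interpret M: sigma_finite_measure M by fact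
  interpret P: pair_sigma_finite M lborel ..
  define f g where "f = (indicator A :: 'a \<Rightarrow> ennreal)" and "g = (indicator B :: 'a \<Rightarrow> ennreal)"
  have [measurable]: "f \<in> borel_measurable borel" "g \<in> borel_measurable borel"
    unfolding f_def g_def by measurable
  have Mf: "integral\<^sup>N M f = emeasure M A" "integral\<^sup>N M g = emeasure M B"
    using sets by (simp_all add: f_def g_def)
  have transM: "(\<integral>\<^sup>+x. h x \<partial>M) = (\<integral>\<^sup>+x. h (c + x) \<partial>M)" if [measurable]: "h \<in> borel_measurable borel" for h c
    by (subst inv[of c, symmetric]) (simp add: nn_integral_distr)
  have transL: "(\<integral>\<^sup>+x. h x \<partial>lborel) = (\<integral>\<^sup>+x. h (c + x) \<partial>lborel)" if [measurable]: "h \<in> borel_measurable borel" for h and c :: 'a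
    by (subst lborel_distr_plus[of c, symmetric]) (simp add: nn_integral_distr)
  have reflect: "(\<integral>\<^sup>+y. f (x - y) \<partial>lborel) = emeasure lborel A" for x
  proof -
    have "lborel = distr lborel borel (\<lambda>y. x + (-1) *\<^sub>R y :: 'a)"
      by (subst lborel_affine[of "-1" x]) (simp_all add: density_1)
    then have "(\<integral>\<^sup>+y. f y \<partial>lborel) = (\<integral>\<^sup>+y. f y \<partial>distr lborel borel (\<lambda>y. x + (-1) *\<^sub>R y))" by simp
    also have "\<dots> = (\<integral>\<^sup>+y. f (x - y) \<partial>lborel)" by (subst nn_integral_distr) simp_all
    finally show ?thesis by (simp add: f_def)
  qed
  have "emeasure M A * emeasure lborel B = (\<integral>\<^sup>+x. f x * (\<integral>\<^sup>+y. g y \<partial>lborel) \<partial>M)"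
    by (simp add: nn_integral_multc Mf) (simp add: g_def)
  also have "\<dots> = (\<integral>\<^sup>+x. (\<integral>\<^sup>+y. f x * g (x + y) \<partial>lborel) \<partial>M)"
    by (intro nn_integral_cong, subst transL) (simp_all add: nn_integral_cmult)
  also have "\<dots> = (\<integral>\<^sup>+y. (\<integral>\<^sup>+x. f x * g (x + y) \<partial>M) \<partial>lborel)"
    by (rule P.Fubini'[symmetric]) simp
  also have "\<dots> = (\<integral>\<^sup>+y. (\<integral>\<^sup>+x. f (x - y) * g x \<partial>M) \<partial>lborel)"
  proof (rule nn_integral_cong)
    fix y show "(\<integral>\<^sup>+x. f x * g (x + y) \<partial>M) = (\<integral>\<^sup>+x. f (x - y) * g x \<partial>M)"
      by (subst transM[of _ "- y"]) simp_all
  qed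
  also have "\<dots> = (\<integral>\<^sup>+x. (\<integral>\<^sup>+y. f (x - y) * g x \<partial>lborel) \<partial>M)"
    by (rule P.Fubini') simp
  also have "\<dots> = emeasure M B * emeasure lborel A"
    by (simp add: nn_integral_multc reflect Mf(2) mult.commute nn_integral_cmult)
  finally show ?thesis .
qed

lemma sigma_finite_distr:
  assumes "sigma_finite_measure M" and f [measurable]: "f \<in> M \<rightarrow>\<^sub>M N" and r [measurable]: "r \<in> N \<rightarrow>\<^sub>M M"
    and inv: "\<And>x. x \<in> space M \<Longrightarrow> r (f x) = x"
  shows "sigma_finite_measure (distr M N f)"
proof -
  interpret sigma_finite_measure M by fact
  obtain A :: "nat \<Rightarrow> 'a set" where A: "range A \<subseteq> sets M" "(\<Union>i. A i) = space M" "\<And>i. emeasure M (A i) \<noteq> \<infinity>"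
    using sigma_finite by metis
  have [measurable]: "A i \<in> sets M" for i using A(1) by auto
  have "f -` (r -` A i \<inter> space N) \<inter> space M = A i" for i
    using inv measurable_space[OF f] sets.sets_into_space[of "A i" M] by auto
  then have fin: "emeasure (distr M N f) (r -` A i \<inter> space N) \<noteq> \<infinity>" for i
    using A(3) by (subst emeasure_distr) simp_all
  have cover: "\<exists>i. r x \<in> A i" if "x \<in> space N" for x
    using measurable_space[OF r that] A(2) by blast
  show ?thesis
  proof
    show "\<exists>B. countable B \<and> B \<subseteq> sets (distr M N f) \<and> \<Union> B = space (distr M N f) \<and>
        (\<forall>a\<in>B. emeasure (distr M N f) a \<noteq> \<infinity>)"
      using fin cover
      by (intro exI[of _ "range (\<lambda>i. r -` A i \<inter> space N)"]) auto
  qed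
qed

lemma sigma_finite_scale_measure:
  assumes "sigma_finite_measure M" "c < \<infinity>"
  shows "sigma_finite_measure (scale_measure c M)"
proof -
  interpret sigma_finite_measure M by fact
  obtain A where "countable A" "A \<subseteq> sets M" "\<Union>A = space M" "\<forall>a\<in>A. emeasure M a \<noteq> \<infinity>"
    using sigma_finite_countable by blast
  then show ?thesis using assms(2)
    by unfold_locales (auto simp: space_scale_measure ennreal_mult_eq_top_iff intro!: exI[of _ A])
qed

text \<open>The image of Lebesgue measure under a linear automorphism is translation invariant, hence a
multiple of Lebesgue measure.  The factor is \<open>\<bar>det g\<bar>\<close>; it is found by
comparing the measures of the unit cube.\<close>

lemma lborel_linear_image:
  fixes g :: "'a::euclidean_space \<Rightarrow> 'a"
  assumes lin: "linear g" and inj: "inj g"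
  obtains c :: real where "0 < c" "lborel = scale_measure (ennreal c) (distr lborel borel g)"
proof -
  obtain h where h: "linear h" "\<And>x. h (g x) = x" "\<And>x. g (h x) = x"
    using linear_injective_isomorphism[OF lin inj] by metis
  have [measurable]: "g \<in> borel_measurable borel" "h \<in> borel_measurable borel"
    using lin h(1) by (auto intro!: borel_measurable_continuous_onI linear_continuous_on
        simp: linear_conv_bounded_linear)
  define M where "M = distr lborel borel g"
  have sf: "sigma_finite_measure M"
    unfolding M_def by (rule sigma_finite_distr[where r = h]) (use h in \<open>auto intro: sigma_finite_lborel\<close>)
  have inv: "distr M borel ((+) c) = M" for c
  proof -
    have "distr M borel ((+) c) = distr lborel borel (\<lambda>x. g (h c + x))"
      unfolding M_def by (subst distr_distr) (auto simp: comp_def linear_add[OF lin] h)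
    also have "\<dots> = distr (distr lborel borel ((+) (h c))) borel g"
      by (subst distr_distr) (auto simp: comp_def)
    finally show ?thesis by (simp add: lborel_distr_plus M_def)
  qed
  define Q where "Q = (cbox 0 One :: 'a set)"
  have Q1: "emeasure lborel Q = 1"
    by (simp add: Q_def emeasure_lborel_cbox_eq)
  have vi: "g -` Q = h ` Q" by (auto simp: h(3)) (metis h(2) image_eqI)
  have "bounded (g -` Q)" unfolding vi unfolding Q_def using h(1)
    by (intro bounded_linear_image bounded_cbox) (simp add: linear_conv_bounded_linear)
  then have "emeasure lborel (g -` Q) < \<infinity>" by (rule emeasure_bounded_finite)
  then have fin: "emeasure M Q < \<infinity>" by (simp add: M_def emeasure_distr Q_def)
  \<comment> \<open>The unit cube normalises: it has Lebesgue measure one.\<close>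
  have eq: "emeasure M A = emeasure M Q * emeasure lborel A" if "A \<in> sets borel" for A
    using emeasure_translation_invariant[OF _ sf inv that, of Q] Q1
    by (simp add: M_def Q_def)
  have pos: "emeasure M Q \<noteq> 0"
  proof
    assume "emeasure M Q = 0"
    then have "emeasure M UNIV = 0" using eq[of UNIV] by simp
    then show False by (simp add: M_def emeasure_distr)
  qed
  obtain k where k: "emeasure M Q = ennreal k" "0 < k"
    using fin pos by (cases "emeasure M Q") (auto simp: less_le)
  have "lborel = scale_measure (ennreal (1 / k)) M"
  proof (rule measure_eqI)
    show "sets lborel = sets (scale_measure (ennreal (1 / k)) M)" by (simp add: M_def)
    fix A :: "'a set" assume "A \<in> sets lborel"
    then have "emeasure (scale_measure (ennreal (1 / k)) M) A = ennreal (1 / k) * ennreal k * emeasure lborel A"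
      using eq[of A] k by (simp add: mult.assoc)
    also have "ennreal (1 / k) * ennreal k = 1"
      using k by (simp add: ennreal_mult'[symmetric] del: ennreal_mult')
    finally show "emeasure lborel A = emeasure (scale_measure (ennreal (1 / k)) M) A" by simp
  qed
  then show ?thesis using that[of "1 / k"] k by (simp add: M_def)
qed

lemma PiM_reindex:
  fixes \<beta> :: "'i \<Rightarrow> 'b" and M :: "real measure"
  assumes \<beta>: "bij_betw \<beta> I B" and fin: "finite I" and M: "sigma_finite_measure M"
  shows "PiM B (\<lambda>_. M) = distr (PiM I (\<lambda>_. M)) (PiM B (\<lambda>_. M)) (\<lambda>x. \<lambda>b\<in>B. x (inv_into I \<beta> b))"
proof -
  interpret sigma_finite_measure M by (rule M)
  interpret I: product_sigma_finite "\<lambda>_::'i. M" ..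
  interpret B: product_sigma_finite "\<lambda>_::'b. M" ..
  have inv: "inv_into I \<beta> b \<in> I" "\<beta> (inv_into I \<beta> b) = b" if "b \<in> B" for b
    using \<beta> that by (auto simp: bij_betw_def inv_into_into f_inv_into_f)
  have inv': "inv_into I \<beta> (\<beta> i) = i" "\<beta> i \<in> B" if "i \<in> I" for i
    using \<beta> that by (auto simp: bij_betw_def)
  have [measurable]: "(\<lambda>x. \<lambda>b\<in>B. x (inv_into I \<beta> b)) \<in> PiM I (\<lambda>_. M) \<rightarrow>\<^sub>M PiM B (\<lambda>_. M)"
    using inv by (intro measurable_restrict measurable_component_singleton) auto
  show ?thesis
  proof (rule B.PiM_eqI[symmetric])
    show "finite B" using \<beta> fin bij_betw_finite by blast
    fix A assume A: "\<And>b. b \<in> B \<Longrightarrow> A b \<in> sets M"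
    have "(\<lambda>x. \<lambda>b\<in>B. x (inv_into I \<beta> b)) -` Pi\<^sub>E B A \<inter> space (PiM I (\<lambda>_. M)) = Pi\<^sub>E I (\<lambda>i. A (\<beta> i))"
    proof (intro set_eqI iffI)
      fix x assume x: "x \<in> (\<lambda>x. \<lambda>b\<in>B. x (inv_into I \<beta> b)) -` Pi\<^sub>E B A \<inter> space (PiM I (\<lambda>_. M))"
      then have "x (inv_into I \<beta> (\<beta> i)) \<in> A (\<beta> i)" if "i \<in> I" for i
        using inv'(2)[OF that] by (auto simp: PiE_iff)
      then show "x \<in> Pi\<^sub>E I (\<lambda>i. A (\<beta> i))" using x inv' by (auto simp: space_PiM PiE_iff)
    next
      fix x assume x: "x \<in> Pi\<^sub>E I (\<lambda>i. A (\<beta> i))"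
      then have "x (inv_into I \<beta> b) \<in> A b" if "b \<in> B" for b
        using inv[OF that] by (metis PiE_mem)
      moreover have "x i \<in> space M" if "i \<in> I" for i
        using x A[OF inv'(2)[OF that]] that sets.sets_into_space by (meson PiE_mem subsetD)
      ultimately show "x \<in> (\<lambda>x. \<lambda>b\<in>B. x (inv_into I \<beta> b)) -` Pi\<^sub>E B A \<inter> space (PiM I (\<lambda>_. M))"
        using x by (auto simp: space_PiM PiE_iff)
    qed
    moreover have "Pi\<^sub>E B A \<in> sets (PiM B (\<lambda>_. M))"
      using A \<open>finite B\<close> by (intro sets_PiM_I_finite) auto
    ultimately have "emeasure (distr (PiM I (\<lambda>_. M)) (PiM B (\<lambda>_. M)) (\<lambda>x. \<lambda>b\<in>B. x (inv_into I \<beta> b))) (Pi\<^sub>E B A)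
        = (\<Prod>i\<in>I. emeasure M (A (\<beta> i)))"
      using A inv' fin by (simp add: emeasure_distr I.emeasure_PiM)
    also have "\<dots> = (\<Prod>b\<in>B. emeasure M (A b))"
      by (rule prod.reindex_bij_betw[OF \<beta>])
    finally show "emeasure (distr (PiM I (\<lambda>_. M)) (PiM B (\<lambda>_. M)) (\<lambda>x. \<lambda>b\<in>B. x (inv_into I \<beta> b))) (Pi\<^sub>E B A)
        = (\<Prod>b\<in>B. emeasure M (A b))" .
  qed simp
qed

lemma lborel_in_coordinates:
  fixes \<beta> :: "'i \<Rightarrow> 'a::euclidean_space" and g :: "'a \<Rightarrow> 'a"
  assumes \<beta>: "bij_betw \<beta> I Basis" and fin: "finite I" and g: "linear g" "inj g"
  obtains c :: real where "0 < c"
    "lborel = scale_measure (ennreal c) (distr (PiM I (\<lambda>_. lborel)) borel (\<lambda>x. \<Sum>k\<in>I. x k *\<^sub>R g (\<beta> k)))"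
proof -
  obtain c where c: "0 < c" "lborel = scale_measure (ennreal c) (distr lborel borel g)"
    using lborel_linear_image[OF g] by blast
  have [measurable]: "g \<in> borel_measurable borel"
    using g(1) by (auto intro!: borel_measurable_continuous_onI linear_continuous_on
        simp: linear_conv_bounded_linear)
  have inv: "inv_into I \<beta> b \<in> I" if "b \<in> Basis" for b
    using \<beta> that by (auto simp: bij_betw_def inv_into_into)
  have inv': "inv_into I \<beta> (\<beta> i) = i" "\<beta> i \<in> Basis" if "i \<in> I" for i
    using \<beta> that by (auto simp: bij_betw_def)
  have m: "(\<lambda>x. \<lambda>b\<in>Basis. x (inv_into I \<beta> b)) \<in> PiM I (\<lambda>_. lborel) \<rightarrow>\<^sub>M PiM Basis (\<lambda>_. lborel :: real measure)"
    using inv by (intro measurable_restrict measurable_component_singleton) auto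
  have "lborel = distr (PiM Basis (\<lambda>_. lborel)) borel (\<lambda>f. \<Sum>b\<in>Basis. f b *\<^sub>R b :: 'a)"
    by (rule lborel_eq)
  also have "\<dots> = distr (PiM I (\<lambda>_. lborel)) borel (\<lambda>x. \<Sum>b\<in>Basis. x (inv_into I \<beta> b) *\<^sub>R b)"
    by (subst PiM_reindex[OF \<beta> fin sigma_finite_lborel], subst distr_distr) (use m in \<open>auto simp: comp_def\<close>)
  also have "(\<lambda>x. \<Sum>b\<in>Basis. x (inv_into I \<beta> b) *\<^sub>R b) = (\<lambda>x. \<Sum>k\<in>I. x k *\<^sub>R \<beta> k)"
    using inv' by (subst sum.reindex_bij_betw[OF \<beta>, symmetric]) simp
  finally have "distr lborel borel g = distr (distr (PiM I (\<lambda>_. lborel)) borel (\<lambda>x. \<Sum>k\<in>I. x k *\<^sub>R \<beta> k)) borel g"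
    by simp
  also have "\<dots> = distr (PiM I (\<lambda>_. lborel)) borel (\<lambda>x. \<Sum>k\<in>I. x k *\<^sub>R g (\<beta> k))"
    by (subst distr_distr) (auto simp: comp_def linear_sum[OF g(1)] linear_scale[OF g(1)])
  finally show ?thesis using c that by metis
qed

text \<open>A spanning family of the right cardinality has a dual basis, here presented as the image of the
standard basis under an automorphism \<open>g\<close>.  The inverse of \<open>g\<close> is \<open>x \<mapsto> (e\<^sub>k \<bullet> x)\<^sub>k\<close>, which is injective
because a vector orthogonal to a spanning set vanishes.\<close>

lemma dual_family:
  fixes e :: "'i \<Rightarrow> 'a::euclidean_space"
  assumes fin: "finite I" and card: "card I = DIM('a)" and span: "span (e ` I) = UNIV"
  obtains \<beta> g where "bij_betw \<beta> I (Basis :: 'a set)" "linear g" "inj g"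
    "\<And>j k. j \<in> I \<Longrightarrow> k \<in> I \<Longrightarrow> e j \<bullet> g (\<beta> k) = (if j = k then 1 else 0)"
proof -
  obtain \<beta> where \<beta>: "bij_betw \<beta> I (Basis :: 'a set)"
    using finite_same_card_bij[OF fin finite_Basis] card by metis
  have \<beta>b: "\<beta> k \<in> Basis" if "k \<in> I" for k using \<beta> that by (auto simp: bij_betw_def)
  have \<beta>eq: "\<beta> j = \<beta> k \<longleftrightarrow> j = k" if "j \<in> I" "k \<in> I" for j k
    using \<beta> that by (auto simp: bij_betw_def inj_on_def)
  define h where "h x = (\<Sum>k\<in>I. (e k \<bullet> x) *\<^sub>R \<beta> k)" for x
  have lin: "linear h"
    by (rule linearI) (simp_all add: h_def inner_add_right scaleR_add_left sum.distrib scaleR_sum_right)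
  have comp: "h x \<bullet> \<beta> j = e j \<bullet> x" if "j \<in> I" for x j
    using that fin by (simp add: h_def inner_sum_left inner_Basis \<beta>b \<beta>eq if_distrib cong: if_cong sum.cong)
  have "inj h"
  proof (rule linear_injective_0[OF lin, THEN iffD2], intro allI impI)
    fix x assume "h x = 0"
    then have "orthogonal x (e j)" if "j \<in> I" for j
      using comp[OF that, of x] by (simp add: orthogonal_def inner_commute)
    then have "orthogonal x x" using span by (intro orthogonal_to_span[of x "e ` I"]) auto
    then show "x = 0" by (simp add: orthogonal_def)
  qed
  then obtain g where g: "linear g" "\<And>x. g (h x) = x" "\<And>x. h (g x) = x"
    using linear_injective_isomorphism[OF lin] by metis
  show ?thesis
  proof (rule that[OF \<beta> g(1)])
    show "inj g" using g(3) by (metis injI)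
    show "e j \<bullet> g (\<beta> k) = (if j = k then 1 else 0)" if "j \<in> I" "k \<in> I" for j k
      using comp[OF that(1), of "g (\<beta> k)"] that by (auto simp: g inner_Basis \<beta>b \<beta>eq)
  qed
qed

section \<open>The relation lattice as a real subspace\<close>

definition real_vec :: "int ^ 'k \<Rightarrow> real ^ 'k" where
  "real_vec v = (\<chi> i. of_int (v $ i))"

lemma real_vec_simps [simp]:
  "real_vec 0 = 0" "real_vec (v + w) = real_vec v + real_vec w"
  "real_vec (v - w) = real_vec v - real_vec w" "real_vec (c *s v) = of_int c *\<^sub>R real_vec v"
  by (simp_all add: real_vec_def vec_eq_iff)

lemma real_vec_sum: "real_vec (sum f A) = (\<Sum>x\<in>A. real_vec (f x))"
  by (induction A rule: infinite_finite_induct) simp_all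

lemma real_vec_axis: "real_vec (axis i 1) = axis i 1"
  by (auto simp: real_vec_def vec_eq_iff axis_def)

lemma real_vec_span:
  assumes "v \<in> zvec.span S" shows "real_vec v \<in> span (real_vec ` S)"
  using assms
proof (induction rule: zvec.span_induct_alt)
  case base then show ?case by (simp add: span_zero)
next
  case (step c x y) then show ?case
    by (simp add: span_add span_scale span_base)
qed

lemma span_axes:
  fixes S :: "(real ^ 'n::finite) set"
  assumes "\<And>i. axis i 1 \<in> span S" shows "span S = UNIV"
proof -
  have "Basis \<subseteq> span S" using assms by (auto simp: Basis_vec_def)
  then have "span (Basis :: (real ^ 'n) set) \<subseteq> span S" by (intro span_minimal subspace_span)
  then show ?thesis by auto
qed

text \<open>Since \<open>\<A>\<close> generates \<open>\<int>\<^sup>m\<close>, the map \<open>q \<mapsto> \<Sum>\<^sub>i q\<^sub>i a\<^sub>i\<close> has an additive section.\<close>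

lemma integer_section:
  fixes a :: "'n::finite \<Rightarrow> int ^ 'm::finite"
  assumes "zvec.span (range a) = UNIV"
  obtains q :: "'m \<Rightarrow> int ^ 'n" where "\<And>s. (\<Sum>i\<in>UNIV. q s $ i *s a i) = axis s 1"
proof -
  let ?R = "range (\<lambda>q::int ^ 'n. \<Sum>i\<in>UNIV. q $ i *s a i)"
  have "zvec.subspace ?R"
    unfolding zvec.subspace_def
  proof (intro conjI ballI allI)
    show "0 \<in> ?R" by (rule range_eqI[of _ _ 0]) simp
    fix x assume "x \<in> ?R"
    then obtain p where p: "x = (\<Sum>i\<in>UNIV. p $ i *s a i)" by blast
    show "c *s x \<in> ?R" for c
      by (rule range_eqI[of _ _ "c *s p"]) (simp add: p zvec.scale_sum_right)
    fix y assume "y \<in> ?R"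
    then obtain r where r: "y = (\<Sum>i\<in>UNIV. r $ i *s a i)" by blast
    show "x + y \<in> ?R"
      by (rule range_eqI[of _ _ "p + r"]) (simp add: p r zvec.scale_left_distrib sum.distrib)
  qed
  moreover have "range a \<subseteq> ?R"
  proof (safe)
    fix i show "a i \<in> ?R"
      by (rule range_eqI[of _ _ "axis i 1"]) (simp add: axis_def if_distrib[of "\<lambda>c. c *s _"] cong: if_cong)
  qed
  ultimately have "?R = UNIV" using zvec.span_minimal[of "range a" ?R] assms by auto
  then have "axis s 1 \<in> ?R" for s by (simp only: UNIV_I)
  then have "\<exists>q. axis s 1 = (\<Sum>i\<in>UNIV. q $ i *s a i)" for s by blast
  then obtain q where q: "\<And>s. axis s 1 = (\<Sum>i\<in>UNIV. q s $ i *s a i)" by metis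
  show ?thesis by (rule that[of q]) (rule q[symmetric])
qed

lemma card_config:
  fixes a :: "'n::finite \<Rightarrow> int ^ 'm::finite"
  assumes "zvec.span (range a) = UNIV"
  shows "CARD('m) \<le> CARD('n)"
proof -
  have "axis s 1 \<in> span (real_vec ` range a)" for s
    using real_vec_span[of "axis s 1" "range a"] assms by (simp add: real_vec_axis)
  then have "span (real_vec ` range a) = UNIV" by (rule span_axes)
  then have "DIM(real ^ 'm) \<le> card (real_vec ` range a)"
    using dim_le_card[of UNIV "real_vec ` range a"] by (simp add: dim_UNIV)
  also have "\<dots> \<le> CARD('n)"
    using card_image_le[of UNIV "real_vec \<circ> a"] by (simp add: image_comp)
  finally show ?thesis by simp
qed

text \<open>Every integer vector differs from an integer combination of the lifts \<open>q\<^sub>s\<close> by a relation, so the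
\<open>l\<^sup>\<alpha>\<close> and the \<open>q\<^sub>s\<close> together span.  Since there are exactly \<open>N = (N - m) + m\<close> of them,
they form a basis of \<open>\<real>\<^sup>N\<close>.\<close>

lemma lattice_basis_spanning_completion:
  fixes a :: "'n::finite \<Rightarrow> int ^ 'm::finite"
  assumes span: "zvec.span (range a) = UNIV"
    and J: "J = {1..CARD('n) - CARD('m)}" and l: "zvec.span (l ` J) = relation_lattice a"
  obtains e where "\<And>\<alpha>. \<alpha> \<in> J \<Longrightarrow> e \<alpha> = real_vec (l \<alpha>)" "span (e ` {1..CARD('n)}) = UNIV"
proof -
  obtain q where q: "\<And>s. (\<Sum>i\<in>UNIV. q s $ i *s a i) = axis s 1"
    using integer_section[OF span] by metis
  have le: "CARD('m) \<le> CARD('n)" by (rule card_config[OF span])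
  let ?K = "{CARD('n) - CARD('m) + 1..CARD('n)}"
  have "card ?K = CARD('m)" using le by simp
  then obtain \<theta> where \<theta>: "bij_betw \<theta> ?K (UNIV :: 'm set)"
    using finite_same_card_bij[of ?K "UNIV :: 'm set"] by auto
  define e where "e k = (if k \<in> J then real_vec (l k) else real_vec (q (\<theta> k)))" for k
  have img: "e ` {1..CARD('n)} = real_vec ` (l ` J \<union> range q)"
  proof -
    have "{1..CARD('n)} = J \<union> ?K" using J le by auto
    moreover have "e ` J = real_vec ` l ` J" by (auto simp: e_def image_comp)
    moreover have "e ` ?K = (\<lambda>k. real_vec (q (\<theta> k))) ` ?K"
      using J by (intro image_cong) (auto simp: e_def)
    moreover have "\<dots> = real_vec ` range q"
      using \<theta> by (auto simp: bij_betw_def image_comp[symmetric, of "\<lambda>s. real_vec (q s)" \<theta>, unfolded comp_def])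
    ultimately show ?thesis by (simp add: image_Un)
  qed
  have "axis i 1 \<in> span (e ` {1..CARD('n)})" for i
  proof -
    \<comment> \<open>Both \<open>axis i 1\<close> and the combination of lifts with coefficients \<open>a\<^sub>i\<close> are mapped to \<open>a\<^sub>i\<close>.\<close>
    define x :: "int ^ 'n" where "x = axis i 1 - (\<Sum>s\<in>UNIV. a i $ s *s q s)"
    have "(\<Sum>j\<in>UNIV. (\<Sum>s\<in>UNIV. a i $ s *s q s) $ j *s a j) = (\<Sum>s\<in>UNIV. a i $ s *s (\<Sum>j\<in>UNIV. q s $ j *s a j))"
      unfolding sum_component zvec.scale_sum_left zvec.scale_sum_right
      by (subst sum.swap) (simp add: mult.commute)
    also have "\<dots> = a i"
      by (simp add: q vec_eq_iff axis_def if_distrib cong: if_cong)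
    moreover have "(\<Sum>j\<in>UNIV. (axis i 1 :: int ^ 'n) $ j *s a j) = a i"
      by (simp add: axis_def if_distrib[of "\<lambda>c. c *s _"] cong: if_cong)
    ultimately have "x \<in> relation_lattice a"
      by (simp add: relation_lattice_def x_def zvec.scale_left_diff_distrib sum_subtractf)
    then have "real_vec x \<in> span (real_vec ` l ` J)" using real_vec_span l by blast
    then have "real_vec x \<in> span (e ` {1..CARD('n)})"
      unfolding img by (rule subsetD[OF span_mono, rotated]) auto
    moreover have "real_vec (\<Sum>s\<in>UNIV. a i $ s *s q s) \<in> span (e ` {1..CARD('n)})"
      unfolding img real_vec_sum by (rule span_sum, unfold real_vec_simps, intro span_scale span_base) auto
    ultimately have "real_vec x + real_vec (\<Sum>s\<in>UNIV. a i $ s *s q s) \<in> span (e ` {1..CARD('n)})"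
      by (rule span_add)
    then show ?thesis by (simp add: x_def real_vec_axis)
  qed
  then have "span (e ` {1..CARD('n)}) = UNIV" by (rule span_axes)
  then show ?thesis using that[of e] by (simp add: e_def)
qed

lemma lattice_map_real_vec: "\<alpha> \<in> J \<Longrightarrow> lattice_map J l T \<alpha> = real_vec (l \<alpha>) \<bullet> T"
  by (simp add: lattice_map_def real_vec_def inner_vec_def)

lemma lattice_map_eqI:
  assumes "s \<in> extensional J" "\<And>\<alpha>. \<alpha> \<in> J \<Longrightarrow> real_vec (l \<alpha>) \<bullet> T = s \<alpha>"
  shows "lattice_map J l T = s"
  using assms by (intro extensionalityI[of _ J]) (auto simp: lattice_map_real_vec, auto simp: lattice_map_def)

section \<open>Lebesgue measure fibred over the lattice map\<close>

text \<open>The data of a linear section \<open>s \<mapsto> \<Sum>\<^sub>\<alpha> s\<^sub>\<alpha> w\<^sub>\<alpha>\<close> of the lattice map and of a measure \<open>\<nu>\<close> carried by its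
kernel, such that adding base and fibre coordinates turns the product measure into Lebesgue
measure.\<close>

locale lattice_fibre =
  fixes J :: "nat set" and l :: "nat \<Rightarrow> int ^ 'n::finite"
    and w :: "nat \<Rightarrow> real ^ 'n" and \<nu> :: "(real ^ 'n) measure"
  assumes finite_J: "finite J"
    and sigma_finite_nu: "sigma_finite_measure \<nu>"
    and sets_nu: "sets \<nu> = sets borel"
    and kernel_nu: "AE T in \<nu>. lattice_map J l T = (\<lambda>\<alpha>\<in>J. 0)"
    and section_w: "s \<in> PiE J (\<lambda>_. UNIV) \<Longrightarrow> lattice_map J l (\<Sum>\<alpha>\<in>J. s \<alpha> *\<^sub>R w \<alpha>) = s"
    and lborel_fibred: "lborel = distr (PiM J (\<lambda>_. lborel) \<Otimes>\<^sub>M \<nu>) borel (\<lambda>(s, T). (\<Sum>\<alpha>\<in>J. s \<alpha> *\<^sub>R w \<alpha>) + T)"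

text \<open>In the coordinates dual to the \<open>l\<^sup>\<alpha>\<close> and the lifts \<open>q\<^sub>s\<close>, the lattice map is the projection to the
coordinates in \<open>J\<close>.  The remaining coordinates parametrise the kernel, and the scaling factor of
the change of coordinates is absorbed into \<open>\<nu>\<close>.\<close>

lemma lattice_fibre_exists:
  fixes a :: "'n::finite \<Rightarrow> int ^ 'm::finite"
  assumes "gkz_config a" and J: "J = {1..CARD('n) - CARD('m)}"
    and "lattice_basis (relation_lattice a) J l"
  obtains w \<nu> where "lattice_fibre J l w \<nu>"
proof -
  define I K where "I = {1..CARD('n)}" and "K = {CARD('n) - CARD('m) + 1..CARD('n)}"
  have fin: "finite I" "finite K" by (simp_all add: I_def K_def)
  obtain e where e: "\<And>\<alpha>. \<alpha> \<in> J \<Longrightarrow> e \<alpha> = real_vec (l \<alpha>)" "span (e ` I) = UNIV"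
    using lattice_basis_spanning_completion[of a J l] assms
    unfolding gkz_config_def lattice_basis_def I_def by metis
  obtain \<beta> g where \<beta>: "bij_betw \<beta> I (Basis :: (real ^ 'n) set)" and g: "linear g" "inj g"
    and dual: "\<And>j k. j \<in> I \<Longrightarrow> k \<in> I \<Longrightarrow> e j \<bullet> g (\<beta> k) = (if j = k then 1 else 0)"
    using dual_family[of I e] e(2) fin(1) by (auto simp: I_def)
  define w where "w k = g (\<beta> k)" for k
  obtain c where c: "0 < c"
    "lborel = scale_measure (ennreal c) (distr (PiM I (\<lambda>_. lborel)) borel (\<lambda>x. \<Sum>k\<in>I. x k *\<^sub>R w k))"
    using lborel_in_coordinates[OF \<beta> fin(1) g] unfolding w_def by auto
  have IJK: "I = J \<union> K" "J \<inter> K = {}" "finite J" using J by (auto simp: I_def K_def)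
  have JI: "j \<in> I" if "j \<in> J" for j using that IJK(1) by blast
  have KI: "k \<in> I" if "k \<in> K" for k using that IJK(1) by blast
  define f where "f y = (\<Sum>k\<in>K. y k *\<^sub>R w k)" for y :: "nat \<Rightarrow> real"
  define \<sigma> where "\<sigma> s = (\<Sum>\<alpha>\<in>J. s \<alpha> *\<^sub>R w \<alpha>)" for s :: "nat \<Rightarrow> real"
  let ?PJ = "PiM J (\<lambda>_. lborel :: real measure)" and ?PK = "PiM K (\<lambda>_. lborel :: real measure)"
  interpret L: product_sigma_finite "\<lambda>_::nat. lborel :: real measure" ..
  have sfK: "sigma_finite_measure ?PK" by (rule L.sigma_finite[OF fin(2)])
  interpret PK: sigma_finite_measure ?PK by (rule sfK)
  have fm [measurable]: "f \<in> ?PK \<rightarrow>\<^sub>M borel" unfolding f_def by measurable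
  have \<sigma>m [measurable]: "\<sigma> \<in> ?PJ \<rightarrow>\<^sub>M borel" unfolding \<sigma>_def by measurable
  define \<nu> where "\<nu> = scale_measure (ennreal c) (distr ?PK borel f)"
  have fe: "e j \<bullet> f y = (if j \<in> K then y j else 0)" if "j \<in> I" for j y
  proof -
    have "e j \<bullet> f y = (\<Sum>k\<in>K. if j = k then y k else 0)"
      unfolding f_def inner_sum_right w_def using dual[OF that KI] by (intro sum.cong) simp_all
    then show ?thesis using fin(2) by simp
  qed
  have \<sigma>e: "e j \<bullet> \<sigma> s = s j" if "j \<in> J" for j s
  proof -
    have "e j \<bullet> \<sigma> s = (\<Sum>k\<in>J. if j = k then s k else 0)"
      unfolding \<sigma>_def inner_sum_right w_def using dual[OF JI[OF that] JI] by (intro sum.cong) simp_all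
    then show ?thesis using that IJK(3) by simp
  qed
  have sf: "sigma_finite_measure \<nu>"
    unfolding \<nu>_def
  proof (intro sigma_finite_scale_measure sigma_finite_distr[where r = "\<lambda>T. \<lambda>k\<in>K. e k \<bullet> T"])
    show "sigma_finite_measure ?PK" by (rule sfK)
    show "(\<lambda>k\<in>K. e k \<bullet> f y) = y" if "y \<in> space ?PK" for y
    proof (rule extensionalityI[of _ K])
      show "y \<in> extensional K" using that by (simp add: space_PiM PiE_iff)
      show "(\<lambda>k\<in>K. e k \<bullet> f y) k = y k" if "k \<in> K" for k using fe[OF KI[OF that]] that by simp
    qed simp
    show "f \<in> ?PK \<rightarrow>\<^sub>M borel" by (rule fm)
  qed (auto intro!: measurable_restrict)
  interpret \<nu>: sigma_finite_measure \<nu> by (rule sf)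
  have sets\<nu>: "sets \<nu> = sets borel" by (simp add: \<nu>_def)
  note [measurable_cong] = sets\<nu>
  have ker: "AE T in \<nu>. lattice_map J l T = (\<lambda>\<alpha>\<in>J. 0)"
  proof -
    have "lattice_map J l (f y) = (\<lambda>\<alpha>\<in>J. 0)" for y
    proof (rule lattice_map_eqI)
      fix \<alpha> assume \<alpha>: "\<alpha> \<in> J"
      then have "\<alpha> \<notin> K" using IJK(2) by blast
      then have "e \<alpha> \<bullet> f y = 0" using fe[OF JI[OF \<alpha>]] by (simp only: if_False)
      then show "real_vec (l \<alpha>) \<bullet> f y = (\<lambda>\<alpha>\<in>J. 0) \<alpha>" using \<alpha> by (simp add: e(1))
    qed simp
    then have "AE T in distr ?PK borel f. lattice_map J l T = (\<lambda>\<alpha>\<in>J. 0)"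
    proof (subst AE_distr_iff)
      have "{T. lattice_map J l T = (\<lambda>\<alpha>\<in>J. 0)} = {T. \<forall>\<alpha>\<in>J. real_vec (l \<alpha>) \<bullet> T = 0}"
        by (auto simp: lattice_map_real_vec[symmetric] intro!: lattice_map_eqI)
      moreover have "{T. \<forall>\<alpha>\<in>J. real_vec (l \<alpha>) \<bullet> T = 0} \<in> sets borel"
        using IJK(3) by measurable
      ultimately show "{T \<in> space borel. lattice_map J l T = (\<lambda>\<alpha>\<in>J. 0)} \<in> sets borel" by simp
    qed auto
    then show ?thesis using c(1) by (auto simp: \<nu>_def eventually_ae_filter null_sets_def space_scale_measure)
  qed
  have lb: "lborel = distr (?PJ \<Otimes>\<^sub>M \<nu>) borel (\<lambda>(s, T). \<sigma> s + T)"
  proof (rule measure_eqI)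
    fix A :: "(real ^ 'n) set" assume "A \<in> sets lborel"
    then have A [measurable]: "A \<in> sets borel" by simp
    have split: "(\<Sum>k\<in>I. merge J K (s, y) k *\<^sub>R w k) = \<sigma> s + f y" for s y
      unfolding IJK(1) \<sigma>_def f_def using IJK fin by (subst sum.union_disjoint) (auto simp: merge_def intro!: arg_cong2[of _ _ _ _ "(+)"] sum.cong)
    have "emeasure lborel A = ennreal c * emeasure (distr (PiM I (\<lambda>_. lborel)) borel (\<lambda>x. \<Sum>k\<in>I. x k *\<^sub>R w k)) A"
      by (subst c(2)) simp
    also have "emeasure (distr (PiM I (\<lambda>_. lborel)) borel (\<lambda>x. \<Sum>k\<in>I. x k *\<^sub>R w k)) A
        = (\<integral>\<^sup>+x. indicator A (\<Sum>k\<in>I. x k *\<^sub>R w k) \<partial>PiM (J \<union> K) (\<lambda>_. lborel))"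
      by (subst nn_integral_indicator[symmetric], simp, subst nn_integral_distr) (simp_all add: IJK(1)[symmetric])
    also have "\<dots> = (\<integral>\<^sup>+s. \<integral>\<^sup>+y. indicator A (\<sigma> s + f y) \<partial>?PK \<partial>?PJ)"
      using IJK fin by (subst L.product_nn_integral_fold) (simp_all add: split[unfolded IJK(1)])
    also have "ennreal c * \<dots> = (\<integral>\<^sup>+s. ennreal c * (\<integral>\<^sup>+y. indicator A (\<sigma> s + f y) \<partial>?PK) \<partial>?PJ)"
      by (rule nn_integral_cmult[symmetric]) measurable
    also have "\<dots> = (\<integral>\<^sup>+s. \<integral>\<^sup>+T. indicator A (\<sigma> s + T) \<partial>\<nu> \<partial>?PJ)"
      by (simp add: \<nu>_def nn_integral_scale_measure nn_integral_distr)
    also have "\<dots> = (\<integral>\<^sup>+p. indicator A (case p of (s, T) \<Rightarrow> \<sigma> s + T) \<partial>(?PJ \<Otimes>\<^sub>M \<nu>))"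
      by (subst \<nu>.nn_integral_fst[symmetric]) simp_all
    also have "\<dots> = emeasure (distr (?PJ \<Otimes>\<^sub>M \<nu>) borel (\<lambda>(s, T). \<sigma> s + T)) A"
      by (subst nn_integral_indicator[symmetric], simp, subst nn_integral_distr) simp_all
    finally show "emeasure lborel A = emeasure (distr (?PJ \<Otimes>\<^sub>M \<nu>) borel (\<lambda>(s, T). \<sigma> s + T)) A" .
  qed simp
  have "lattice_map J l (\<sigma> s) = s" if "s \<in> PiE J (\<lambda>_. UNIV)" for s
    using that \<sigma>e e(1) by (intro lattice_map_eqI) (auto simp: PiE_iff)
  then have "lattice_fibre J l w \<nu>"
    using sf sets\<nu> ker lb IJK(3) by unfold_locales (simp_all add: \<sigma>_def)
  then show ?thesis by (rule that)
qed

section \<open>Continuous densities as fibre integrals\<close>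

lemma mem_closed_if_AE_lborel:
  assumes "closed C" "AE x in lborel. x \<in> C" shows "x \<in> C"
  using mem_closed_if_AE_lebesgue[OF assms(1), of x] AE_completion[OF assms(2)] by blast

lemma lattice_map_measurable [measurable]:
  "lattice_map J l \<in> borel \<rightarrow>\<^sub>M PiM J (\<lambda>_. lborel :: real measure)"
  unfolding lattice_map_def by (intro measurable_restrict) simp

lemma lattice_map_continuous: "continuous_on UNIV (lattice_map J l)"
proof (rule continuous_on_coordinatewise_then_product)
  show "continuous_on UNIV (\<lambda>T. lattice_map J l T \<alpha>)" for \<alpha>
    by (cases "\<alpha> \<in> J") (auto simp: lattice_map_def intro!: continuous_intros)
qed

lemma lattice_map_add:
  "lattice_map J l (x + y) = (\<lambda>\<alpha>\<in>J. lattice_map J l x \<alpha> + lattice_map J l y \<alpha>)"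
  by (auto simp: lattice_map_def sum.distrib distrib_left)

lemma lattice_map_kernel_add:
  assumes "lattice_map J l z = (\<lambda>\<alpha>\<in>J. 0)"
  shows "lattice_map J l (x + z) = lattice_map J l x"
  unfolding lattice_map_add assms by (auto simp: lattice_map_def)

lemma lattice_map_PiE: "lattice_map J l T \<in> PiE J (\<lambda>_. UNIV)"
  by (simp add: lattice_map_def)

definition fibre_integral :: "(real ^ 'n::finite) measure \<Rightarrow> (real ^ 'n \<Rightarrow> complex) \<Rightarrow> real ^ 'n \<Rightarrow> complex" where
  "fibre_integral \<nu> G x = (\<integral>T. G (x + T) \<partial>\<nu>)"

context lattice_fibre
begin

definition sec :: "(nat \<Rightarrow> real) \<Rightarrow> real ^ 'n" where
  "sec s = (\<Sum>\<alpha>\<in>J. s \<alpha> *\<^sub>R w \<alpha>)"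

abbreviation PJ :: "(nat \<Rightarrow> real) measure" where
  "PJ \<equiv> PiM J (\<lambda>_. lborel)"

lemma lattice_map_sec: "s \<in> PiE J (\<lambda>_. UNIV) \<Longrightarrow> lattice_map J l (sec s) = s"
  using section_w by (simp add: sec_def)

lemma sec_measurable [measurable]: "sec \<in> PJ \<rightarrow>\<^sub>M borel"
  unfolding sec_def by measurable

lemma sec_continuous: "continuous_on S sec"
  unfolding sec_def
  by (intro continuous_on_sum continuous_on_scaleR continuous_on_const)
     (rule continuous_on_subset[OF continuous_on_product_coordinates], simp)

lemma lborel_sec: "lborel = distr (PJ \<Otimes>\<^sub>M \<nu>) borel (\<lambda>(s, T). sec s + T)"
  using lborel_fibred by (simp add: sec_def)

lemma sigma_finite_PJ: "sigma_finite_measure PJ"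
proof -
  interpret product_sigma_finite "\<lambda>_::nat. lborel :: real measure" ..
  show ?thesis by (rule sigma_finite[OF finite_J])
qed

lemma pair_sf: "pair_sigma_finite PJ \<nu>"
  using sigma_finite_PJ sigma_finite_nu by (simp add: pair_sigma_finite_def)

lemmas [measurable_cong] = sets_nu

lemma measurable_fibration [measurable]: "(\<lambda>(s, T). sec s + T) \<in> PJ \<Otimes>\<^sub>M \<nu> \<rightarrow>\<^sub>M borel"
  by measurable

lemma lattice_map_fibre: "AE T in \<nu>. \<forall>s\<in>PiE J (\<lambda>_. UNIV). lattice_map J l (sec s + T) = s"
  using kernel_nu by eventually_elim (simp add: lattice_map_kernel_add lattice_map_sec)

text \<open>Pulling back along the lattice map preserves null sets.  This transfers questions about the
product space \<open>\<real>\<^sup>J\<close> to \<open>\<real>\<^sup>N\<close>, where a closed set of full measure is known to be everything.\<close>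

lemma AE_lborel_lattice_map:
  assumes "AE s in PJ. P s" and [measurable]: "{T. P (lattice_map J l T)} \<in> sets borel"
  shows "AE T in lborel. P (lattice_map J l T)"
proof -
  interpret pair_sigma_finite PJ \<nu> by (rule pair_sf)
  have P: "Measurable.pred borel (\<lambda>T. P (lattice_map J l T))"
    using assms(2) by (simp add: pred_def)
  have "AE p in PJ \<Otimes>\<^sub>M \<nu>. P (lattice_map J l ((\<lambda>(s, T). sec s + T) p))"
  proof (rule AE_pair_measure)
    have "Measurable.pred (PJ \<Otimes>\<^sub>M \<nu>) (\<lambda>p. P (lattice_map J l ((\<lambda>(s, T). sec s + T) p)))"
      by (rule measurable_compose[OF measurable_fibration P])
    then show "{p \<in> space (PJ \<Otimes>\<^sub>M \<nu>). P (lattice_map J l ((\<lambda>(s, T). sec s + T) p))} \<in> sets (PJ \<Otimes>\<^sub>M \<nu>)"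
      by (simp add: pred_def)
    have "AE s in PJ. s \<in> PiE J (\<lambda>_. UNIV)" by (rule AE_I2) (simp add: space_PiM)
    with assms(1) show "AE s in PJ. AE T in \<nu>. P (lattice_map J l ((\<lambda>(s, T). sec s + T) (s, T)))"
    proof eventually_elim
      case (elim s)
      show ?case using lattice_map_fibre elim by (auto elim!: eventually_mono)
    qed
  qed
  then show ?thesis
    by (subst lborel_sec) (simp add: AE_distr_iff)
qed

text \<open>Two densities of the same push-forward agree almost everywhere; composed with the lattice map they
are continuous functions on \<open>\<real>\<^sup>N\<close> that agree almost everywhere, hence everywhere, and the lattice map
is onto.\<close>

lemma continuous_density_unique:
  assumes p: "is_continuous_density J l G p" and q: "is_continuous_density J l G q"
    and s: "s \<in> PiE J (\<lambda>_. UNIV)"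
  shows "p s = q s"
proof -
  have cont: "continuous_on UNIV (\<lambda>T. r (lattice_map J l T))"
    if "is_continuous_density J l G r" for r
    using that unfolding is_continuous_density_def
    by (intro continuous_on_compose2[OF _ lattice_map_continuous, of "PiE J (\<lambda>_. UNIV)" r]
        image_subsetI lattice_map_PiE) simp
  have closed: "closed {T. p (lattice_map J l T) = q (lattice_map J l T)}"
    by (rule closed_Collect_eq[OF cont[OF p] cont[OF q]])
  have "AE s in PJ. p s = q s"
  proof (rule sigma_finite_measure.density_unique_banach[OF sigma_finite_PJ])
    show "integrable PJ p" "integrable PJ q" using p q by (simp_all add: is_continuous_density_def)
    show "set_lebesgue_integral PJ A p = set_lebesgue_integral PJ A q" if "A \<in> sets PJ" for A
      using p q that unfolding is_continuous_density_def by metis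
  qed
  then have "AE T in lborel. T \<in> {T. p (lattice_map J l T) = q (lattice_map J l T)}"
    using AE_lborel_lattice_map[of "\<lambda>s. p s = q s"] closed by simp
  from mem_closed_if_AE_lborel[OF closed this, of "sec s"] show ?thesis
    by (simp add: lattice_map_sec[OF s])
qed

text \<open>Fubini for the fibration of Lebesgue measure, where the indicator of the preimage of \<open>B\<close> is constant
along almost every fibre.\<close>

lemma fibre_integral_is_density:
  assumes int: "integrable lborel G" and [measurable]: "G \<in> borel_measurable borel"
    and cont: "continuous_on UNIV (fibre_integral \<nu> G)"
  shows "is_continuous_density J l G (\<lambda>s. fibre_integral \<nu> G (sec s))"
  unfolding is_continuous_density_def
proof (intro conjI ballI)
  interpret pair_sigma_finite PJ \<nu> by (rule pair_sf)
  have int': "integrable (PJ \<Otimes>\<^sub>M \<nu>) (\<lambda>p. G ((\<lambda>(s, T). sec s + T) p))"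
    using int by (subst (asm) lborel_sec) (simp add: integrable_distr_eq)
  show "continuous_on (PiE J (\<lambda>_. UNIV)) (\<lambda>s. fibre_integral \<nu> G (sec s))"
    by (rule continuous_on_compose2[OF cont sec_continuous]) simp
  show "integrable PJ (\<lambda>s. fibre_integral \<nu> G (sec s))"
    using integrable_fst'[OF int'] by (simp add: fibre_integral_def)
  fix B assume [measurable]: "B \<in> sets PJ"
  have [measurable]: "{T. lattice_map J l T \<in> B} \<in> sets borel"
    using measurable_sets[OF lattice_map_measurable, of B J l] by (simp add: vimage_def)
  have int'': "integrable (PJ \<Otimes>\<^sub>M \<nu>) (\<lambda>p. indicator {T. lattice_map J l T \<in> B} ((\<lambda>(s, T). sec s + T) p) *\<^sub>R G ((\<lambda>(s, T). sec s + T) p))"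
  proof -
    have "integrable lborel (\<lambda>T. indicator {T. lattice_map J l T \<in> B} T *\<^sub>R G T)"
      by (rule integrable_mult_indicator[OF _ int]) simp
    then show ?thesis by (subst (asm) lborel_sec) (simp add: integrable_distr_eq)
  qed
  have "set_lebesgue_integral lborel {T. lattice_map J l T \<in> B} G
      = (\<integral>p. indicator {T. lattice_map J l T \<in> B} ((\<lambda>(s, T). sec s + T) p) *\<^sub>R G ((\<lambda>(s, T). sec s + T) p) \<partial>(PJ \<Otimes>\<^sub>M \<nu>))"
    unfolding set_lebesgue_integral_def by (subst lborel_sec, subst integral_distr) simp_all
  also have "\<dots> = (\<integral>s. \<integral>T. indicator {T. lattice_map J l T \<in> B} (sec s + T) *\<^sub>R G (sec s + T) \<partial>\<nu> \<partial>PJ)"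
    using integral_fst'[OF int''] by simp
  also have "\<dots> = (\<integral>s. indicator B s *\<^sub>R fibre_integral \<nu> G (sec s) \<partial>PJ)"
  proof (rule Bochner_Integration.integral_cong[OF refl])
    fix s assume "s \<in> space PJ"
    then have s: "s \<in> PiE J (\<lambda>_. UNIV)" by (simp add: space_PiM)
    have "(\<integral>T. indicator {T. lattice_map J l T \<in> B} (sec s + T) *\<^sub>R G (sec s + T) \<partial>\<nu>)
        = (\<integral>T. indicator B s *\<^sub>R G (sec s + T) \<partial>\<nu>)"
    proof (rule integral_cong_AE)
      show "AE T in \<nu>. indicator {T. lattice_map J l T \<in> B} (sec s + T) *\<^sub>R G (sec s + T)
          = indicator B s *\<^sub>R G (sec s + T)"
        using lattice_map_fibre by eventually_elim (use s in \<open>auto simp: indicator_def\<close>)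
    qed measurable
    then show "(\<integral>T. indicator {T. lattice_map J l T \<in> B} (sec s + T) *\<^sub>R G (sec s + T) \<partial>\<nu>)
        = indicator B s *\<^sub>R fibre_integral \<nu> G (sec s)"
      by (simp add: fibre_integral_def)
  qed
  finally show "set_lebesgue_integral lborel {T. lattice_map J l T \<in> B} G =
      set_lebesgue_integral PJ B (\<lambda>s. fibre_integral \<nu> G (sec s))"
    by (simp add: set_lebesgue_integral_def)
qed

lemma integrable_translate:
  assumes "integrable lborel G"
  shows "integrable lborel (\<lambda>T::real ^ 'n. G (T + z) :: complex)"
proof -
  have [measurable]: "G \<in> borel_measurable borel" using assms by (simp add: borel_measurable_integrable)
  have "integrable (distr lborel borel ((+) z)) G" using assms by (simp add: lborel_distr_plus)
  then show ?thesis by (simp add: integrable_distr_eq add.commute)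
qed

lemma fibre_integral_translate: "fibre_integral \<nu> (\<lambda>T. G (T + z)) x = fibre_integral \<nu> G (x + z)"
  by (simp add: fibre_integral_def add_ac)

lemma translate_is_density:
  assumes int: "integrable lborel G" and [measurable]: "G \<in> borel_measurable borel"
    and cont: "continuous_on UNIV (fibre_integral \<nu> G)"
  shows "is_continuous_density J l (\<lambda>T. G (T + z)) (\<lambda>s. fibre_integral \<nu> G (sec s + z))"
proof -
  have "continuous_on UNIV (\<lambda>x. fibre_integral \<nu> G (x + z))"
    by (intro continuous_on_compose2[OF cont] continuous_intros) simp
  then show ?thesis
    using fibre_integral_is_density[OF integrable_translate[OF int, of z]]
    by (simp add: fibre_integral_translate)
qed

text \<open>Translation invariance of \<open>\<nu>\<close> along the kernel, deduced from that of Lebesgue measure: for \<open>z\<close> in the kernel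
\<open>G\<close> and \<open>G(\<cdot> + z)\<close> have the same push-forward, so their continuous densities coincide.\<close>

lemma fibre_integral_invariant:
  assumes int: "integrable lborel G" and G [measurable]: "G \<in> borel_measurable borel"
    and cont: "continuous_on UNIV (fibre_integral \<nu> G)"
  shows "fibre_integral \<nu> G x = fibre_integral \<nu> G (sec (lattice_map J l x))"
proof -
  define z where "z = x - sec (lattice_map J l x)"
  have x: "x = sec (lattice_map J l x) + z" by (simp add: z_def)
  have z: "lattice_map J l z = (\<lambda>\<alpha>\<in>J. 0)"
  proof (rule ext)
    fix \<alpha>
    have "lattice_map J l x = (\<lambda>\<alpha>\<in>J. lattice_map J l x \<alpha> + lattice_map J l z \<alpha>)"
      using lattice_map_add[of J l "sec (lattice_map J l x)" z]
      unfolding x[symmetric] lattice_map_sec[OF lattice_map_PiE] .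
    from fun_cong[OF this, of \<alpha>]
    have "\<alpha> \<in> J \<Longrightarrow> lattice_map J l x \<alpha> = lattice_map J l x \<alpha> + lattice_map J l z \<alpha>"
      by simp
    then show "lattice_map J l z \<alpha> = (\<lambda>\<alpha>\<in>J. 0) \<alpha>" by (cases "\<alpha> \<in> J") (auto simp: lattice_map_def)
  qed
  have "set_lebesgue_integral lborel {T. lattice_map J l T \<in> B} (\<lambda>T. G (T + z)) =
      set_lebesgue_integral lborel {T. lattice_map J l T \<in> B} G" if [measurable]: "B \<in> sets PJ" for B
  proof -
    have [measurable]: "{T. lattice_map J l T \<in> B} \<in> sets borel"
      using measurable_sets[OF lattice_map_measurable, of B J l] by (simp add: vimage_def)
    have "set_lebesgue_integral lborel {T. lattice_map J l T \<in> B} G =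
        (\<integral>T. indicator {T. lattice_map J l T \<in> B} T *\<^sub>R G T \<partial>distr lborel borel ((+) z))"
      by (simp add: lborel_distr_plus set_lebesgue_integral_def)
    also have "\<dots> = (\<integral>T. indicator {T. lattice_map J l T \<in> B} (T + z) *\<^sub>R G (T + z) \<partial>lborel)"
      by (subst integral_distr) (simp_all add: add.commute)
    also have "\<dots> = set_lebesgue_integral lborel {T. lattice_map J l T \<in> B} (\<lambda>T. G (T + z))"
      by (simp add: set_lebesgue_integral_def indicator_def lattice_map_kernel_add[OF z])
    finally show ?thesis by simp
  qed
  then have "is_continuous_density J l G (\<lambda>s. fibre_integral \<nu> G (sec s + z))"
    using translate_is_density[OF int G cont, of z] unfolding is_continuous_density_def by simp
  from continuous_density_unique[OF this fibre_integral_is_density[OF int G cont] lattice_map_PiE[where l = l and T = x]]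
  show ?thesis using x by simp
qed

lemma delta_integral_eq:
  assumes int: "integrable lborel (\<lambda>T. F (vec_exp T))"
    and p: "is_continuous_density J l (\<lambda>T. F (vec_exp T)) p" and s: "s \<in> PiE J (\<lambda>_. UNIV)"
  shows "has_delta_integral J l F s (p s)" and "delta_integral J l F s = p s"
proof -
  show h: "has_delta_integral J l F s (p s)"
    using int p unfolding has_delta_integral_def by blast
  show "delta_integral J l F s = p s"
    unfolding delta_integral_def
    using h continuous_density_unique[OF _ p s] by (intro the_equality) (auto simp: has_delta_integral_def)
qed

text \<open>By Fubini \<open>exp (- e \<Sum>\<^sub>i \<bar>T\<^sub>i\<bar>)\<close> is integrable along some fibre \<open>sec s + T\<close>, and translating that fibre to the
kernel costs only the constant \<open>exp (e \<Sum>\<^sub>i \<bar>(sec s)\<^sub>i\<bar>)\<close>.\<close>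

lemma tempered_nu: "tempered \<nu>"
  unfolding tempered_def
proof (intro conjI allI impI sets_nu)
  fix e :: real assume e: "0 < e"
  interpret pair_sigma_finite PJ \<nu> by (rule pair_sf)
  let ?E = "\<lambda>T::real ^ 'n. exp (- e * (\<Sum>i\<in>UNIV. \<bar>T $ i\<bar>))"
  have [measurable]: "?E \<in> borel_measurable borel"
    by (intro borel_measurable_continuous_onI continuous_intros)
  have "integrable lborel ?E" using tempered_lborel[where ?'n = 'n] e by (simp add: tempered_def)
  then have "integrable (PJ \<Otimes>\<^sub>M \<nu>) (\<lambda>p. ?E ((\<lambda>(s, T). sec s + T) p))"
    by (subst (asm) lborel_sec) (subst (asm) integrable_distr_eq, simp_all)
  from AE_integrable_fst'[OF this] have ae: "AE s in PJ. integrable \<nu> (\<lambda>T. ?E (sec s + T))" by simp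
  have "\<exists>s. integrable \<nu> (\<lambda>T. ?E (sec s + T))"
  proof (rule ccontr)
    assume "\<not> ?thesis"
    then have "AE s in PJ. False" using ae by simp
    then have "AE T in lborel :: (real ^ 'n) measure. False"
      using AE_lborel_lattice_map[of "\<lambda>_. False"] by simp
    then show False using mem_closed_if_AE_lborel[of "{} :: (real ^ 'n) set"] by auto
  qed
  then obtain s where s: "integrable \<nu> (\<lambda>T. ?E (sec s + T))" by blast
  have "integrable \<nu> (\<lambda>T. exp (e * (\<Sum>i\<in>UNIV. \<bar>sec s $ i\<bar>)) * ?E (sec s + T))"
    by (rule integrable_mult_right) (rule s)
  then show "integrable \<nu> ?E"
  proof (rule Bochner_Integration.integrable_bound)
    show "AE T in \<nu>. norm (?E T) \<le> norm (exp (e * (\<Sum>i\<in>UNIV. \<bar>sec s $ i\<bar>)) * ?E (sec s + T))"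
    proof (rule AE_I2)
      fix T
      have "(\<Sum>i\<in>UNIV. \<bar>(sec s + T) $ i\<bar>) \<le> (\<Sum>i\<in>UNIV. \<bar>sec s $ i\<bar> + \<bar>T $ i\<bar>)"
        by (intro sum_mono) (simp add: abs_triangle_ineq)
      then have "e * (\<Sum>i\<in>UNIV. \<bar>(sec s + T) $ i\<bar>) \<le> e * (\<Sum>i\<in>UNIV. \<bar>sec s $ i\<bar>) + e * (\<Sum>i\<in>UNIV. \<bar>T $ i\<bar>)"
        using e by (simp add: sum.distrib distrib_left[symmetric])
      then show "norm (?E T) \<le> norm (exp (e * (\<Sum>i\<in>UNIV. \<bar>sec s $ i\<bar>)) * ?E (sec s + T))"
        by (simp add: exp_add[symmetric])
    qed
  qed measurable
qed

lemma relation_vanishes_on_fibre: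
  assumes "v \<in> zvec.span (l ` J)"
  shows "AE T in \<nu>. (\<Sum>i\<in>UNIV. of_int (v $ i) * T $ i) = (0::real)"
  using kernel_nu
proof eventually_elim
  case (elim T)
  have "orthogonal T (real_vec v)"
  proof (rule orthogonal_to_span[OF real_vec_span[OF assms]])
    fix y assume "y \<in> real_vec ` l ` J"
    then obtain \<alpha> where "\<alpha> \<in> J" "y = real_vec (l \<alpha>)" by blast
    then show "orthogonal T y"
      using lattice_map_real_vec[of \<alpha> J l T] elim by (simp add: orthogonal_def inner_commute)
  qed
  then show ?case by (simp add: orthogonal_def inner_vec_def real_vec_def mult.commute)
qed

end

section \<open>The fibre integral of the GKZ integrand\<close>

text \<open>The monomial \<open>t\<^sup>\<gamma>\<close> in the logarithmic coordinate \<open>x = ln t\<close>.\<close>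

definition exp_pairing :: "complex ^ 'n::finite \<Rightarrow> real ^ 'n \<Rightarrow> complex" where
  "exp_pairing \<gamma> x = exp (\<Sum>i\<in>UNIV. \<gamma> $ i * of_real (x $ i))"

definition ones :: "real ^ 'n" where "ones = (\<chi> i. 1)"

lemma vec_exp_pos_orthant [simp]: "vec_exp x \<in> pos_orthant"
  by (simp add: vec_exp_def pos_orthant_def)

lemma vec_exp_ln: "u \<in> pos_orthant \<Longrightarrow> vec_exp (vec_ln u) = u"
  by (simp add: vec_exp_def vec_ln_def pos_orthant_def vec_eq_iff)

lemma vec_ln_exp: "vec_ln (vec_exp x) = x"
  by (simp add: vec_exp_def vec_ln_def vec_eq_iff)

lemma monomial_vec_exp: "monomial \<gamma> (vec_exp T) = exp_pairing \<gamma> T"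
proof -
  have "complex_of_real (exp x) powr z = exp (z * of_real x)" for x z
    by (simp add: powr_def Ln_of_real exp_of_real[symmetric] del: exp_of_real)
  then show ?thesis by (simp add: monomial_def exp_pairing_def vec_exp_def exp_sum)
qed

lemma Phi_integrand_monomial:
  "Phi_integrand \<gamma> t = monomial \<gamma> t * exp (- (\<Sum>i\<in>UNIV. of_real (t $ i)))"
  by (simp add: Phi_integrand_def monomial_def prod.distrib exp_sum sum_negf[symmetric])

lemma exp_phase: "exp (phase \<gamma> u T) = exp_pairing \<gamma> T * exp (- (\<Sum>i\<in>UNIV. of_real (u $ i * exp (T $ i))))"
  by (simp add: phase_def exp_pairing_def sum_subtractf exp_diff exp_minus divide_inverse)

lemma exp_pairing_add: "exp_pairing \<gamma> (x + y) = exp_pairing \<gamma> x * exp_pairing \<gamma> y"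
  by (simp add: exp_pairing_def distrib_left sum.distrib exp_add)

text \<open>Translation by \<open>x\<close> in logarithmic coordinates rescales \<open>t\<^sub>i\<close> by \<open>u\<^sub>i = e\<^bsup>x\<^sub>i\<^esup>\<close>, and this moves the argument
\<open>u\<close> of \<open>\<Phi>\<close> from the delta-factors into the exponential.\<close>

lemma exp_phase_translate:
  "exp (phase \<gamma> ones (x + T)) = exp_pairing \<gamma> x * exp (phase \<gamma> (vec_exp x) T)"
  by (simp add: exp_phase exp_pairing_add ones_def vec_exp_def exp_add mult.assoc)

lemma Phi_integrand_vec_exp: "Phi_integrand \<gamma> (vec_exp T) = exp (phase \<gamma> ones T)"
  unfolding Phi_integrand_monomial monomial_vec_exp exp_phase by (simp add: ones_def vec_exp_def)

lemma fibre_integral_phase: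
  "fibre_integral \<nu> (\<lambda>T. exp (phase \<gamma> ones T)) x = exp_pairing \<gamma> x * exp_integral \<nu> \<gamma> (vec_exp x)"
  unfolding fibre_integral_def exp_phase_translate exp_integral_def by simp

lemma ones_pos_orthant: "ones \<in> pos_orthant"
  by (simp add: ones_def pos_orthant_def)

lemma integrable_lborel_phase:
  assumes "\<gamma> \<in> gamma_domain"
  shows "integrable lborel (\<lambda>T. exp (phase \<gamma> ones T))"
  by (rule integrable_phase(1)[OF tempered_lborel assms ones_pos_orthant])

lemma exp_integral_continuous:
  assumes "tempered \<nu>" "\<gamma> \<in> gamma_domain"
  shows "continuous_on pos_orthant (exp_integral \<nu> \<gamma>)"
  using exp_integral_has_derivative_u[OF assms]
  by (meson continuous_at_imp_continuous_on has_derivative_continuous)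

lemma vec_exp_continuous: "continuous_on S vec_exp"
  unfolding vec_exp_def by (intro continuous_on_vec_lambda continuous_intros)

lemma fibre_integral_phase_continuous:
  assumes "tempered \<nu>" "\<gamma> \<in> gamma_domain"
  shows "continuous_on UNIV (fibre_integral \<nu> (\<lambda>T. exp (phase \<gamma> ones T)))"
proof -
  have "continuous_on UNIV (\<lambda>x. exp_integral \<nu> \<gamma> (vec_exp x))"
    by (rule continuous_on_compose2[OF exp_integral_continuous[OF assms] vec_exp_continuous]) auto
  then show ?thesis
    unfolding fibre_integral_phase[abs_def] exp_pairing_def by (intro continuous_intros)
qed

context lattice_fibre
begin

lemma Phi_integral_converges:
  assumes "\<gamma> \<in> gamma_domain"
  shows "has_delta_integral J l (Phi_integrand \<gamma>) (lattice_map J l x) (exp_pairing \<gamma> x * exp_integral \<nu> \<gamma> (vec_exp x))"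
    and "delta_integral J l (Phi_integrand \<gamma>) (lattice_map J l x) = exp_pairing \<gamma> x * exp_integral \<nu> \<gamma> (vec_exp x)"
proof -
  let ?G = "\<lambda>T. exp (phase \<gamma> ones T)"
  note G = integrable_lborel_phase[OF assms] and c = fibre_integral_phase_continuous[OF tempered_nu assms]
  have m: "?G \<in> borel_measurable borel" by measurable
  have eq: "fibre_integral \<nu> ?G (sec (lattice_map J l x)) = exp_pairing \<gamma> x * exp_integral \<nu> \<gamma> (vec_exp x)"
    using fibre_integral_invariant[OF G m c, of x] by (simp add: fibre_integral_phase)
  show "has_delta_integral J l (Phi_integrand \<gamma>) (lattice_map J l x) (exp_pairing \<gamma> x * exp_integral \<nu> \<gamma> (vec_exp x))"
    "delta_integral J l (Phi_integrand \<gamma>) (lattice_map J l x) = exp_pairing \<gamma> x * exp_integral \<nu> \<gamma> (vec_exp x)"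
    using delta_integral_eq[of "Phi_integrand \<gamma>", OF _ _ lattice_map_PiE[where l = l and T = x]]
      fibre_integral_is_density[OF G m c] G
    by (simp_all add: Phi_integrand_vec_exp flip: eq)
qed

lemma Phi_eq:
  assumes "\<gamma> \<in> gamma_domain" "u \<in> pos_orthant"
  shows "Phi J l \<gamma> u = exp_pairing \<gamma> (vec_ln u) * exp_integral \<nu> \<gamma> u"
  using Phi_integral_converges(2)[OF assms(1), of "vec_ln u"] by (simp add: Phi_def vec_exp_ln assms(2))

lemma Phi_translate_kernel:
  assumes "\<gamma> \<in> gamma_domain" "lattice_map J l z = (\<lambda>\<alpha>\<in>J. 0)"
  shows "Phi J l \<gamma> (vec_exp (x + z)) = Phi J l \<gamma> (vec_exp x)"
  by (simp add: Phi_def vec_ln_exp lattice_map_kernel_add[OF assms(2)])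

text \<open>Translating the integrand by \<open>y\<close> has the same effect on the density at the origin as evaluating the
density of the original integrand at \<open>\<lambda> y\<close>.\<close>

lemma translated_delta_integral:
  assumes "\<gamma> \<in> gamma_domain" and f: "\<And>T. F (vec_exp T) = exp (phase \<gamma> ones (T + y))"
  shows "has_delta_integral J l F (\<lambda>\<alpha>\<in>J. 0) (Phi J l \<gamma> (vec_exp y))"
    and "delta_integral J l F (\<lambda>\<alpha>\<in>J. 0) = Phi J l \<gamma> (vec_exp y)"
proof -
  let ?G = "\<lambda>T. exp (phase \<gamma> ones T)"
  note G = integrable_lborel_phase[OF assms(1)] and c = fibre_integral_phase_continuous[OF tempered_nu assms(1)]
  have m: "?G \<in> borel_measurable borel" by measurable
  have s: "(\<lambda>\<alpha>\<in>J. 0) \<in> PiE J (\<lambda>_. UNIV :: real set)" by auto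
  have "sec (\<lambda>\<alpha>\<in>J. 0) = 0" by (simp add: sec_def)
  then have eq: "fibre_integral \<nu> ?G (sec (\<lambda>\<alpha>\<in>J. 0) + y) = Phi J l \<gamma> (vec_exp y)"
    by (simp add: fibre_integral_phase Phi_eq assms(1) vec_ln_exp)
  show "has_delta_integral J l F (\<lambda>\<alpha>\<in>J. 0) (Phi J l \<gamma> (vec_exp y))"
    "delta_integral J l F (\<lambda>\<alpha>\<in>J. 0) = Phi J l \<gamma> (vec_exp y)"
    using delta_integral_eq[of F, OF _ _ s, of "\<lambda>s. fibre_integral \<nu> ?G (sec s + y)"]
      translate_is_density[OF G m c, of y] integrable_translate[OF G, of y]
    by (simp_all only: f eq)
qed

end

section \<open>The GG-system\<close>

definition power_function :: "complex ^ 'n::finite \<Rightarrow> real ^ 'n \<Rightarrow> complex" where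
  "power_function \<gamma> u = exp_pairing \<gamma> (vec_ln u)"

lemma power_function_has_derivative:
  assumes "u \<in> pos_orthant"
  shows "(power_function \<gamma> has_derivative
    (\<lambda>v. power_function \<gamma> u * (\<Sum>i\<in>UNIV. \<gamma> $ i * of_real (v $ i / u $ i)))) (at u)"
proof -
  have ln: "((\<lambda>u. \<gamma> $ i * complex_of_real (ln (u $ i))) has_derivative (\<lambda>v. \<gamma> $ i * of_real (v $ i / u $ i))) (at u)" for i
  proof -
    have "((\<lambda>u. ln (u $ i)) has_derivative (\<lambda>v. v $ i / u $ i)) (at u)"
      using assms by (auto intro!: derivative_eq_intros bounded_linear_imp_has_derivative bounded_linear_vec_nth
          simp: pos_orthant_def divide_inverse)
    then show ?thesis by (intro has_derivative_mult_right has_derivative_of_real)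
  qed
  have "((\<lambda>u. \<Sum>i\<in>UNIV. \<gamma> $ i * complex_of_real (ln (u $ i))) has_derivative
      (\<lambda>v. \<Sum>i\<in>UNIV. \<gamma> $ i * of_real (v $ i / u $ i))) (at u)"
    by (intro has_derivative_sum ln)
  from has_derivative_compose[OF this, of exp "(*) (exp (\<Sum>i\<in>UNIV. \<gamma> $ i * complex_of_real (ln (u $ i))))"]
  show ?thesis
    using DERIV_exp[of "\<Sum>i\<in>UNIV. \<gamma> $ i * complex_of_real (ln (u $ i))"]
    by (simp add: power_function_def[abs_def] exp_pairing_def vec_ln_def has_field_derivative_def)
qed

lemma pd_power_function:
  assumes "u \<in> pos_orthant"
  shows "pd i (power_function \<gamma>) u = \<gamma> $ i / of_real (u $ i) * power_function \<gamma> u"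
proof -
  have "(\<Sum>j\<in>UNIV. \<gamma> $ j * of_real (axis i 1 $ j / u $ j)) = (\<Sum>j\<in>UNIV. if i = j then \<gamma> $ j / of_real (u $ j) else 0)"
    by (intro sum.cong) (auto simp: axis_def)
  then show ?thesis
    unfolding has_vector_derivative_pd[OF power_function_has_derivative[OF assms]] by simp
qed

lemma power_function_axis:
  assumes "u \<in> pos_orthant"
  shows "power_function (\<gamma> + axis i 1) u = of_real (u $ i) * power_function \<gamma> u"
proof -
  have "(\<Sum>j\<in>UNIV. (\<gamma> + axis i 1) $ j * complex_of_real (ln (u $ j)))
      = (\<Sum>j\<in>UNIV. \<gamma> $ j * complex_of_real (ln (u $ j)) + (if i = j then complex_of_real (ln (u $ j)) else 0))"
    by (intro sum.cong) (auto simp: axis_def algebra_simps)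
  then have "power_function (\<gamma> + axis i 1) u = power_function \<gamma> u * exp (complex_of_real (ln (u $ i)))"
    by (simp add: power_function_def exp_pairing_def vec_ln_def sum.distrib exp_add)
  also have "exp (complex_of_real (ln (u $ i))) = of_real (u $ i)"
    using assms by (simp add: exp_of_real pos_orthant_def)
  finally show ?thesis by (simp add: mult.commute)
qed

lemma differentiable_scale:
  fixes f :: "real ^ 'n::finite \<Rightarrow> complex"
  shows "f differentiable (at t) \<Longrightarrow> (\<lambda>t. c * f t) differentiable (at t)"
  by (intro differentiable_mult differentiable_const)

lemma pd_scale:
  assumes "f differentiable (at t)"
  shows "pd i (\<lambda>t. c * f t) t = c * pd i f t"
proof -
  have "pd i (\<lambda>t. 0::complex) t = 0" by (simp add: pd_def)
  then show ?thesis using pd_lincomb[OF assms differentiable_const, of i c 0] by simp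
qed

lemma smooth_power_function: "smooth (power_function \<gamma>)"
proof (rule smooth_coinduct[of "{\<lambda>u. c * power_function \<gamma> u | c \<gamma>. True}"])
  have d: "power_function \<gamma> differentiable (at u)" if "u \<in> pos_orthant" for u and \<gamma> :: "complex ^ 'a"
    using power_function_has_derivative[OF that] by (auto simp: differentiable_def)
  show "pd_stable {\<lambda>u::real ^ 'a. c * power_function \<gamma> u | c \<gamma>. True}"
    unfolding pd_stable_def
  proof (safe)
    fix c :: complex and \<gamma> :: "complex ^ 'a" and i
    show "(\<lambda>u. c * power_function \<gamma> u) differentiable_on pos_orthant"
      by (simp add: differentiable_on_orthant_iff differentiable_scale d)
    have "pd i (\<lambda>u. c * power_function \<gamma> u) u = (c * \<gamma> $ i) * power_function (\<gamma> - axis i 1) u"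
      if u: "u \<in> pos_orthant" for u
    proof -
      have "power_function \<gamma> u = of_real (u $ i) * power_function (\<gamma> - axis i 1) u"
        using power_function_axis[OF u, of "\<gamma> - axis i 1" i] by simp
      moreover have "u $ i \<noteq> 0" using u by (auto simp: pos_orthant_def dest: spec[of _ i])
      ultimately show ?thesis
        by (simp add: pd_scale[OF d[OF u]] pd_power_function[OF u])
    qed
    then show "\<exists>g\<in>{\<lambda>u. c * power_function \<gamma> u | c \<gamma>. True}. \<forall>u\<in>pos_orthant. pd i (\<lambda>u. c * power_function \<gamma> u) u = g u"
      by (intro bexI[of _ "\<lambda>u. (c * \<gamma> $ i) * power_function (\<gamma> - axis i 1) u"]) auto
  qed
  show "power_function \<gamma> \<in> {\<lambda>u. c * power_function \<gamma> u | c \<gamma>. True}"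
    by (intro CollectI exI[of _ 1] exI[of _ \<gamma>]) simp
qed

lemma gamma_domain_axis: "\<gamma> \<in> gamma_domain \<Longrightarrow> \<gamma> + axis i 1 \<in> gamma_domain"
  by (auto simp: gamma_domain_def axis_def intro: add_pos_nonneg)

lemma exp_integral_differentiable:
  "tempered \<nu> \<Longrightarrow> \<gamma> \<in> gamma_domain \<Longrightarrow> u \<in> pos_orthant \<Longrightarrow> exp_integral \<nu> \<gamma> differentiable (at u)"
  using exp_integral_has_derivative_u by (auto simp: differentiable_def)

lemma smooth_exp_integral:
  assumes \<nu>: "tempered \<nu>" and "\<gamma> \<in> gamma_domain"
  shows "smooth (exp_integral \<nu> \<gamma>)"
proof (rule smooth_coinduct[of "{\<lambda>u. c * exp_integral \<nu> \<gamma> u | c \<gamma>. \<gamma> \<in> gamma_domain}"])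
  note d = exp_integral_differentiable[OF \<nu>]
  show "pd_stable {\<lambda>u. c * exp_integral \<nu> \<gamma> u | c \<gamma>. \<gamma> \<in> gamma_domain}"
    unfolding pd_stable_def
  proof (safe)
    fix c :: complex and \<gamma> :: "complex ^ 'a" and i
    assume \<gamma>: "\<gamma> \<in> gamma_domain"
    show "(\<lambda>u. c * exp_integral \<nu> \<gamma> u) differentiable_on pos_orthant"
      by (simp add: differentiable_on_orthant_iff differentiable_scale d \<gamma>)
    have "pd i (\<lambda>u. c * exp_integral \<nu> \<gamma> u) u = (- c) * exp_integral \<nu> (\<gamma> + axis i 1) u"
      if u: "u \<in> pos_orthant" for u
      by (simp add: pd_scale[OF d[OF \<gamma> u]] pd_exp_integral[OF \<nu> \<gamma> u])
    moreover have "(\<lambda>u. (- c) * exp_integral \<nu> (\<gamma> + axis i 1) u) \<in> {\<lambda>u. c * exp_integral \<nu> \<gamma> u | c \<gamma>. \<gamma> \<in> gamma_domain}"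
      using gamma_domain_axis[OF \<gamma>, of i] by (intro CollectI exI[of _ "- c"] exI[of _ "\<gamma> + axis i 1"] conjI refl)
    ultimately show "\<exists>g\<in>{\<lambda>u. c * exp_integral \<nu> \<gamma> u | c \<gamma>. \<gamma> \<in> gamma_domain}.
        \<forall>u\<in>pos_orthant. pd i (\<lambda>u. c * exp_integral \<nu> \<gamma> u) u = g u"
      by (intro bexI[of _ "\<lambda>u. (- c) * exp_integral \<nu> (\<gamma> + axis i 1) u"]) auto
  qed
  show "exp_integral \<nu> \<gamma> \<in> {\<lambda>u. c * exp_integral \<nu> \<gamma> u | c \<gamma>. \<gamma> \<in> gamma_domain}"
    using assms(2) by (intro CollectI exI[of _ 1] exI[of _ \<gamma>]) simp
qed

lemma pd_power_exp_integral:
  assumes \<nu>: "tempered \<nu>" and \<gamma>: "\<gamma>' \<in> gamma_domain" and u: "u \<in> pos_orthant"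
  shows "pd i (\<lambda>u. power_function \<gamma> u * exp_integral \<nu> \<gamma>' u) u =
    \<gamma> $ i / of_real (u $ i) * (power_function \<gamma> u * exp_integral \<nu> \<gamma>' u) - power_function \<gamma> u * exp_integral \<nu> (\<gamma>' + axis i 1) u"
proof -
  have "power_function \<gamma> differentiable (at u)"
    using smooth_power_function smooth_differentiable u by blast
  from pd_mult[OF this exp_integral_differentiable[OF assms], of i] show ?thesis
    by (simp add: pd_power_function[OF u] pd_exp_integral[OF assms])
qed

definition shift_by :: "'n list \<Rightarrow> complex ^ 'n" where
  "shift_by ks = (\<chi> i. of_nat (count_list ks i))"

lemma shift_by_Cons: "shift_by (k # ks) = shift_by ks + axis k 1"
  by (auto simp: shift_by_def vec_eq_iff axis_def)

lemma gamma_domain_shift_by: "\<gamma> \<in> gamma_domain \<Longrightarrow> \<gamma> + shift_by ks \<in> gamma_domain"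
  by (auto simp: gamma_domain_def shift_by_def intro: add_pos_nonneg)

text \<open>The factor \<open>u\<^sup>\<gamma>\<close> keeps its exponent throughout: it turns each operator \<open>-\<partial>\<^bsub>u\<^sub>k\<^esub> + \<gamma>\<^sub>k/u\<^sub>k\<close> into \<open>-\<partial>\<^bsub>u\<^sub>k\<^esub>\<close> acting
on the exponential integral, where it shifts the parameter.\<close>

lemma gg_op_iterated:
  assumes \<nu>: "tempered \<nu>" and \<gamma>: "\<gamma> \<in> gamma_domain"
    and \<Phi>: "\<And>u. u \<in> pos_orthant \<Longrightarrow> \<Phi> u = power_function \<gamma> u * exp_integral \<nu> \<gamma> u"
    and u: "u \<in> pos_orthant"
  shows "foldr (gg_op \<gamma>) ks \<Phi> u = power_function \<gamma> u * exp_integral \<nu> (\<gamma> + shift_by ks) u"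
  using u
proof (induction ks arbitrary: u)
  case Nil
  have "shift_by [] = (0 :: complex ^ 'a)" by (simp add: shift_by_def vec_eq_iff)
  then show ?case using \<Phi>[OF Nil] by simp
next
  case (Cons k ks)
  have "pd k (foldr (gg_op \<gamma>) ks \<Phi>) u = pd k (\<lambda>u. power_function \<gamma> u * exp_integral \<nu> (\<gamma> + shift_by ks) u) u"
    by (rule pd_cong[OF Cons.prems Cons.IH])
  moreover have "foldr (gg_op \<gamma>) (k # ks) \<Phi> u = - pd k (foldr (gg_op \<gamma>) ks \<Phi>) u
      + \<gamma> $ k / of_real (u $ k) * foldr (gg_op \<gamma>) ks \<Phi> u"
    by (simp add: gg_op_def)
  ultimately show ?case
    by (simp add: Cons.IH[OF Cons.prems] shift_by_Cons add.assoc[symmetric]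
        pd_power_exp_integral[OF \<nu> gamma_domain_shift_by[OF \<gamma>] Cons.prems])
qed

text \<open>Multiplying the integrand by \<open>\<Prod>\<^sub>i t\<^sub>i\<^bsup>v\<^sub>i\<^esup>\<close> for a relation \<open>v\<close> changes nothing on the fibre.\<close>

lemma exp_integral_shift:
  assumes sets: "sets \<nu> = sets borel" and v: "AE T in \<nu>. (\<Sum>i\<in>UNIV. of_int (v $ i) * T $ i) = (0::real)"
    and diff: "\<And>i. \<delta>' $ i - \<delta> $ i = of_int (v $ i)"
  shows "exp_integral \<nu> \<delta> u = exp_integral \<nu> \<delta>' u"
  unfolding exp_integral_def
proof (rule integral_cong_AE)
  show "AE T in \<nu>. exp (phase \<delta> u T) = exp (phase \<delta>' u T)"
    using v
  proof eventually_elim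
    case (elim T)
    have "phase \<delta>' u T - phase \<delta> u T = (\<Sum>i\<in>UNIV. (\<delta>' $ i - \<delta> $ i) * of_real (T $ i))"
      by (simp add: phase_def sum_subtractf[symmetric] algebra_simps)
    also have "\<dots> = of_real (\<Sum>i\<in>UNIV. of_int (v $ i) * T $ i)" by (simp add: diff)
    finally show ?case using elim by simp
  qed
qed (simp_all add: sets cong: measurable_cong_sets)

lemma exp_pairing_axis: "exp_pairing (\<gamma> + axis i z) x = exp_pairing \<gamma> x * exp (z * of_real (x $ i))"
proof -
  have "(\<Sum>j\<in>UNIV. (\<gamma> + axis i z) $ j * complex_of_real (x $ j))
      = (\<Sum>j\<in>UNIV. \<gamma> $ j * complex_of_real (x $ j) + (if i = j then z * complex_of_real (x $ j) else 0))"
    by (intro sum.cong) (auto simp: axis_def algebra_simps)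
  then show ?thesis by (simp add: exp_pairing_def sum.distrib exp_add)
qed

lemma eventually_gamma_domain:
  assumes "\<gamma> \<in> gamma_domain"
  shows "eventually (\<lambda>z. \<gamma> + axis i z \<in> gamma_domain) (nhds 0)"
proof -
  have "eventually (\<lambda>z. 0 < Re (\<gamma> $ i) + Re z) (nhds 0)"
  proof -
    have "((\<lambda>z. Re (\<gamma> $ i) + Re z) \<longlongrightarrow> Re (\<gamma> $ i) + Re 0) (nhds 0)"
      by (intro tendsto_intros filterlim_ident)
    then show ?thesis using assms by (intro order_tendstoD) (auto simp: gamma_domain_def)
  qed
  then show ?thesis
    by eventually_elim (use assms in \<open>auto simp: gamma_domain_def axis_def\<close>)
qed

context lattice_fibre
begin

lemma Phi_has_field_derivative:
  assumes \<gamma>: "\<gamma> \<in> gamma_domain" and u: "u \<in> pos_orthant"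
  shows "((\<lambda>z. Phi J l (\<gamma> + axis i z) u) has_field_derivative
    of_real (ln (u $ i)) * Phi J l \<gamma> u
      + power_function \<gamma> u * (\<integral>T. of_real (T $ i) * exp (phase \<gamma> u T) \<partial>\<nu>)) (at 0)"
proof -
  let ?D = "\<integral>T. of_real (T $ i) * exp (phase \<gamma> u T) \<partial>\<nu>"
  have zero: "\<gamma> + axis i 0 = \<gamma>" by (simp add: vec_eq_iff axis_def)
  have "((\<lambda>z. exp_pairing (\<gamma> + axis i z) (vec_ln u) * exp_integral \<nu> (\<gamma> + axis i z) u) has_field_derivative
      of_real (ln (u $ i)) * Phi J l \<gamma> u + power_function \<gamma> u * ?D) (at 0)"
    unfolding exp_pairing_axis
    by (rule derivative_eq_intros exp_integral_has_field_derivative[OF tempered_nu \<gamma> u] refl)+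
       (simp add: zero Phi_eq[OF \<gamma> u] power_function_def vec_ln_def algebra_simps)
  \<comment> \<open>The product formula holds while \<open>\<gamma> + z e\<^sub>i\<close> stays in the right half-planes, that is, for \<open>z\<close> near zero.\<close>
  moreover have "eventually (\<lambda>z. Phi J l (\<gamma> + axis i z) u =
      exp_pairing (\<gamma> + axis i z) (vec_ln u) * exp_integral \<nu> (\<gamma> + axis i z) u) (nhds 0)"
    using eventually_gamma_domain[OF \<gamma>, of i] by eventually_elim (simp add: Phi_eq u)
  ultimately show ?thesis by (subst DERIV_cong_ev[OF refl _ refl]) auto
qed

lemma Phi_power_form:
  "\<gamma> \<in> gamma_domain \<Longrightarrow> u \<in> pos_orthant \<Longrightarrow> Phi J l \<gamma> u = power_function \<gamma> u * exp_integral \<nu> \<gamma> u"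
  by (simp add: Phi_eq power_function_def)

lemma smooth_Phi: "\<gamma> \<in> gamma_domain \<Longrightarrow> smooth (Phi J l \<gamma>)"
  by (rule smooth_cong[OF Phi_power_form smooth_mult[OF smooth_power_function smooth_exp_integral[OF tempered_nu]]])

text \<open>The ladder formula: the first term comes from the prefactor \<open>u\<^sup>\<gamma>\<close>, the second from the exponential.\<close>

lemma pd_Phi:
  assumes \<gamma>: "\<gamma> \<in> gamma_domain" and u: "u \<in> pos_orthant"
  shows "of_real (u $ i) * pd i (Phi J l \<gamma>) u = \<gamma> $ i * Phi J l \<gamma> u - Phi J l (\<gamma> + axis i 1) u"
proof -
  have "pd i (Phi J l \<gamma>) u = pd i (\<lambda>u. power_function \<gamma> u * exp_integral \<nu> \<gamma> u) u"
    by (rule pd_cong[OF u Phi_power_form[OF \<gamma>]])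
  moreover have "u $ i \<noteq> 0" using u by (auto simp: pos_orthant_def dest: spec[of _ i])
  ultimately show ?thesis
    by (simp add: pd_power_exp_integral[OF tempered_nu \<gamma> u] Phi_power_form[OF \<gamma> u]
        Phi_power_form[OF gamma_domain_axis[OF \<gamma>] u] power_function_axis[OF u] right_diff_distrib)
qed

text \<open>The derivative at \<open>h = 0\<close> of the constant function \<open>h \<mapsto> \<Phi>(e\<^bsup>ln u + h z\<^esup>)\<close>, for a direction \<open>z\<close> in the kernel of
the lattice map.\<close>

lemma Phi_euler:
  assumes \<gamma>: "\<gamma> \<in> gamma_domain" and u: "u \<in> pos_orthant"
    and z: "lattice_map J l z = (\<lambda>\<alpha>\<in>J. 0)"
  shows "(\<Sum>i\<in>UNIV. of_real (z $ i) * (of_real (u $ i) * pd i (Phi J l \<gamma>) u)) = 0"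
proof -
  obtain D where D: "(Phi J l \<gamma> has_derivative D) (at u)"
    using smooth_differentiable[OF smooth_Phi[OF \<gamma>] u] by (auto simp: differentiable_def)
  define q where "q h = vec_exp (vec_ln u + h *\<^sub>R z)" for h
  have q0: "q 0 = u" by (simp add: q_def vec_exp_ln[OF u])
  have q': "(q has_derivative (\<lambda>h. h *\<^sub>R (\<chi> i. z $ i * u $ i))) (at 0)"
    unfolding has_derivative_componentwise_within[of q]
  proof
    fix b :: "real ^ 'n" assume "b \<in> Basis"
    then obtain k where b: "b = axis k 1" by (auto simp: Basis_vec_def)
    have "exp (ln (u $ k)) = u $ k" using u by (simp add: pos_orthant_def)
    then show "((\<lambda>x. q x \<bullet> b) has_derivative (\<lambda>x. (x *\<^sub>R (\<chi> i. z $ i * u $ i)) \<bullet> b)) (at 0)"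
      unfolding b by (auto simp: inner_axis q_def vec_exp_def vec_ln_def intro!: derivative_eq_intros)
  qed
  have "((\<lambda>h. Phi J l \<gamma> (q h)) has_derivative (\<lambda>h. D (h *\<^sub>R (\<chi> i. z $ i * u $ i)))) (at 0)"
    by (rule has_derivative_compose[OF q']) (simp add: q0 D)
  moreover have "Phi J l \<gamma> (q h) = Phi J l \<gamma> u" for h
  proof -
    have "lattice_map J l (h *\<^sub>R z) = (\<lambda>\<alpha>\<in>J. 0)"
    proof (rule lattice_map_eqI)
      fix \<alpha> assume "\<alpha> \<in> J"
      then show "real_vec (l \<alpha>) \<bullet> (h *\<^sub>R z) = (\<lambda>\<alpha>\<in>J. 0) \<alpha>"
        using lattice_map_real_vec[of \<alpha> J l z] z by simp
    qed simp
    from Phi_translate_kernel[OF \<gamma> this, of "vec_ln u"] show ?thesis by (simp add: q_def vec_exp_ln[OF u])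
  qed
  ultimately have "((\<lambda>h::real. Phi J l \<gamma> u) has_derivative (\<lambda>h. D (h *\<^sub>R (\<chi> i. z $ i * u $ i)))) (at 0)"
    by simp
  then have "(\<lambda>h. D (h *\<^sub>R (\<chi> i. z $ i * u $ i))) = (\<lambda>h::real. 0)"
    using has_derivative_unique[OF _ has_derivative_const] by blast
  then have "D (1 *\<^sub>R (\<chi> i. z $ i * u $ i)) = 0" by meson
  then show ?thesis
    by (simp add: has_derivative_pd_sum[OF D] scaleR_conv_of_real mult.assoc)
qed

lemma Phi_gg_solution:
  assumes span: "zvec.span (l ` J) = relation_lattice a"
  shows "gg_solution a (Phi J l)"
  unfolding gg_solution_def
proof (intro ballI conjI allI impI)
  fix \<gamma> :: "complex ^ 'n" assume \<gamma>: "\<gamma> \<in> gamma_domain"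
  show "smooth (Phi J l \<gamma>)" by (rule smooth_Phi[OF \<gamma>])
  fix u :: "real ^ 'n" assume u: "u \<in> pos_orthant"
  show "(\<lambda>z. Phi J l (\<gamma> + axis i z) u) field_differentiable (at 0)" for i
    using Phi_has_field_derivative[OF \<gamma> u] by (auto simp: field_differentiable_def)
  have kernel: "lattice_map J l (\<chi> i. of_int (a i $ s)) = (\<lambda>\<alpha>\<in>J. 0)" for s
  proof (rule lattice_map_eqI)
    fix \<alpha> assume \<alpha>: "\<alpha> \<in> J"
    then have "l \<alpha> \<in> relation_lattice a" using zvec.span_superset span by blast
    then have "(\<Sum>i\<in>UNIV. l \<alpha> $ i *s a i) $ s = 0" by (simp add: relation_lattice_def)
    then have "(\<Sum>i\<in>UNIV. l \<alpha> $ i * a i $ s) = 0" by simp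
    then have "real_of_int (\<Sum>i\<in>UNIV. l \<alpha> $ i * a i $ s) = 0" by simp
    then show "real_vec (l \<alpha>) \<bullet> (\<chi> i. of_int (a i $ s)) = (\<lambda>\<alpha>\<in>J. 0) \<alpha>"
      using \<alpha> by (simp add: real_vec_def inner_vec_def)
  qed simp
  show euler: "(\<Sum>i\<in>UNIV. of_int (a i $ s) * of_real (u $ i) * pd i (Phi J l \<gamma>) u) = 0" for s
    using Phi_euler[OF \<gamma> u kernel, of s] by (simp add: mult.assoc)
  show "(\<Sum>i\<in>UNIV. of_int (a i $ s) * (Phi J l (\<gamma> + axis i 1) u - \<gamma> $ i * Phi J l \<gamma> u)) = 0" for s
  proof -
    have "of_int (a i $ s) * (Phi J l (\<gamma> + axis i 1) u - \<gamma> $ i * Phi J l \<gamma> u)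
        = - (of_int (a i $ s) * of_real (u $ i) * pd i (Phi J l \<gamma>) u)" for i
      using pd_Phi[OF \<gamma> u, of i] by (simp add: mult.assoc right_diff_distrib)
    then show ?thesis using euler[of s] by (simp add: sum_negf)
  qed
  fix v assume v: "v \<in> relation_lattice a"
  then have v0: "AE T in \<nu>. (\<Sum>i\<in>UNIV. of_int (v $ i) * T $ i) = (0::real)"
    using relation_vanishes_on_fibre span by blast
  show "foldr (gg_op \<gamma>) ks (Phi J l \<gamma>) u = foldr (gg_op \<gamma>) ks' (Phi J l \<gamma>) u"
    if "list_for (\<lambda>i. nat (- v $ i)) ks" "list_for (\<lambda>i. nat (v $ i)) ks'" for ks ks'
  proof -
    have "(\<gamma> + shift_by ks') $ i - (\<gamma> + shift_by ks) $ i = of_int (v $ i)" for i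
      using that by (cases "v $ i \<ge> 0") (simp_all add: shift_by_def list_for_def)
    then have "exp_integral \<nu> (\<gamma> + shift_by ks) u = exp_integral \<nu> (\<gamma> + shift_by ks') u"
      by (rule exp_integral_shift[OF sets_nu v0])
    then show ?thesis
      using gg_op_iterated[OF tempered_nu \<gamma> Phi_power_form[OF \<gamma>] u] by simp
  qed
  show "(\<Sum>i\<in>UNIV. of_int (v $ i) * (deriv (\<lambda>z. Phi J l (\<gamma> + axis i z) u) 0 - of_real (ln (u $ i)) * Phi J l \<gamma> u)) = 0"
  proof -
    have "(\<Sum>i\<in>UNIV. of_int (v $ i) * (deriv (\<lambda>z. Phi J l (\<gamma> + axis i z) u) 0 - of_real (ln (u $ i)) * Phi J l \<gamma> u))
        = power_function \<gamma> u * (\<Sum>i\<in>UNIV. of_int (v $ i) * (\<integral>T. of_real (T $ i) * exp (phase \<gamma> u T) \<partial>\<nu>))"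
      by (simp add: DERIV_imp_deriv[OF Phi_has_field_derivative[OF \<gamma> u]] sum_distrib_left mult_ac)
    also have "(\<Sum>i\<in>UNIV. of_int (v $ i) * (\<integral>T. of_real (T $ i) * exp (phase \<gamma> u T) \<partial>\<nu>))
        = (\<integral>T. (\<Sum>i\<in>UNIV. of_int (v $ i) * (of_real (T $ i) * exp (phase \<gamma> u T))) \<partial>\<nu>)"
      using integrable_coordinate_phase[OF tempered_nu \<gamma> u]
      by (subst Bochner_Integration.integral_sum) simp_all
    also have "\<dots> = (\<integral>T. 0 \<partial>\<nu>)"
    proof (rule integral_cong_AE)
      show "AE T in \<nu>. (\<Sum>i\<in>UNIV. of_int (v $ i) * (of_real (T $ i) * exp (phase \<gamma> u T))) = 0"
        using v0
      proof eventually_elim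
        case (elim T)
        have "(\<Sum>i\<in>UNIV. of_int (v $ i) * (of_real (T $ i) * exp (phase \<gamma> u T)))
            = of_real (\<Sum>i\<in>UNIV. of_int (v $ i) * T $ i) * exp (phase \<gamma> u T)"
          by (simp add: sum_distrib_right mult.assoc)
        then show ?case by (simp add: elim)
      qed
    qed (use integrable_coordinate_phase[OF tempered_nu \<gamma> u] in \<open>auto intro!: borel_measurable_sum borel_measurable_times\<close>)
    finally show ?thesis by simp
  qed
qed

end

section \<open>The matrix element\<close>

lemma power_div_fact_le_exp:
  fixes x :: real
  assumes "0 \<le> x" shows "x ^ n / fact n \<le> exp x"
proof -
  have "(\<Sum>k\<in>{n}. x ^ k /\<^sub>R fact k) \<le> (\<Sum>k. x ^ k /\<^sub>R fact k)"
    using assms by (intro sum_le_suminf[OF summable_exp_generic]) auto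
  then show ?thesis by (simp add: exp_def divide_inverse mult.commute)
qed

text \<open>Half of the exponential decay bounds the powers of the coordinates, and the other half tends to
zero at infinity because \<open>\<Sum>\<^sub>i t\<^sub>i \<ge> \<parallel>t\<parallel>\<close> on the orthant.\<close>

lemma exponential_decays:
  fixes k :: "real ^ 'n::finite"
  assumes k: "k \<in> pos_orthant"
  shows "decays (\<lambda>t. c * exp (- (\<Sum>i\<in>UNIV. of_real (k $ i * t $ i))))"
  unfolding decays_def
proof
  fix n :: "'n \<Rightarrow> nat"
  let ?F = "inf at_infinity (principal pos_orthant) :: (real ^ 'n) filter"
  define m where "m = Min (range (\<lambda>i. k $ i))"
  have m: "0 < m" "\<And>i. m \<le> k $ i"
    using k by (auto simp: m_def pos_orthant_def)
  \<comment> \<open>\<open>y\<^sup>n / n! \<le> e\<^sup>y\<close> at \<open>y = m x / 2\<close>.\<close>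
  have "\<exists>C. \<forall>x\<ge>0. x ^ n i * exp (- (m / 2 * x)) \<le> C" for i
  proof (intro exI[of _ "fact (n i) * (2 / m) ^ n i"] allI impI)
    fix x :: real assume x: "0 \<le> x"
    have "(m / 2 * x) ^ n i / fact (n i) \<le> exp (m / 2 * x)"
      using x m(1) by (intro power_div_fact_le_exp) simp
    then have "(m / 2 * x) ^ n i * exp (- (m / 2 * x)) \<le> fact (n i)"
      by (simp add: exp_minus field_simps)
    then have "(2 / m) ^ n i * ((m / 2 * x) ^ n i * exp (- (m / 2 * x))) \<le> (2 / m) ^ n i * fact (n i)"
      using m(1) by (intro mult_left_mono) auto
    also have "(2 / m) ^ n i * ((m / 2 * x) ^ n i * exp (- (m / 2 * x))) = x ^ n i * exp (- (m / 2 * x))"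
      using m(1) by (simp add: power_mult_distrib[symmetric] mult.assoc[symmetric])
    finally show "x ^ n i * exp (- (m / 2 * x)) \<le> fact (n i) * (2 / m) ^ n i" by (simp add: mult.commute)
  qed
  then obtain C where C: "\<And>i x. 0 \<le> x \<Longrightarrow> x ^ n i * exp (- (m / 2 * x)) \<le> C i" by metis
  have bound: "norm ((\<Prod>i\<in>UNIV. t $ i ^ n i) * norm (c * exp (- (\<Sum>i\<in>UNIV. complex_of_real (k $ i * t $ i)))))
      \<le> norm c * (\<Prod>i\<in>UNIV. C i) * exp (- (m / 2 * norm t))" if t: "t \<in> pos_orthant" for t
  proof -
    have t0: "0 \<le> t $ i" for i using t by (simp add: pos_orthant_def less_imp_le)
    have "norm t \<le> (\<Sum>i\<in>UNIV. t $ i)"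
      using norm_le_l1_cart[of t] t0 by simp
    then have n: "exp (- (m / 2 * (\<Sum>i\<in>UNIV. t $ i))) \<le> exp (- (m / 2 * norm t))"
      using m(1) by simp
    have "(\<Prod>i\<in>UNIV. t $ i ^ n i) * norm (exp (- (\<Sum>i\<in>UNIV. complex_of_real (k $ i * t $ i))))
        = (\<Prod>i\<in>UNIV. t $ i ^ n i * exp (- (k $ i * t $ i)))"
    proof -
      have "norm (exp (- (\<Sum>i\<in>UNIV. complex_of_real (k $ i * t $ i)))) = exp (\<Sum>i\<in>UNIV. - (k $ i * t $ i))"
        by (simp add: sum_negf)
      then show ?thesis by (simp add: exp_sum prod.distrib)
    qed
    also have "\<dots> \<le> (\<Prod>i\<in>UNIV. C i * exp (- (m / 2 * t $ i)))"
    proof (intro prod_mono conjI)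
      fix i
      show "0 \<le> t $ i ^ n i * exp (- (k $ i * t $ i))" using t0 by simp
      have "exp (- (k $ i * t $ i)) \<le> exp (- (m / 2 * t $ i)) * exp (- (m / 2 * t $ i))"
        using mult_right_mono[OF m(2)[of i] t0[of i]] by (simp add: exp_add[symmetric])
      then have "t $ i ^ n i * exp (- (k $ i * t $ i))
          \<le> (t $ i ^ n i * exp (- (m / 2 * t $ i))) * exp (- (m / 2 * t $ i))"
        using t0[of i] by (simp add: mult.assoc mult_left_mono)
      also have "\<dots> \<le> C i * exp (- (m / 2 * t $ i))"
        using C[OF t0] by (intro mult_right_mono) auto
      finally show "t $ i ^ n i * exp (- (k $ i * t $ i)) \<le> C i * exp (- (m / 2 * t $ i))" .
    qed
    also have "\<dots> = (\<Prod>i\<in>UNIV. C i) * exp (- (m / 2 * (\<Sum>i\<in>UNIV. t $ i)))"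
      by (simp add: prod.distrib exp_sum sum_distrib_left sum_negf[symmetric])
    also have "\<dots> \<le> (\<Prod>i\<in>UNIV. C i) * exp (- (m / 2 * norm t))"
    proof (rule mult_left_mono[OF n])
      have "0 \<le> C i" for i using C[of 1 i] by (smt (verit) exp_ge_zero mult_nonneg_nonneg power_one)
      then show "0 \<le> (\<Prod>i\<in>UNIV. C i)" by (intro prod_nonneg) auto
    qed
    finally have "norm c * ((\<Prod>i\<in>UNIV. t $ i ^ n i) * norm (exp (- (\<Sum>i\<in>UNIV. complex_of_real (k $ i * t $ i)))))
        \<le> norm c * ((\<Prod>i\<in>UNIV. C i) * exp (- (m / 2 * norm t)))" by (rule mult_left_mono) simp
    moreover have "0 \<le> (\<Prod>i\<in>UNIV. t $ i ^ n i)" using t0 by (intro prod_nonneg) simp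
    ultimately show ?thesis by (simp add: norm_mult abs_mult mult_ac)
  qed
  show "((\<lambda>t. (\<Prod>i\<in>UNIV. t $ i ^ n i) * norm (c * exp (- (\<Sum>i\<in>UNIV. complex_of_real (k $ i * t $ i))))) \<longlongrightarrow> 0) ?F"
  proof (rule Lim_null_comparison)
    show "eventually (\<lambda>t. norm ((\<Prod>i\<in>UNIV. t $ i ^ n i) * norm (c * exp (- (\<Sum>i\<in>UNIV. complex_of_real (k $ i * t $ i)))))
        \<le> norm c * (\<Prod>i\<in>UNIV. C i) * exp (- (m / 2 * norm t))) ?F"
      using eventually_orthant_at_infinity by eventually_elim (rule bound)
    have "filterlim (\<lambda>t::real ^ 'n. m / 2 * norm t) at_top at_infinity"
      using m(1) by (intro filterlim_tendsto_pos_mult_at_top[OF tendsto_const] filterlim_norm_at_top) auto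
    then have "((\<lambda>t::real ^ 'n. exp (- (m / 2 * norm t))) \<longlongrightarrow> 0) at_infinity"
      by (intro filterlim_compose[OF exp_at_bot]) (simp add: filterlim_uminus_at_bot)
    then have "((\<lambda>t::real ^ 'n. norm c * (\<Prod>i\<in>UNIV. C i) * exp (- (m / 2 * norm t))) \<longlongrightarrow> norm c * (\<Prod>i\<in>UNIV. C i) * 0) at_infinity"
      by (intro tendsto_mult tendsto_const)
    then have "((\<lambda>t::real ^ 'n. norm c * (\<Prod>i\<in>UNIV. C i) * exp (- (m / 2 * norm t))) \<longlongrightarrow> 0) at_infinity"
      by simp
    then show "((\<lambda>t::real ^ 'n. norm c * (\<Prod>i\<in>UNIV. C i) * exp (- (m / 2 * norm t))) \<longlongrightarrow> 0) ?F"
      by (rule tendsto_mono[OF inf_le1])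
  qed
qed

lemma exponential_rapid:
  fixes k :: "real ^ 'n::finite"
  assumes k: "k \<in> pos_orthant"
    and f: "\<And>t. t \<in> pos_orthant \<Longrightarrow> f t = c * exp (- (\<Sum>i\<in>UNIV. of_real (k $ i * t $ i)))"
  shows "f \<in> rapid_space"
proof -
  let ?e = "\<lambda>t::real ^ 'n. exp (- (\<Sum>i\<in>UNIV. complex_of_real (k $ i * t $ i)))"
  let ?C = "{f. \<exists>c. \<forall>t\<in>pos_orthant. f t = c * ?e t}"
  have der: "(?e has_derivative (\<lambda>v. ?e t * - (\<Sum>i\<in>UNIV. of_real (k $ i * v $ i)))) (at t)" for t
  proof -
    have "((\<lambda>t::real ^ 'n. - (\<Sum>i\<in>UNIV. complex_of_real (k $ i * t $ i))) has_derivative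
        (\<lambda>v. - (\<Sum>i\<in>UNIV. of_real (k $ i * v $ i)))) (at t)"
      by (intro has_derivative_minus has_derivative_sum has_derivative_of_real has_derivative_mult_right
          bounded_linear_imp_has_derivative bounded_linear_vec_nth)
    from has_derivative_compose[OF this, of exp "(*) (?e t)"] show ?thesis
      using DERIV_exp[of "- (\<Sum>i\<in>UNIV. complex_of_real (k $ i * t $ i))"]
      by (simp add: has_field_derivative_def)
  qed
  have d: "?e differentiable (at t)" for t using der by (auto simp: differentiable_def)
  have pd: "pd i ?e t = - of_real (k $ i) * ?e t" for i t
  proof -
    have "(\<Sum>j\<in>UNIV. complex_of_real (k $ j * axis i 1 $ j)) = (\<Sum>j\<in>UNIV. if i = j then of_real (k $ j) else 0)"
      by (intro sum.cong) (auto simp: axis_def)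
    then show ?thesis unfolding has_vector_derivative_pd[OF der] by simp
  qed
  show ?thesis
  proof (rule rapid_coinduct[of ?C])
    show "pd_stable ?C"
      unfolding pd_stable_def
    proof (intro ballI conjI allI)
      fix f i assume "f \<in> ?C"
      then obtain c where c: "\<And>t. t \<in> pos_orthant \<Longrightarrow> f t = c * ?e t" by blast
      show "f differentiable_on pos_orthant"
      proof (rule differentiable_on_orthant_cong[OF c])
        show "(\<lambda>t. c * ?e t) differentiable_on pos_orthant"
          unfolding differentiable_on_orthant_iff using differentiable_scale[OF d] by blast
      qed
      have "pd i f t = (- c * of_real (k $ i)) * ?e t" if "t \<in> pos_orthant" for t
      proof -
        have "pd i f t = pd i (\<lambda>t. c * ?e t) t" by (rule pd_cong[OF that c])
        then show ?thesis unfolding pd_scale[OF d] pd by simp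
      qed
      then show "\<exists>g\<in>?C. \<forall>t\<in>pos_orthant. pd i f t = g t" by blast
    qed
    show "decays f" if "f \<in> ?C" for f
      using that decays_cong[OF _ exponential_decays[OF k]] by blast
    show "f \<in> ?C" using f by blast
  qed
qed

theorem theorem3p1:
  fixes a :: "'n::finite \<Rightarrow> int ^ 'm::finite"
    and J :: "nat set"
    and l :: "nat \<Rightarrow> int ^ 'n"
    and \<gamma> :: "complex ^ 'n"
    and \<phi>\<^sub>R :: "real ^ 'n \<Rightarrow> complex"
    and \<phi>\<^sub>L :: "'n covector"
  assumes "gkz_config a"
    and "J = {1..CARD('n) - CARD('m)}"
    and "lattice_basis (relation_lattice a) J l"
    and "\<forall>i. 0 < Re (\<gamma> $ i)"
    and "right_vector \<gamma> \<phi>\<^sub>R"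
    and "left_vector a J l \<gamma> \<phi>\<^sub>L"
  shows "LN_representation rapid_space (rep \<gamma>) \<and>
    (\<forall>u\<in>pos_orthant. has_delta_integral J l (Phi_integrand \<gamma>)
       (lattice_map J l (vec_ln u)) (Phi J l \<gamma> u)) \<and>
    gg_solution a (Phi J l) \<and>
    (\<forall>y :: real ^ 'n.
       rep_exp \<gamma> y \<phi>\<^sub>R \<in> left_domain J l \<gamma> \<and>
       Phi J l \<gamma> (vec_exp y) = pairing \<phi>\<^sub>L (rep_exp \<gamma> y \<phi>\<^sub>R))"
proof -
  obtain w \<nu> where "lattice_fibre J l w \<nu>"
    using lattice_fibre_exists[OF assms(1-3)] by blast
  then interpret lattice_fibre J l w \<nu> .
  have \<gamma>: "\<gamma> \<in> gamma_domain" using assms(4) by (simp add: gamma_domain_def)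
  have span: "zvec.span (l ` J) = relation_lattice a" using assms(3) by (simp add: lattice_basis_def)
  have matrix_element: "rep_exp \<gamma> y \<phi>\<^sub>R \<in> left_domain J l \<gamma> \<and>
      Phi J l \<gamma> (vec_exp y) = pairing \<phi>\<^sub>L (rep_exp \<gamma> y \<phi>\<^sub>R)" for y
  proof -
    have \<phi>R: "\<phi>\<^sub>R t = exp (- (\<Sum>i\<in>UNIV. of_real (t $ i)))" if "t \<in> pos_orthant" for t
      using assms(5) that by (simp add: right_vector_def)
    have f: "rep_exp \<gamma> y \<phi>\<^sub>R t = exp_pairing \<gamma> y * exp (- (\<Sum>i\<in>UNIV. of_real (vec_exp y $ i * t $ i)))"
      if "t \<in> pos_orthant" for t
    proof -
      have "(\<chi> j. exp (y $ j) * t $ j) \<in> pos_orthant" using that by (simp add: pos_orthant_def)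
      then show ?thesis by (simp add: rep_exp_def exp_pairing_def \<phi>R vec_exp_def)
    qed
    have F: "monomial \<gamma> (vec_exp T) * rep_exp \<gamma> y \<phi>\<^sub>R (vec_exp T) = exp (phase \<gamma> ones (T + y))" for T
      unfolding f[OF vec_exp_pos_orthant] monomial_vec_exp exp_phase exp_pairing_add
      by (simp add: ones_def vec_exp_def exp_add mult_ac)
    have "rep_exp \<gamma> y \<phi>\<^sub>R \<in> rapid_space"
      by (rule exponential_rapid[OF vec_exp_pos_orthant f])
    then have dom: "rep_exp \<gamma> y \<phi>\<^sub>R \<in> left_domain J l \<gamma>"
      using translated_delta_integral(1)[OF \<gamma>, of "\<lambda>t. monomial \<gamma> t * rep_exp \<gamma> y \<phi>\<^sub>R t", OF F]
      unfolding left_domain_def by blast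
    then have "pairing \<phi>\<^sub>L (rep_exp \<gamma> y \<phi>\<^sub>R) = delta_integral J l (\<lambda>t. monomial \<gamma> t * rep_exp \<gamma> y \<phi>\<^sub>R t) (\<lambda>\<alpha>\<in>J. 0)"
      using assms(6) by (simp add: left_vector_def)
    also have "\<dots> = Phi J l \<gamma> (vec_exp y)"
      by (rule translated_delta_integral(2)[OF \<gamma> F])
    finally show ?thesis using dom by simp
  qed
  have "has_delta_integral J l (Phi_integrand \<gamma>) (lattice_map J l (vec_ln u)) (Phi J l \<gamma> u)" for u
    using Phi_integral_converges[OF \<gamma>, of "vec_ln u"] by (simp add: Phi_def)
  then show ?thesis
    using LN_representation_rapid_space Phi_gg_solution[OF span] matrix_element by blast
qed

end
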